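(* Let $\alpha_1,\dots,\alpha_n\ge 0$ satisfy $\min(\alpha_1,\alpha_n)>0$ and $\sum_{i=1}^n\alpha_i=1$, and let $0<\delta<\frac12$. Then there exists a constant $C>0$ depending only on $\delta$, $\alpha_1$ and $\alpha_n$ such that the following holds. Let $\Omega\subset\mathbb{R}^n$ be a bounded domain and let $u$ be a viscosity solution of $$\sum_{i=1}^n\alpha_i\lambda_i(D^2u)=0\quad\text{in }\Omega .$$ Then for every pair of concentric balls $B_r,B_{2r}$ with $B_{2r}\subset\Omega$ and all $x,z\in B_r$, $$|u(x)-u(z)|\le C\,\|u\|_{L^\infty(B_{2r})}\,\frac{|x-z|^\delta}{r^\delta}.$$
   Context: For a real symmetric $n\times n$ matrix $X$, $\lambda_1(X)\le\cdots\le\lambda_n(X)$ denote its ordered eigenvalues. $B_r,B_{2r}$ are open balls with the same center and radii $r,2r$. Viscosity solutions: an upper semicontinuous function $u:\overline\Omega\to\mathbb{R}$ is a viscosity subsolution of $\sum_i\alpha_i\lambda_i(D^2u)=0$ if for all $x\in\Omega$ and $\phi\in C^2(\Omega)$ such that $u(x)=\phi(x)$ and $u(y)<\phi(y)$ for $y\ne x$, one has $\sum_i\alpha_i\lambda_i(D^2\phi(x))\ge 0$. A lower semicontinuous function $u:\overline\Omega\to\mathbb{R}$ is a viscosity supersolution if for all $x\in\Omega$ and $\phi\in C^2(\Omega)$ such that $u(x)=\phi(x)$ and $u(y)>\phi(y)$ for $y\neq x$, one has $\sum_i\alpha_i\lambda_i(D^2\phi(x))\le 0$. A continuous function on $\overline\Omega$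 that is both is a viscosity solution. *)

theory Defs
  imports
    "HOL-Probability.Essential_Supremum"
    "Jordan_Normal_Form.Char_Poly"
begin

text \<open>
  The constant in the estimate has to be independent of the dimension, so the dimension \<open>n\<close> must be
  a term and not a type.  Points of \<open>\<real>\<^sup>n\<close> are therefore the elements of
  \<open>topspace (Euclidean_space n)\<close>, i.e. sequences \<open>x :: nat \<Rightarrow> real\<close> with \<open>x i = 0\<close> for \<open>i \<ge> n\<close>:
  coordinates are numbered \<open>0, \<dots>, n - 1\<close>.  The coefficients \<open>\<alpha>\<close> and the eigenvalues, on the other
  hand, are numbered \<open>1, \<dots>, n\<close>.
\<close>

definition euclid_dist :: "nat \<Rightarrow> (nat \<Rightarrow> real) \<Rightarrow> (nat \<Rightarrow> real) \<Rightarrow> real" where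
  "euclid_dist n x y = L2_set (\<lambda>i. x i - y i) {..<n}"

definition euclid_ball :: "nat \<Rightarrow> (nat \<Rightarrow> real) \<Rightarrow> real \<Rightarrow> (nat \<Rightarrow> real) set" where
  "euclid_ball n c r = {x \<in> topspace (Euclidean_space n). euclid_dist n c x < r}"

definition bounded_domain :: "nat \<Rightarrow> (nat \<Rightarrow> real) set \<Rightarrow> bool" where
  "bounded_domain n \<Omega> \<longleftrightarrow>
     \<Omega> \<noteq> {} \<and> openin (Euclidean_space n) \<Omega> \<and> connectedin (Euclidean_space n) \<Omega> \<and>
     (\<exists>R. \<Omega> \<subseteq> euclid_ball n (\<lambda>_. 0) R)"

definition cont_on :: "nat \<Rightarrow> (nat \<Rightarrow> real) set \<Rightarrow> ((nat \<Rightarrow> real) \<Rightarrow> real) \<Rightarrow> bool" where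
  "cont_on n S f \<longleftrightarrow> continuous_map (subtopology (Euclidean_space n) S) euclideanreal f"

definition usc_on :: "nat \<Rightarrow> (nat \<Rightarrow> real) set \<Rightarrow> ((nat \<Rightarrow> real) \<Rightarrow> real) \<Rightarrow> bool" where
  "usc_on n S f \<longleftrightarrow> (\<forall>a. openin (subtopology (Euclidean_space n) S) {x \<in> S. f x < a})"

definition lsc_on :: "nat \<Rightarrow> (nat \<Rightarrow> real) set \<Rightarrow> ((nat \<Rightarrow> real) \<Rightarrow> real) \<Rightarrow> bool" where
  "lsc_on n S f \<longleftrightarrow> (\<forall>a. openin (subtopology (Euclidean_space n) S) {x \<in> S. f x > a})"

definition partial_differentiable :: "nat \<Rightarrow> ((nat \<Rightarrow> real) \<Rightarrow> real) \<Rightarrow> (nat \<Rightarrow> real) \<Rightarrow> bool" where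
  "partial_differentiable i f x \<longleftrightarrow> (\<lambda>t. f (x(i := t))) field_differentiable at (x i)"

definition partial_deriv :: "nat \<Rightarrow> ((nat \<Rightarrow> real) \<Rightarrow> real) \<Rightarrow> (nat \<Rightarrow> real) \<Rightarrow> real" where
  "partial_deriv i f x = deriv (\<lambda>t. f (x(i := t))) (x i)"

text \<open>
  \<open>C\<^sup>2(\<Omega>)\<close> for open \<open>\<Omega>\<close>.  At points of \<open>\<Omega>\<close> the partial derivatives depend only on the values of
  \<open>\<phi>\<close> in \<open>\<Omega>\<close>; the values outside are irrelevant.
\<close>

definition C2_on :: "nat \<Rightarrow> (nat \<Rightarrow> real) set \<Rightarrow> ((nat \<Rightarrow> real) \<Rightarrow> real) \<Rightarrow> bool" where
  "C2_on n \<Omega> \<phi> \<longleftrightarrow>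
     cont_on n \<Omega> \<phi> \<and>
     (\<forall>i<n. (\<forall>x\<in>\<Omega>. partial_differentiable i \<phi> x) \<and> cont_on n \<Omega> (partial_deriv i \<phi>)) \<and>
     (\<forall>i<n. \<forall>j<n. (\<forall>x\<in>\<Omega>. partial_differentiable i (partial_deriv j \<phi>) x) \<and>
                   cont_on n \<Omega> (partial_deriv i (partial_deriv j \<phi>)))"

definition hessian :: "nat \<Rightarrow> ((nat \<Rightarrow> real) \<Rightarrow> real) \<Rightarrow> (nat \<Rightarrow> real) \<Rightarrow> real mat" where
  "hessian n \<phi> x = mat n n (\<lambda>(i, j). partial_deriv i (partial_deriv j \<phi>) x)"

text \<open>
  The \<open>i\<close>-th smallest eigenvalue, \<open>1 \<le> i \<le> n\<close>, counted with multiplicity.  It is meaningful for real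
  symmetric matrices, whose characteristic polynomial has \<open>n\<close> real roots.
\<close>

definition ordered_eigenvalue :: "nat \<Rightarrow> real mat \<Rightarrow> real" where
  "ordered_eigenvalue i A = sorted_list_of_multiset (proots (char_poly A)) ! (i - 1)"

definition weighted_eigenvalue_sum :: "nat \<Rightarrow> (nat \<Rightarrow> real) \<Rightarrow> real mat \<Rightarrow> real" where
  "weighted_eigenvalue_sum n \<alpha> A = (\<Sum>i=1..n. \<alpha> i * ordered_eigenvalue i A)"

definition viscosity_subsolution ::
    "nat \<Rightarrow> (nat \<Rightarrow> real) \<Rightarrow> (nat \<Rightarrow> real) set \<Rightarrow> ((nat \<Rightarrow> real) \<Rightarrow> real) \<Rightarrow> bool" where
  "viscosity_subsolution n \<alpha> \<Omega> u \<longleftrightarrow>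
     usc_on n (Euclidean_space n closure_of \<Omega>) u \<and>
     (\<forall>x\<in>\<Omega>. \<forall>\<phi>. C2_on n \<Omega> \<phi> \<and> u x = \<phi> x \<and> (\<forall>y\<in>\<Omega>. y \<noteq> x \<longrightarrow> u y < \<phi> y) \<longrightarrow>
        weighted_eigenvalue_sum n \<alpha> (hessian n \<phi> x) \<ge> 0)"

definition viscosity_supersolution ::
    "nat \<Rightarrow> (nat \<Rightarrow> real) \<Rightarrow> (nat \<Rightarrow> real) set \<Rightarrow> ((nat \<Rightarrow> real) \<Rightarrow> real) \<Rightarrow> bool" where
  "viscosity_supersolution n \<alpha> \<Omega> u \<longleftrightarrow>
     lsc_on n (Euclidean_space n closure_of \<Omega>) u \<and>
     (\<forall>x\<in>\<Omega>. \<forall>\<phi>. C2_on n \<Omega> \<phi> \<and> u x = \<phi> x \<and> (\<forall>y\<in>\<Omega>. y \<noteq> x \<longrightarrow> u y > \<phi> y) \<longrightarrow>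
        weighted_eigenvalue_sum n \<alpha> (hessian n \<phi> x) \<le> 0)"

definition viscosity_solution ::
    "nat \<Rightarrow> (nat \<Rightarrow> real) \<Rightarrow> (nat \<Rightarrow> real) set \<Rightarrow> ((nat \<Rightarrow> real) \<Rightarrow> real) \<Rightarrow> bool" where
  "viscosity_solution n \<alpha> \<Omega> u \<longleftrightarrow>
     cont_on n (Euclidean_space n closure_of \<Omega>) u \<and>
     viscosity_subsolution n \<alpha> \<Omega> u \<and> viscosity_supersolution n \<alpha> \<Omega> u"

text \<open>
  Lebesgue measure on \<open>\<real>\<^sup>n\<close>: the library's product measure lives on sequences that are \<open>undefined\<close>
  off \<open>{..<n}\<close>, and is transported to those that vanish off \<open>{..<n}\<close>.
\<close>

definition zero_extend :: "nat \<Rightarrow> (nat \<Rightarrow> real) \<Rightarrow> nat \<Rightarrow> real" where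
  "zero_extend n x = (\<lambda>i. if i < n then x i else 0)"

lemma zero_extend_measurable:
  "zero_extend n \<in> (\<Pi>\<^sub>M i\<in>{..<n}. lborel) \<rightarrow>\<^sub>M borel"
proof (rule measurable_coordinatewise_then_product)
  fix i show "(\<lambda>x. zero_extend n x i) \<in> borel_measurable (\<Pi>\<^sub>M i\<in>{..<n}. lborel)"
    by (cases "i < n") (simp_all add: zero_extend_def)
qed

definition lborel_Rn :: "nat \<Rightarrow> (nat \<Rightarrow> real) measure" where
  "lborel_Rn n = distr (\<Pi>\<^sub>M i\<in>{..<n}. lborel) borel (zero_extend n)"

definition Linfty_norm :: "nat \<Rightarrow> (nat \<Rightarrow> real) set \<Rightarrow> ((nat \<Rightarrow> real) \<Rightarrow> real) \<Rightarrow> ereal" where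
  "Linfty_norm n S u = esssup (restrict_space (lborel_Rn n) S) (\<lambda>x. ereal \<bar>u x\<bar>)"

end

theory Submission
  imports Defs "HOL-Real_Asymp.Real_Asymp"
begin

text \<open>
  This is the Ishii-Lions method: one maximises \<open>u x - u z - L \<bar>x - z\<bar>\<^sup>\<delta> - M (\<bar>x - x\<^sub>0\<bar>\<^sup>2 + \<bar>z - x\<^sub>0\<bar>\<^sup>2)\<close>
  and compares the Hessians \<open>X\<close>, \<open>Y\<close> of the test functions at a maximum.  With \<open>\<kappa> = L \<delta> \<bar>x - z\<bar>\<^bsup>\<delta> - 2\<^esup>\<close>
  they satisfy, up to errors of order \<open>M\<close>, the bounds \<open>X \<le> Y\<close>, \<open>X \<le> \<kappa>\<close>, \<open>Y \<ge> - \<kappa>\<close> and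
  \<open>\<langle>X e, e\<rangle> - \<langle>Y e, e\<rangle> \<le> - 4 (1 - \<delta>) \<kappa>\<close> for \<open>e = (x - z) / \<bar>x - z\<bar>\<close>.  For \<open>\<delta> < 1/2\<close> the last one forces
  the smallest or the largest eigenvalue of \<open>X\<close> to be at least \<open>(1 - 2 \<delta>) \<kappa>\<close> below that of \<open>Y\<close>, which
  contradicts the equation when \<open>L\<close> is large compared with \<open>M\<close> and \<open>min \<alpha>\<^sub>1 \<alpha>\<^sub>n\<close> is positive.

  The existence of \<open>X\<close> and \<open>Y\<close> (the theorem on sums) is obtained without Alexandrov's theorem.  After
  a sup-convolution, \<open>W (x, z) = u x - u z\<close> is semiconvex.  Among all upper second order jets of \<open>W\<close>
  near the maximum, one that almost minimises a suitable elliptic functional of its Hessian nearly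
  coincides with \<open>W\<close> on a whole ball, since otherwise Hopf's barrier would yield a better jet.  As \<open>W\<close>
  splits, the Hessian of such a jet is nearly block diagonal.
\<close>

section \<open>The space of finitely supported sequences\<close>

text \<open>The regularisation is fixed once and never sent to a limit. Moving both arguments of the
  sup-convolution's penalty by the same vector leaves it unchanged, so a jet of the regularised
  function is also a jet of \<open>u\<close> at a nearby point. The equation sees only the Hessian,
  hence the displaced base point is harmless while it stays in the ball of radius
  \<open>2 * r\<close>. The almost minimal jet is held by two opposing facts. Semiconvexity bounds
  the trace from below, so a large weight \<open>N\<close> makes the excess over \<open>A\<close>
  small. A jet of \<open>W\<close> minus the polynomial of a jet adds up with that jet to a jet of
  \<open>W\<close>, so a barrier whose gain is the same at all scales would push the functional
  below its infimum. Near block diagonality then comes from the mixed second differences of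
  \<open>W\<close>, which vanish identically. The weight, the barrier and the semiconvexity constant
  depend on the dimension and on \<open>u\<close>, but they only serve to reach an error
  \<open>\<theta>\<close> prescribed beforehand. This is why the final constant does not see the
  dimension.\<close>

text \<open>
  One inner product space containing every \<open>\<real>\<^sup>n\<close>: the dimension \<open>n\<close> is a term, so the Euclidean space
  types of the library are not applicable.
\<close>

typedef fsv = "{f :: nat \<Rightarrow> real. finite {i. f i \<noteq> 0}}"
  morphisms coord Abs_fsv
  by (rule exI[of _ "\<lambda>_. 0"]) simp

setup_lifting type_definition_fsv

lemma finite_coord: "finite {i. coord x i \<noteq> 0}"
  using coord[of x] by simp

lemma fsv_eqI: "(\<And>i. coord x i = coord y i) \<Longrightarrow> x = y"
  by (simp add: coord_inject[symmetric] fun_eq_iff)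

instantiation fsv :: real_vector
begin

lift_definition zero_fsv :: fsv is "\<lambda>_. 0" by simp

lift_definition plus_fsv :: "fsv \<Rightarrow> fsv \<Rightarrow> fsv" is "\<lambda>f g i. f i + g i"
proof -
  fix f g :: "nat \<Rightarrow> real"
  assume "finite {i. f i \<noteq> 0}" "finite {i. g i \<noteq> 0}"
  then show "finite {i. f i + g i \<noteq> 0}"
    by (rule finite_subset[rotated, OF finite_UnI]) auto
qed

lift_definition minus_fsv :: "fsv \<Rightarrow> fsv \<Rightarrow> fsv" is "\<lambda>f g i. f i - g i"
proof -
  fix f g :: "nat \<Rightarrow> real"
  assume "finite {i. f i \<noteq> 0}" "finite {i. g i \<noteq> 0}"
  then show "finite {i. f i - g i \<noteq> 0}"
    by (rule finite_subset[rotated, OF finite_UnI]) auto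
qed

lift_definition uminus_fsv :: "fsv \<Rightarrow> fsv" is "\<lambda>f i. - f i" by simp

lift_definition scaleR_fsv :: "real \<Rightarrow> fsv \<Rightarrow> fsv" is "\<lambda>c f i. c * f i"
  by (erule rev_finite_subset) auto

instance
  by standard (transfer; simp add: fun_eq_iff algebra_simps)+

end

lemmas coord_simps [simp] =
  zero_fsv.rep_eq plus_fsv.rep_eq minus_fsv.rep_eq uminus_fsv.rep_eq scaleR_fsv.rep_eq

instantiation fsv :: real_inner
begin

definition inner_fsv :: "fsv \<Rightarrow> fsv \<Rightarrow> real"
  where "inner_fsv x y = (\<Sum>i | coord x i \<noteq> 0. coord x i * coord y i)"

definition norm_fsv :: "fsv \<Rightarrow> real" where "norm_fsv x = sqrt (inner x x)"

definition sgn_fsv :: "fsv \<Rightarrow> fsv" where "sgn_fsv x = x /\<^sub>R norm x"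

definition dist_fsv :: "fsv \<Rightarrow> fsv \<Rightarrow> real" where "dist_fsv x y = norm (x - y)"

definition uniformity_fsv :: "(fsv \<times> fsv) filter"
  where "uniformity_fsv = (INF e\<in>{0<..}. principal {(x, y). dist x y < e})"

definition open_fsv :: "fsv set \<Rightarrow> bool"
  where "open_fsv U \<longleftrightarrow> (\<forall>x\<in>U. \<forall>\<^sub>F (x', y) in uniformity. x' = x \<longrightarrow> y \<in> U)"

lemma inner_fsv_superset:
  assumes "finite A" "{i. coord x i \<noteq> 0} \<subseteq> A"
  shows "inner x y = (\<Sum>i\<in>A. coord x i * coord y i)"
  unfolding inner_fsv_def using assms by (intro sum.mono_neutral_left) auto

instance
proof
  fix x y z :: fsv and r :: real
  define A where "A = {i. coord x i \<noteq> 0} \<union> {i. coord y i \<noteq> 0}"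
  have A: "finite A" by (simp add: A_def finite_coord)
  have *: "inner u w = (\<Sum>i\<in>A. coord u i * coord w i)" if "u \<in> {x, y, x + y, r *\<^sub>R x}" for u w
    using that by (intro inner_fsv_superset[OF A]) (auto simp: A_def)
  show "inner x y = inner y x" by (simp add: * mult.commute)
  show "inner (x + y) z = inner x z + inner y z" by (simp add: * sum.distrib algebra_simps)
  show "inner (r *\<^sub>R x) y = r * inner x y" by (simp add: * sum_distrib_left algebra_simps)
  show "0 \<le> inner x x" by (simp add: * sum_nonneg)
  show "inner x x = 0 \<longleftrightarrow> x = 0"
    unfolding inner_fsv_def by (auto simp: sum_nonneg_eq_0_iff finite_coord intro!: fsv_eqI)
qed (rule dist_fsv_def sgn_fsv_def uniformity_fsv_def open_fsv_def norm_fsv_def)+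

end

definition Rn :: "nat \<Rightarrow> fsv set"
  where "Rn n = {x. \<forall>i\<ge>n. coord x i = 0}"

lift_definition axis_fsv :: "nat \<Rightarrow> fsv" is "\<lambda>i j. if j = i then 1 else 0" by simp

lemma coord_axis: "coord (axis_fsv i) j = (if j = i then 1 else 0)"
  by transfer simp

lemma inner_Rn:
  assumes "x \<in> Rn n"
  shows "inner x y = (\<Sum>i<n. coord x i * coord y i)"
  by (rule inner_fsv_superset) (use assms leI in \<open>auto simp: Rn_def\<close>)

lemma axis_in_Rn: "i < n \<Longrightarrow> axis_fsv i \<in> Rn n"
  by (auto simp: Rn_def coord_axis)

lemma inner_axis_fsv: "inner x (axis_fsv i) = coord x i"
  by (subst inner_commute, subst inner_Rn[OF axis_in_Rn[of i "Suc i"]])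
     (simp_all add: coord_axis if_distrib[of "\<lambda>t. t * _"] cong: if_cong)

lemma norm_axis_fsv: "norm (axis_fsv i) = 1"
  by (simp add: norm_eq_sqrt_inner inner_axis_fsv coord_axis)

lemma inj_axis: "inj axis_fsv"
  by (rule injI) (metis coord_axis zero_neq_one)

lemma subspace_Rn: "subspace (Rn n)"
  by (auto simp: subspace_def Rn_def)

lemma coord_sum: "coord (\<Sum>i\<in>A. f i) j = (\<Sum>i\<in>A. coord (f i) j)"
  by (induction A rule: infinite_finite_induct) auto

lemma Rn_expand:
  assumes "x \<in> Rn n"
  shows "x = (\<Sum>i<n. coord x i *\<^sub>R axis_fsv i)"
proof (rule fsv_eqI)
  fix j
  show "coord x j = coord (\<Sum>i<n. coord x i *\<^sub>R axis_fsv i) j"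
    using assms by (auto simp: coord_sum coord_axis Rn_def if_distrib[of "\<lambda>t. _ * t"] cong: if_cong)
qed

lemma continuous_on_coord [continuous_intros]: "continuous_on A (\<lambda>x. coord x i)"
  unfolding inner_axis_fsv[symmetric] by (intro continuous_intros)

lemma continuous_on_coord_fun: "continuous_on A coord"
  by (rule continuous_on_coordinatewise_then_product) (rule continuous_on_coord)

text \<open>Bounded closed sets of the infinite-dimensional type \<open>fsv\<close> need not be
  compact, so compactness is built one dimension at a time: the box in \<open>Rn (Suc n)\<close> is
  a continuous image of the box in \<open>Rn n\<close> times an interval.\<close>

lemma compact_Rn_box: "compact {x \<in> Rn n. \<forall>i. \<bar>coord x i\<bar> \<le> R}"
proof (induction n)
  case 0
  have "{x \<in> Rn 0. \<forall>i. \<bar>coord x i\<bar> \<le> R} \<subseteq> {0}"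
    by (auto simp: Rn_def intro!: fsv_eqI)
  then show ?case by (meson finite.simps finite_imp_compact finite_subset)
next
  case (Suc n)
  let ?B = "\<lambda>n. {x \<in> Rn n. \<forall>i. \<bar>coord x i\<bar> \<le> R}"
  have "compact ((\<lambda>(x, t). x + t *\<^sub>R axis_fsv n) ` (?B n \<times> {-R..R}))"
    by (intro compact_continuous_image compact_Times Suc compact_Icc)
       (auto simp: split_def intro!: continuous_intros)
  moreover have "?B (Suc n) = (\<lambda>(x, t). x + t *\<^sub>R axis_fsv n) ` (?B n \<times> {-R..R})" (is "_ = ?I")
  proof (intro subset_antisym subsetI)
    fix x assume x: "x \<in> ?B (Suc n)"
    let ?y = "x - coord x n *\<^sub>R axis_fsv n"
    have "?y \<in> ?B n"
    proof -
      have "\<bar>coord x i\<bar> \<le> R" for i using x by simp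
      moreover from this[of n] have "0 \<le> R" by linarith
      moreover have "coord x i = 0" if "i \<ge> n" "i \<noteq> n" for i using that x by (auto simp: Rn_def)
      ultimately show ?thesis by (auto simp: Rn_def coord_axis)
    qed
    moreover have "coord x n \<in> {-R..R}" using x by (auto simp: abs_le_iff) (metis minus_le_iff)
    ultimately show "x \<in> ?I" by (intro image_eqI[of _ _ "(?y, coord x n)"]) auto
  next
    fix x assume "x \<in> ?I"
    then obtain y t where *: "x = y + t *\<^sub>R axis_fsv n" "y \<in> ?B n" "\<bar>t\<bar> \<le> R" by (auto simp: abs_le_iff)
    moreover have "coord y n = 0" using * by (auto simp: Rn_def)
    ultimately show "x \<in> ?B (Suc n)" by (auto simp: Rn_def coord_axis)
  qed
  ultimately show ?case by simp
qed

lemma abs_coord_le: "\<bar>coord x i\<bar> \<le> norm x"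
  using Cauchy_Schwarz_ineq2[of x "axis_fsv i"] by (simp add: inner_axis_fsv norm_axis_fsv)

lemma compact_Rn_cball: "compact (Rn n \<inter> cball c R)"
proof -
  have le: "\<bar>coord x i\<bar> \<le> norm c + R" if "x \<in> cball c R" for x i
  proof -
    have "norm x \<le> norm c + R"
      using that norm_triangle_sub[of x c] by (simp add: dist_norm norm_minus_commute)
    then show ?thesis using abs_coord_le[of x i] by linarith
  qed
  have "Rn n \<inter> cball c R = {x \<in> Rn n. \<forall>i. \<bar>coord x i\<bar> \<le> norm c + R} \<inter> cball c R"
    using le by blast
  then show ?thesis by (simp add: compact_Int_closed compact_Rn_box)
qed

section \<open>Second order jets and Hopf's barrier\<close>

text \<open>The inequality holds exactly on a small ball, without a remainder of order
  \<open>o((norm h)\<^sup>2)\<close>. Jets can thus be added and moved without error terms; the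
  price is a small multiple of the identity whenever a jet comes from a Taylor expansion.\<close>

definition upper_jet ::
  "'b::real_inner set \<Rightarrow> ('b \<Rightarrow> real) \<Rightarrow> 'b \<Rightarrow> 'b \<Rightarrow> ('b \<Rightarrow> 'b \<Rightarrow> real) \<Rightarrow> bool" where
  "upper_jet T W y p B \<longleftrightarrow>
     (\<exists>s>0. \<forall>h\<in>T. norm h < s \<longrightarrow> W (y + h) \<le> W y + inner p h + B h h / 2)"

definition symmetric_form :: "('b::real_vector \<Rightarrow> 'b \<Rightarrow> real) \<Rightarrow> bool" where
  "symmetric_form B \<longleftrightarrow> bilinear B \<and> (\<forall>x y. B x y = B y x)"

lemma symmetric_form_simps:
  assumes "symmetric_form B"
  shows "B (x + y) z = B x z + B y z" "B z (x + y) = B z x + B z y"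
    "B (x - y) z = B x z - B y z" "B z (x - y) = B z x - B z y"
    "B (c *\<^sub>R x) y = c * B x y" "B y (c *\<^sub>R x) = c * B y x"
    "B (- x) y = - B x y" "B y (- x) = - B y x" "B 0 y = 0" "B y 0 = 0"
  using assms
  by (simp_all add: symmetric_form_def bilinear_ladd bilinear_radd bilinear_lsub bilinear_rsub
      bilinear_lmul bilinear_rmul bilinear_lneg bilinear_rneg bilinear_lzero bilinear_rzero)

lemma symmetric_form_commute: "symmetric_form B \<Longrightarrow> B x y = B y x"
  by (auto simp: symmetric_form_def)

lemma symmetric_form_linear: "symmetric_form B \<Longrightarrow> linear (B x)"
  by (simp add: symmetric_form_def bilinear_def)

lemma symmetric_formI:
  assumes "\<And>x. linear (B x)" "\<And>x y. B x y = B y x"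
  shows "symmetric_form B"
proof -
  have "(\<lambda>x. B x y) = B y" for y using assms(2) by auto
  then show ?thesis using assms by (simp add: symmetric_form_def bilinear_def)
qed

lemma symmetric_form_add:
  "symmetric_form A \<Longrightarrow> symmetric_form B \<Longrightarrow> symmetric_form (\<lambda>x y. A x y + B x y)"
  by (intro symmetric_formI linear_compose_add) (auto simp: symmetric_form_def bilinear_def)

lemma symmetric_form_scale:
  "symmetric_form A \<Longrightarrow> symmetric_form (\<lambda>x y. c * A x y)"
  by (intro symmetric_formI linearI) (auto simp: symmetric_form_simps symmetric_form_commute algebra_simps)

lemma symmetric_form_inner: "symmetric_form inner"
  by (intro symmetric_formI) (auto simp: inner_commute intro!: linearI inner_add_right)

lemma symmetric_form_inner_prod: "symmetric_form (\<lambda>x y. inner g x * inner g y)"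
  by (intro symmetric_formI linearI) (auto simp: algebra_simps inner_add_right)

text \<open>A Euclidean space sitting inside a larger one, used for \<open>Rn n\<close> and for
  products \<open>T \<times> T\<close>. The set \<open>E\<close> is an orthonormal basis:
  orthogonality follows from \<open>norm_E\<close> and \<open>expand\<close>, since
  \<open>parseval\<close> applied to an element of \<open>E\<close> leaves nothing for the other
  ones.\<close>

locale frame =
  fixes T :: "'b::real_inner set" and E :: "'b set"
  assumes subspace: "subspace T"
    and finite_E: "finite E" and nonempty_E: "E \<noteq> {}" and E_subset: "E \<subseteq> T"
    and norm_E: "\<And>e. e \<in> E \<Longrightarrow> norm e = 1"
    and expand: "\<And>g. g \<in> T \<Longrightarrow> g = (\<Sum>e\<in>E. inner g e *\<^sub>R e)"
    and compact: "\<And>R. compact (T \<inter> cball 0 R)"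
begin

lemma T_simps [simp, intro]:
  "0 \<in> T" "x \<in> T \<Longrightarrow> y \<in> T \<Longrightarrow> x + y \<in> T" "x \<in> T \<Longrightarrow> y \<in> T \<Longrightarrow> x - y \<in> T"
  "x \<in> T \<Longrightarrow> c *\<^sub>R x \<in> T" "x \<in> T \<Longrightarrow> - x \<in> T"
  using subspace
  by (auto intro: subspace_0 subspace_add subspace_diff subspace_scale subspace_neg)

lemma parseval:
  assumes "g \<in> T"
  shows "(\<Sum>e\<in>E. (inner g e)\<^sup>2) = (norm g)\<^sup>2"
proof -
  have "inner g g = inner g (\<Sum>e\<in>E. inner g e *\<^sub>R e)" using expand[OF assms] by simp
  then show ?thesis unfolding power2_norm_eq_inner by (simp add: inner_sum_right power2_eq_square)
qed

lemma form_expand: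
  assumes B: "symmetric_form B" and "h \<in> T" "k \<in> T"
  shows "B h k = (\<Sum>e\<in>E. inner k e * B h e)"
proof -
  have "B h (\<Sum>e\<in>E. inner k e *\<^sub>R e) = (\<Sum>e\<in>E. inner k e * B h e)"
    using symmetric_form_linear[OF B] by (simp add: linear_sum linear_scale)
  then show ?thesis using expand[OF \<open>k \<in> T\<close>] by simp
qed

lemma form_representation:
  assumes "symmetric_form B" "h \<in> T"
  obtains b where "\<And>k. k \<in> T \<Longrightarrow> B h k = inner b k"
proof
  show "B h k = inner (\<Sum>e\<in>E. B h e *\<^sub>R e) k" if "k \<in> T" for k
    unfolding form_expand[OF assms that] inner_sum_left
    by (intro sum.cong) (auto simp: inner_commute)
qed

lemma continuous_on_form:
  assumes B: "symmetric_form B"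
  shows "continuous_on T (\<lambda>h. B h h)"
proof -
  have "B h h = (\<Sum>e\<in>E. inner h e * (\<Sum>f\<in>E. inner h f * B e f))" if "h \<in> T" for h
    using that E_subset
    by (subst form_expand[OF B that that], intro sum.cong)
       (auto simp: symmetric_form_commute[OF B, of h] form_expand[OF B])
  then show ?thesis
    by (subst continuous_on_cong[OF refl]) (auto intro!: continuous_intros)
qed

end

section \<open>A Gaussian barrier and the jets it yields\<close>

lemma exp_lower_quadratic:
  fixes s :: real
  assumes "\<bar>s\<bar> \<le> 1"
  shows "1 + s + s\<^sup>2 / 4 \<le> exp s"
proof -
  have "(1 + s / 2)\<^sup>2 \<le> (exp (s / 2))\<^sup>2"
    using assms by (intro power_mono exp_ge_add_one_self) auto
  also have "\<dots> = exp s" by (simp add: power2_eq_square flip: exp_add)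
  finally show ?thesis by (simp add: power2_eq_square algebra_simps)
qed

text \<open>The coefficients are weaker than those of Taylor's formula; the slack absorbs the higher order terms.\<close>

lemma barrier_expansion:
  fixes g :: "'b::real_inner" and a s :: real
  assumes "a > 0" "s > 0"
  obtains t where "t > 0"
    "\<And>k. norm k < t \<Longrightarrow>
      exp (- a * (norm (g + k))\<^sup>2 / s\<^sup>2) \<ge> exp (- a * (norm g)\<^sup>2 / s\<^sup>2) *
        (1 - 2 * a * inner g k / s\<^sup>2 - 2 * a * (norm k)\<^sup>2 / s\<^sup>2 + a\<^sup>2 * (inner g k)\<^sup>2 / (2 * s ^ 4))"
proof
  \<comment> \<open>The first entry, with the bound 1, gives
    \<open>\<bar>\<sigma>\<bar> \<le> 1\<close> as \<open>exp_lower_quadratic\<close> demands. The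
    last one makes \<open>a * (norm k)\<^sup>2 / s\<^sup>2\<close> at most 1, so that its square is
    absorbed by the term itself.\<close>
  define t where "t = min (s\<^sup>2 / (a * (2 * norm g + 1))) (min 1 (s / sqrt a))"
  have d: "2 * norm g + 1 > 0" using norm_ge_zero[of g] by linarith
  show "t > 0" using assms d by (simp add: t_def)
  fix k :: 'b assume k: "norm k < t"
  define \<sigma> where "\<sigma> = - a * (2 * inner g k + (norm k)\<^sup>2) / s\<^sup>2"
  have k1: "norm k \<le> 1" "norm k < s\<^sup>2 / (a * (2 * norm g + 1))" "norm k < s / sqrt a" using k by (auto simp: t_def)
  have "\<bar>2 * inner g k + (norm k)\<^sup>2\<bar> \<le> 2 * (norm g * norm k) + norm k * norm k"
    using Cauchy_Schwarz_ineq2[of g k] zero_le_square[of "norm k"]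
    unfolding abs_le_iff power2_eq_square by linarith
  also have "\<dots> \<le> (2 * norm g + 1) * norm k"
    using k1(1) mult_right_mono[of "norm k" 1 "norm k"] by (simp add: algebra_simps)
  finally have "\<bar>2 * inner g k + (norm k)\<^sup>2\<bar> \<le> (2 * norm g + 1) * norm k" .
  then have "a * \<bar>2 * inner g k + (norm k)\<^sup>2\<bar> \<le> a * ((2 * norm g + 1) * norm k)"
    using assms by simp
  also have "\<dots> \<le> s\<^sup>2" using k1(2) assms d by (subst (asm) pos_less_divide_eq) (simp_all add: mult_ac)
  finally have "\<bar>\<sigma>\<bar> \<le> 1" using assms by (simp add: \<sigma>_def abs_mult)
  have \<sigma>_eq: "\<sigma> = - (2 * a * inner g k / s\<^sup>2) + - (a * (norm k)\<^sup>2 / s\<^sup>2)"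
    by (simp add: \<sigma>_def add_divide_distrib diff_divide_distrib algebra_simps)
  from exp_lower_quadratic[OF \<open>\<bar>\<sigma>\<bar> \<le> 1\<close>] have "1 + \<sigma> + \<sigma>\<^sup>2 / 4 \<le> exp \<sigma>" .
  moreover have "exp (- a * (norm (g + k))\<^sup>2 / s\<^sup>2) = exp (- a * (norm g)\<^sup>2 / s\<^sup>2) * exp \<sigma>"
  proof -
    have "(norm (g + k))\<^sup>2 = (norm g)\<^sup>2 + (2 * inner g k + (norm k)\<^sup>2)"
      by (simp add: power2_norm_eq_inner inner_simps inner_commute)
    then show ?thesis
      by (simp add: \<sigma>_def add_divide_distrib diff_divide_distrib distrib_left flip: exp_add)
  qed
  moreover have "1 - 2 * a * inner g k / s\<^sup>2 - 2 * a * (norm k)\<^sup>2 / s\<^sup>2 + a\<^sup>2 * (inner g k)\<^sup>2 / (2 * s ^ 4)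
      \<le> 1 + \<sigma> + \<sigma>\<^sup>2 / 4"
  proof -
    have "a * (norm k)\<^sup>2 / s\<^sup>2 \<le> 1"
    proof -
      have "(norm k)\<^sup>2 \<le> (s / sqrt a)\<^sup>2" using k1(3) by (intro power_mono) auto
      then show ?thesis using assms by (simp add: power_divide field_simps)
    qed
    moreover have "x\<^sup>2 \<le> x" if "0 \<le> x" "x \<le> 1" for x :: real
      using that by (simp add: power2_eq_square mult_left_le)
    ultimately have "(a * (norm k)\<^sup>2 / s\<^sup>2)\<^sup>2 \<le> a * (norm k)\<^sup>2 / s\<^sup>2" using assms by simp
    moreover have "\<sigma>\<^sup>2 \<ge> (2 * a * inner g k / s\<^sup>2)\<^sup>2 / 2 - (a * (norm k)\<^sup>2 / s\<^sup>2)\<^sup>2"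
    proof -
      have "(x + y)\<^sup>2 \<ge> x\<^sup>2 / 2 - y\<^sup>2" for x y :: real
        using zero_le_power2[of "x + 2 * y"] by (simp add: power2_eq_square algebra_simps)
      from this[of "- (2 * a * inner g k / s\<^sup>2)" "- (a * (norm k)\<^sup>2 / s\<^sup>2)"]
      show ?thesis unfolding \<sigma>_eq power2_minus by simp
    qed
    moreover have "(2 * a * inner g k / s\<^sup>2)\<^sup>2 = 4 * (a\<^sup>2 * (inner g k)\<^sup>2 / s ^ 4)"
      by (simp add: power_divide power_mult_distrib)
    moreover have "\<sigma> = - 2 * a * inner g k / s\<^sup>2 - a * (norm k)\<^sup>2 / s\<^sup>2" by (simp add: \<sigma>_eq)
    moreover have "0 \<le> a * (norm k)\<^sup>2 / s\<^sup>2" using assms by simp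
    ultimately show ?thesis by simp
  qed
  ultimately show "exp (- a * (norm (g + k))\<^sup>2 / s\<^sup>2) \<ge> exp (- a * (norm g)\<^sup>2 / s\<^sup>2) *
        (1 - 2 * a * inner g k / s\<^sup>2 - 2 * a * (norm k)\<^sup>2 / s\<^sup>2 + a\<^sup>2 * (inner g k)\<^sup>2 / (2 * s ^ 4))"
    by (simp add: mult_left_mono)
qed

context frame
begin

text \<open>Semiconvexity is expressed by a supporting paraboloid at every point. Adding the
  inequalities in the directions \<open>t *\<^sub>R v\<close> and \<open>- (t *\<^sub>R v)\<close>
  cancels all linear terms, and the quadratic ones are homogeneous, so a short step decides.\<close>

lemma upper_jet_lower_bound:
  assumes lower: "\<And>y. y \<in> T \<Longrightarrow>
      \<exists>l. linear l \<and> (\<forall>k\<in>T. W (y + k) \<ge> W y + l k - K * (norm k)\<^sup>2 / 2)"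
    and y: "y \<in> T" and B: "symmetric_form B" and jet: "upper_jet T W y p B" and v: "v \<in> T"
  shows "B v v \<ge> - K * (norm v)\<^sup>2"
proof -
  obtain l where l: "linear l" "\<And>k. k \<in> T \<Longrightarrow> W (y + k) \<ge> W y + l k - K * (norm k)\<^sup>2 / 2"
    using lower[OF y] by blast
  obtain s where s: "s > 0" "\<And>h. h \<in> T \<Longrightarrow> norm h < s \<Longrightarrow> W (y + h) \<le> W y + inner p h + B h h / 2"
    using jet by (auto simp: upper_jet_def)
  define t where "t = s / (2 * (norm v + 1))"
  have v1: "norm v + 1 > 0" using norm_ge_zero[of v] by linarith
  have t: "t > 0" using s v1 by (simp add: t_def)
  have ts: "norm (t *\<^sub>R v) < s"
  proof -
    have "norm v < 2 * (norm v + 1)" using v1 by (simp add: distrib_left)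
    from mult_strict_left_mono[OF this s(1)] have "s * norm v < s * (2 * (norm v + 1))" .
    then show ?thesis using s v1 by (simp add: t_def field_simps)
  qed
  have "W y + l (t *\<^sub>R v) - K * (norm (t *\<^sub>R v))\<^sup>2 / 2 \<le> W y + inner p (t *\<^sub>R v) + B (t *\<^sub>R v) (t *\<^sub>R v) / 2"
    using l(2)[of "t *\<^sub>R v"] s(2)[of "t *\<^sub>R v"] v ts by force
  moreover have "W y + l (- (t *\<^sub>R v)) - K * (norm (t *\<^sub>R v))\<^sup>2 / 2
      \<le> W y - inner p (t *\<^sub>R v) + B (t *\<^sub>R v) (t *\<^sub>R v) / 2"
    using l(2)[of "- (t *\<^sub>R v)"] s(2)[of "- (t *\<^sub>R v)"] v ts by (force simp: symmetric_form_simps[OF B])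
  moreover have "l (- (t *\<^sub>R v)) = - l (t *\<^sub>R v)" using l(1) by (rule linear_neg)
  ultimately have "- K * (norm (t *\<^sub>R v))\<^sup>2 \<le> B (t *\<^sub>R v) (t *\<^sub>R v)" by linarith
  then have "t\<^sup>2 * (- K * (norm v)\<^sup>2) \<le> t\<^sup>2 * B v v"
    by (simp add: symmetric_form_simps[OF B] power_mult_distrib power2_eq_square algebra_simps)
  then show ?thesis using t by (subst (asm) mult_le_cancel_left_pos) simp_all
qed

text \<open>
  Here \<open>w\<close> is a semiconvex function minus the quadratic polynomial of one of its upper jets.  What
  matters is that the gain \<open>\<epsilon>\<close> depends neither on \<open>w\<close> nor on the scale \<open>s\<close>.
\<close>

lemma hopf_improvement:
  assumes \<theta>: "\<theta> > 0" and K: "K \<ge> 0" and N: "N \<ge> 0"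
  obtains \<epsilon> where "\<epsilon> > 0"
    "\<And>w s h0. \<lbrakk>s > 0; continuous_on T w; w 0 = 0; \<And>h. h \<in> T \<Longrightarrow> norm h < s \<Longrightarrow> w h \<le> 0;
       \<And>y. y \<in> T \<Longrightarrow> \<exists>l. linear l \<and> (\<forall>k\<in>T. w (y + k) \<ge> w y + l k - K * (norm k)\<^sup>2 / 2);
       h0 \<in> T; norm h0 \<le> s / 4; w h0 < - \<theta> * s\<^sup>2\<rbrakk> \<Longrightarrow>
     \<exists>h p B \<mu>. h \<in> T \<and> norm h < s \<and> symmetric_form B \<and> upper_jet T w h p B \<and>
       (\<forall>v\<in>T. B v v \<le> \<mu> * (norm v)\<^sup>2) \<and> N * \<mu> + (\<Sum>e\<in>E. B e e) < - \<epsilon>"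
proof -
  \<comment> \<open>\<open>\<kappa> * s\<close> is the radius around \<open>h0\<close> on which
    semiconvexity keeps \<open>w\<close> below \<open>- \<beta> * s\<^sup>2\<close>; the barrier is
    used only outside this ball, where its radial second derivative is large.\<close>
  define \<kappa> where "\<kappa> = min (1 / 8) (\<theta> / (K + 1))"
  define \<beta> where "\<beta> = \<theta> / 8"
  define d where "d = real (card E)"
  \<comment> \<open>At distance at least \<open>\<kappa> * s\<close> from \<open>h0\<close> the
    radial part of the new Hessian is at most \<open>- c * a * (4 * N + 4 * d + 1)\<close>. It beats
    the contributions \<open>4 * c * a * N\<close> and \<open>4 * c * a * d\<close> of its isotropic
    part and leaves \<open>- c * a\<close>.\<close>
  define a where "a = (4 * N + 4 * d + 1) / \<kappa>\<^sup>2"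
  define \<epsilon> where "\<epsilon> = \<beta> * a * exp (- a) / 2"
  have \<kappa>: "\<kappa> > 0" "\<kappa> \<le> 1 / 8" "\<kappa> * K \<le> \<theta>"
  proof -
    show "\<kappa> > 0" using \<theta> K by (simp add: \<kappa>_def)
    show "\<kappa> \<le> 1 / 8" unfolding \<kappa>_def by (rule min.cobounded1)
    have "\<kappa> * K \<le> \<theta> / (K + 1) * K" using K by (intro mult_right_mono) (auto simp: \<kappa>_def)
    also have "\<dots> \<le> \<theta>" using \<theta> K by (simp add: field_simps)
    finally show "\<kappa> * K \<le> \<theta>" .
  qed
  have pos: "\<beta> > 0" "d \<ge> 0" "a > 0" "\<epsilon> > 0"
    using \<theta> N \<kappa>(1) by (auto simp: \<beta>_def d_def a_def \<epsilon>_def intro!: divide_pos_pos mult_pos_pos add_nonneg_pos)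
  show thesis
  proof (rule that[OF \<open>\<epsilon> > 0\<close>])
    fix w :: "'b \<Rightarrow> real" and s :: real and h0 :: 'b
    assume s: "s > 0" and cont: "continuous_on T w" and w0: "w 0 = 0"
      and w_le: "\<And>h. h \<in> T \<Longrightarrow> norm h < s \<Longrightarrow> w h \<le> 0"
      and lower: "\<And>y. y \<in> T \<Longrightarrow> \<exists>l. linear l \<and> (\<forall>k\<in>T. w (y + k) \<ge> w y + l k - K * (norm k)\<^sup>2 / 2)"
      and h0: "h0 \<in> T" "norm h0 \<le> s / 4" "w h0 < - \<theta> * s\<^sup>2"
    define b where "b = (\<lambda>h. exp (- a * (norm (h - h0))\<^sup>2 / s\<^sup>2))"
    define m0 where "m0 = exp (- a / 8)"
    have m0: "m0 > 0" by (simp add: m0_def)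
    have b_bounds: "0 < b h" "b h \<le> 1" for h using pos by (auto simp: b_def)
    \<comment> \<open>The point \<open>h\<close> lies on the segment from \<open>h0\<close> to the
      point at distance \<open>s / 4\<close> from \<open>h0\<close> in the same direction, where
      \<open>w \<le> 0\<close>. Semiconvexity along this segment, with parameter
      \<open>\<tau> \<le> 1 / 2\<close>, gives at most \<open>- \<theta> * s\<^sup>2 / 2\<close>
      plus an error of \<open>\<theta> * s\<^sup>2 / 8\<close>.\<close>
    have near: "w h < - \<beta> * s\<^sup>2" if h: "h \<in> T" "norm (h - h0) \<le> \<kappa> * s" for h
    proof (cases "h = h0")
      case True
      moreover have "- \<theta> * s\<^sup>2 \<le> - \<beta> * s\<^sup>2" using \<theta> by (simp add: \<beta>_def)
      ultimately show ?thesis using h0 by simp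
    next
      case False
      define \<rho> where "\<rho> = norm (h - h0)"
      define \<tau> where "\<tau> = \<rho> / (s / 4)"
      have \<rho>: "\<rho> > 0" "\<rho> \<le> \<kappa> * s" using False h by (auto simp: \<rho>_def)
      then have \<rho>8: "\<rho> \<le> s / 8" using mult_right_mono[OF \<kappa>(2), of s] s by linarith
      have \<tau>: "\<tau> > 0" "\<tau> \<le> 4 * \<kappa>" "\<tau> \<le> 1 / 2"
        using \<rho> \<rho>8 s \<kappa> by (auto simp: \<tau>_def field_simps)
      obtain l where l: "linear l" "\<And>k. k \<in> T \<Longrightarrow> w (h + k) \<ge> w h + l k - K * (norm k)\<^sup>2 / 2"
        using lower[OF h(1)] by blast
      define u where "u = h - h0"
      have u: "u \<in> T" "norm u = \<tau> * (s / 4)" using h h0 s by (auto simp: u_def \<tau>_def \<rho>_def)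
      have "w (h - u) \<ge> w h - l u - K * (norm u)\<^sup>2 / 2"
        using l(2)[of "- u"] u(1) by (simp add: linear_neg[OF l(1)])
      then have 1: "w h \<le> w h0 + l u + K * (norm u)\<^sup>2 / 2" by (simp add: u_def)
      define c where "c = (1 - \<tau>) / \<tau>"
      have c: "c \<ge> 0" using \<tau> by (simp add: c_def)
      have "w (h + c *\<^sub>R u) \<le> 0"
      proof (rule w_le)
        show "h + c *\<^sub>R u \<in> T" using h u by simp
        have "h + c *\<^sub>R u = h0 + (1 / \<tau>) *\<^sub>R u"
          using \<tau> by (simp add: c_def u_def diff_divide_distrib scaleR_diff_left)
        then have "norm (h + c *\<^sub>R u) \<le> norm h0 + norm ((1 / \<tau>) *\<^sub>R u)" using norm_triangle_ineq by metis
        also have "norm ((1 / \<tau>) *\<^sub>R u) = s / 4" using u \<tau> s by simp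
        finally show "norm (h + c *\<^sub>R u) < s" using h0 s by simp
      qed
      then have 2: "w h + c * l u \<le> K * (c * norm u)\<^sup>2 / 2"
        using l(2)[of "c *\<^sub>R u"] u(1) c by (simp add: linear_scale[OF l(1)])
      have "(1 - \<tau>) * w h + \<tau> * w h \<le> (1 - \<tau>) * (w h0 + l u + K * (norm u)\<^sup>2 / 2) + \<tau> * (K * (c * norm u)\<^sup>2 / 2 - c * l u)"
        using 1 2 \<tau> by (intro add_mono mult_left_mono) auto
      also have "\<dots> = (1 - \<tau>) * w h0 + K / 2 * ((1 - \<tau>) * (norm u)\<^sup>2 + \<tau> * (c * norm u)\<^sup>2)"
        using \<tau> by (simp add: c_def field_simps)
      also have "(1 - \<tau>) * (norm u)\<^sup>2 + \<tau> * (c * norm u)\<^sup>2 = (1 - \<tau>) * \<tau> * (s / 4)\<^sup>2"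
        using \<tau> by (simp add: u c_def power2_eq_square field_simps)
      also have "(1 - \<tau>) * w h0 \<le> (1 / 2) * (- \<theta> * s\<^sup>2)"
      proof -
        have "(1 - \<tau>) * w h0 \<le> (1 - \<tau>) * (- \<theta> * s\<^sup>2)" using h0 \<tau> by (intro mult_left_mono) auto
        also have "\<dots> \<le> (1 / 2) * (- \<theta> * s\<^sup>2)" using \<tau> \<theta> by (intro mult_right_mono_neg) auto
        finally show ?thesis .
      qed
      also have "K / 2 * ((1 - \<tau>) * \<tau> * (s / 4)\<^sup>2) \<le> K / 2 * (1 * (4 * \<kappa>) * (s / 4)\<^sup>2)"
        using \<tau> K \<kappa> by (intro mult_left_mono mult_right_mono mult_mono) auto
      also have "\<dots> = (\<kappa> * K) * s\<^sup>2 / 8" by (simp add: power2_eq_square)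
      also have "\<dots> \<le> \<theta> * s\<^sup>2 / 8" using \<kappa> by (intro divide_right_mono mult_right_mono) auto
      finally have "w h \<le> - (\<theta> * s\<^sup>2) / 2 + \<theta> * s\<^sup>2 / 8" by (simp add: algebra_simps)
      moreover have "\<theta> * s\<^sup>2 > 0" using \<theta> s by simp
      ultimately show ?thesis by (simp add: \<beta>_def)
    qed
    \<comment> \<open>The exponents are separated: \<open>b\<close> is at least
      \<open>exp (- a / 16)\<close> at 0 and at most \<open>exp (- a / 4)\<close> on the sphere of
      radius \<open>3 * s / 4\<close>, with \<open>m0 = exp (- a / 8)\<close> between. So
      \<open>\<psi>\<close> is positive at 0, but negative on that sphere and near
      \<open>h0\<close>; its maximum is interior and away from \<open>h0\<close>.\<close>
    define \<psi> where "\<psi> = (\<lambda>h. w h + \<beta> * s\<^sup>2 * (b h - m0))"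
    define D where "D = T \<inter> cball 0 (3 * s / 4)"
    have "continuous_on D \<psi>"
      unfolding \<psi>_def b_def using s
      by (intro continuous_intros continuous_on_subset[OF cont]) (auto simp: D_def)
    moreover have "compact D" "D \<noteq> {}" using compact s by (auto simp: D_def)
    ultimately obtain h1 where h1: "h1 \<in> D" "\<And>h. h \<in> D \<Longrightarrow> \<psi> h \<le> \<psi> h1"
      using continuous_attains_sup by metis
    have \<psi>0: "\<psi> 0 > 0"
    proof -
      have "(norm h0)\<^sup>2 \<le> (s / 4)\<^sup>2" using h0 by (intro power_mono) auto
      then have "a * (norm h0)\<^sup>2 / s\<^sup>2 \<le> a / 16" using s pos by (simp add: power_divide field_simps)
      then have "- (a / 8) < - (a * (norm h0)\<^sup>2 / s\<^sup>2)" using pos by linarith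
      then have "b 0 > m0" by (simp add: b_def m0_def)
      then show ?thesis using pos s by (simp add: \<psi>_def w0)
    qed
    then have \<psi>1: "\<psi> h1 > 0" using h1(2)[of 0] s by (force simp: D_def)
    have h1T: "h1 \<in> T" "norm h1 \<le> 3 * s / 4" using h1 by (auto simp: D_def)
    have far: "norm (h1 - h0) > \<kappa> * s"
    proof (rule ccontr)
      assume "\<not> ?thesis"
      then have "w h1 < - \<beta> * s\<^sup>2" using near h1T by simp
      moreover have "\<beta> * s\<^sup>2 * (b h1 - m0) \<le> \<beta> * s\<^sup>2 * 1"
        using b_bounds[of h1] pos m0 by (intro mult_left_mono) auto
      ultimately show False using \<psi>1 by (simp add: \<psi>_def)
    qed
    have inside: "norm h1 < 3 * s / 4"
    proof (rule ccontr)
      assume "\<not> ?thesis"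
      then have "norm (h1 - h0) \<ge> s / 2" using h0 norm_triangle_ineq2[of h1 h0] by simp
      then have "(norm (h1 - h0))\<^sup>2 \<ge> (s / 2)\<^sup>2" using s by (intro power_mono) auto
      then have "a * (norm (h1 - h0))\<^sup>2 / s\<^sup>2 \<ge> a / 4" using s pos by (simp add: power_divide field_simps)
      then have "- (a * (norm (h1 - h0))\<^sup>2 / s\<^sup>2) < - (a / 8)" using pos by linarith
      then have "b h1 < m0" by (simp add: b_def m0_def)
      then have "\<beta> * s\<^sup>2 * (b h1 - m0) < 0" using pos s by (simp add: mult_pos_neg)
      moreover have "w h1 \<le> 0" using w_le h1T s by simp
      ultimately show False using \<psi>1 by (simp add: \<psi>_def)
    qed
    define g where "g = h1 - h0"
    have gT: "g \<in> T" using h1T h0 by (simp add: g_def)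
    have g_bounds: "\<kappa> * s < norm g" "norm g \<le> s"
      using far norm_triangle_ineq4[of h1 h0] h1T h0 by (auto simp: g_def)
    obtain t where t: "t > 0" "\<And>k. norm k < t \<Longrightarrow> b (h1 + k) \<ge> b h1 *
        (1 - 2 * a * inner g k / s\<^sup>2 - 2 * a * (norm k)\<^sup>2 / s\<^sup>2 + a\<^sup>2 * (inner g k)\<^sup>2 / (2 * s ^ 4))"
    proof -
      obtain t where "t > 0" "\<And>k. norm k < t \<Longrightarrow> exp (- a * (norm (g + k))\<^sup>2 / s\<^sup>2) \<ge> exp (- a * (norm g)\<^sup>2 / s\<^sup>2) *
        (1 - 2 * a * inner g k / s\<^sup>2 - 2 * a * (norm k)\<^sup>2 / s\<^sup>2 + a\<^sup>2 * (inner g k)\<^sup>2 / (2 * s ^ 4))"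
        using barrier_expansion[OF \<open>a > 0\<close> s, of g] by blast
      then show thesis using that by (simp add: b_def g_def algebra_simps)
    qed
    define c where "c = \<beta> * b h1"
    have c: "c > 0" using pos b_bounds by (simp add: c_def)
    \<comment> \<open>The negative of the second order part of
      \<open>\<beta> * s\<^sup>2 * b\<close> at \<open>h1\<close>, with the slack of
      \<open>barrier_expansion\<close>. The factor \<open>s\<^sup>2\<close> makes
      \<open>\<mu>\<close> and the trace scale invariant, and \<open>norm g \<le> s\<close> bounds
      \<open>c\<close> below by \<open>\<beta> * exp (- a)\<close>.\<close>
    define B where "B = (\<lambda>x y. c * (4 * a) * inner x y + (- c * a\<^sup>2 / s\<^sup>2) * (inner g x * inner g y))"
    define p where "p = (2 * c * a) *\<^sub>R g"
    define \<mu> where "\<mu> = c * (4 * a)"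
    have "symmetric_form B" unfolding B_def
      by (intro symmetric_form_add symmetric_form_scale symmetric_form_inner symmetric_form_inner_prod)
    moreover have "upper_jet T w h1 p B"
      unfolding upper_jet_def
    proof (intro exI[of _ "min t (3 * s / 4 - norm h1)"] conjI ballI impI)
      show "0 < min t (3 * s / 4 - norm h1)" using t inside by simp
      fix k assume k: "k \<in> T" "norm k < min t (3 * s / 4 - norm h1)"
      then have "h1 + k \<in> D" using h1T norm_triangle_ineq[of h1 k] by (simp add: D_def)
      then have "\<psi> (h1 + k) \<le> \<psi> h1" by (rule h1)
      then have "w (h1 + k) \<le> w h1 - \<beta> * s\<^sup>2 * (b (h1 + k) - b h1)" by (simp add: \<psi>_def algebra_simps)
      also have "\<dots> \<le> w h1 - \<beta> * s\<^sup>2 * (b h1 *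
        (1 - 2 * a * inner g k / s\<^sup>2 - 2 * a * (norm k)\<^sup>2 / s\<^sup>2 + a\<^sup>2 * (inner g k)\<^sup>2 / (2 * s ^ 4)) - b h1)"
        using t(2)[of k] k pos by (intro diff_left_mono mult_left_mono) auto
      also have "\<dots> = w h1 + inner p k + B k k / 2"
        using s by (simp add: B_def p_def c_def power2_norm_eq_inner[symmetric] field_simps power2_eq_square power4_eq_xxxx)
      finally show "w (h1 + k) \<le> w h1 + inner p k + B k k / 2" .
    qed
    moreover have "\<forall>v\<in>T. B v v \<le> \<mu> * (norm v)\<^sup>2"
      using c s by (auto simp: B_def \<mu>_def power2_norm_eq_inner)
    moreover have "N * \<mu> + (\<Sum>e\<in>E. B e e) < - \<epsilon>"
    proof -
      have "(\<Sum>e\<in>E. B e e) = (\<Sum>e\<in>E. c * (4 * a) + (- c * a\<^sup>2 / s\<^sup>2) * (inner g e)\<^sup>2)"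
        using norm_E by (intro sum.cong) (auto simp: B_def power2_eq_square norm_eq_1)
      also have "\<dots> = d * (c * (4 * a)) + (- c * a\<^sup>2 / s\<^sup>2) * (norm g)\<^sup>2"
        unfolding sum.distrib sum_distrib_left[symmetric] parseval[OF gT] by (simp add: d_def)
      also have "(- c * a\<^sup>2 / s\<^sup>2) * (norm g)\<^sup>2 \<le> (- c * a\<^sup>2 / s\<^sup>2) * (\<kappa> * s)\<^sup>2"
        using g_bounds \<kappa> s c by (intro mult_left_mono_neg power_mono) auto
      also have "\<dots> = - c * a * (a * \<kappa>\<^sup>2)" using s by (simp add: power2_eq_square)
      also have "a * \<kappa>\<^sup>2 = 4 * N + 4 * d + 1" using \<kappa> by (simp add: a_def)
      finally have "N * \<mu> + (\<Sum>e\<in>E. B e e) \<le> - c * a" by (simp add: \<mu>_def algebra_simps)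
      moreover have "b h1 \<ge> exp (- a)"
      proof -
        have "(norm g)\<^sup>2 \<le> s\<^sup>2" using g_bounds by (intro power_mono) auto
        then show ?thesis using s pos by (simp add: b_def g_def field_simps)
      qed
      then have "c * a \<ge> \<beta> * exp (- a) * a" using pos by (simp add: c_def)
      moreover have "\<beta> * exp (- a) * a > \<epsilon>" using pos by (simp add: \<epsilon>_def)
      ultimately show ?thesis by simp
    qed
    ultimately show "\<exists>h p B \<mu>. h \<in> T \<and> norm h < s \<and> symmetric_form B \<and> upper_jet T w h p B \<and>
       (\<forall>v\<in>T. B v v \<le> \<mu> * (norm v)\<^sup>2) \<and> N * \<mu> + (\<Sum>e\<in>E. B e e) < - \<epsilon>"
      using h1T inside s by (intro exI[of _ h1] exI[of _ p] exI[of _ B] exI[of _ \<mu>]) auto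
  qed
qed

text \<open>
  Among all jets of \<open>W\<close> near \<open>y\<^sub>0\<close>, take one that almost minimises \<open>N m + tr B\<close>, where \<open>m\<close> bounds
  \<open>B - A\<close> from above.  By \<open>hopf_improvement\<close>, \<open>W\<close> then almost coincides with the quadratic polynomial
  of this jet on a whole ball.  This replaces Alexandrov's theorem and Jensen's lemma.
\<close>

lemma almost_quadratic_point:
  assumes cont: "continuous_on T W" and K: "K \<ge> 0"
    and lower: "\<And>y. y \<in> T \<Longrightarrow>
      \<exists>l. linear l \<and> (\<forall>k\<in>T. W (y + k) \<ge> W y + l k - K * (norm k)\<^sup>2 / 2)"
    and y0: "y0 \<in> T" and A: "symmetric_form A" and jet0: "upper_jet T W y0 p0 A"
    and a: "\<And>v. v \<in> T \<Longrightarrow> \<bar>A v v\<bar> \<le> a * (norm v)\<^sup>2"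
    and R: "R > 0" and \<theta>: "\<theta> > 0"
  obtains y q B \<sigma> where "y \<in> T" "dist y0 y < R" "symmetric_form B" "\<sigma> > 0"
    "\<And>v. v \<in> T \<Longrightarrow> B v v \<le> A v v + \<theta> * (norm v)\<^sup>2"
    "\<And>h. h \<in> T \<Longrightarrow> norm h \<le> \<sigma> \<Longrightarrow> W (y + h) \<le> W y + inner q h + B h h / 2"
    "\<And>h. h \<in> T \<Longrightarrow> norm h \<le> \<sigma> \<Longrightarrow> W y + inner q h + B h h / 2 - \<theta> * \<sigma>\<^sup>2 \<le> W (y + h)"
proof -
  define d where "d = real (card E)"
  \<comment> \<open>Here \<open>N * \<theta> = d * (a + K) + 1\<close>. A cost less than 1 above the
    infimum, which is at most \<open>d * a\<close>, together with a trace of at least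
    \<open>- (d * K)\<close>, then forces \<open>m < \<theta>\<close>.\<close>
  define N where "N = (d * (a + K) + 1) / \<theta>"
  \<comment> \<open>The semiconvexity constant of \<open>W\<close> minus the polynomial with Hessian
    \<open>B\<close>, where \<open>B\<close> is at most \<open>A\<close> plus
    \<open>\<theta>\<close>, hence at most \<open>a + \<theta>\<close>.\<close>
  define K' where "K' = K + (a + \<theta>)"
  obtain e0 where e0: "e0 \<in> E" "e0 \<in> T" "norm e0 = 1" using nonempty_E E_subset norm_E by blast
  have E_T: "e \<in> T" if "e \<in> E" for e using that E_subset by blast
  have a0: "a \<ge> 0" using a[OF e0(2)] e0(3) by simp
  have d: "d \<ge> 0" by (simp add: d_def)
  have N: "N > 0" using a0 d K \<theta> by (simp add: N_def add_nonneg_pos)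
  have K': "K' \<ge> 0" using a0 K \<theta> by (simp add: K'_def)
  define adm where "adm = (\<lambda>y q B m. y \<in> T \<and> dist y0 y < R \<and> symmetric_form B \<and> upper_jet T W y q B \<and>
      (\<forall>v\<in>T. B v v \<le> A v v + m * (norm v)\<^sup>2))"
  define cost where "cost = (\<lambda>B m. N * m + (\<Sum>e\<in>E. B e e :: real))"
  define C where "C = {cost B m | y q B m. adm y q B m}"
  have ge: "B v v \<ge> - K * (norm v)\<^sup>2" if "adm y q B m" "v \<in> T" for y q B m v
    using that upper_jet_lower_bound[OF lower] by (auto simp: adm_def)
  have trace_ge: "(\<Sum>e\<in>E. B e e) \<ge> - (d * K)" if "adm y q B m" for y q B m
  proof -
    have "(\<Sum>e\<in>E. - K) \<le> (\<Sum>e\<in>E. B e e)"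
      using ge[OF that, OF E_T] norm_E by (intro sum_mono) force
    then show ?thesis by (simp add: d_def)
  qed
  have bdd: "bdd_below C"
  proof
    fix c assume "c \<in> C"
    then obtain y q B m where *: "c = cost B m" "adm y q B m" by (auto simp: C_def)
    have "- K \<le> B e0 e0" using ge[OF *(2) e0(2)] e0 by simp
    also have "\<dots> \<le> A e0 e0 + m" using *(2) e0 by (force simp: adm_def)
    also have "A e0 e0 \<le> a" using a[OF e0(2)] e0 by simp
    finally have "N * (- (K + a)) \<le> N * m" using N by (intro mult_left_mono) auto
    then show "N * (- (K + a)) + - (d * K) \<le> c" using trace_ge[OF *(2)] by (simp add: * cost_def)
  qed
  have "adm y0 p0 A 0" using y0 A jet0 R by (simp add: adm_def)
  then have c0: "cost A 0 \<in> C" unfolding C_def by blast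
  have "cost A 0 \<le> (\<Sum>e\<in>E. a)"
    unfolding cost_def mult_zero_right add_0 using a[OF E_T] norm_E
    by (intro sum_mono) (auto simp: abs_le_iff)
  then have Inf_le: "Inf C \<le> d * a" using cInf_lower[OF c0 bdd] by (simp add: d_def)
  \<comment> \<open>On the final radius \<open>\<sigma> = s / 4\<close> the bound
    \<open>(\<theta> / 16) * s\<^sup>2\<close> reads
    \<open>\<theta> * \<sigma>\<^sup>2\<close>.\<close>
  have "\<theta> / 16 > 0" using \<theta> by simp
  from hopf_improvement[OF this K' less_imp_le[OF N]] obtain \<epsilon> where \<epsilon>: "\<epsilon> > 0"
    "\<And>w s h0. \<lbrakk>s > 0; continuous_on T w; w 0 = 0; \<And>h. h \<in> T \<Longrightarrow> norm h < s \<Longrightarrow> w h \<le> 0;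
       \<And>y. y \<in> T \<Longrightarrow> \<exists>l. linear l \<and> (\<forall>k\<in>T. w (y + k) \<ge> w y + l k - K' * (norm k)\<^sup>2 / 2);
       h0 \<in> T; norm h0 \<le> s / 4; w h0 < - (\<theta> / 16) * s\<^sup>2\<rbrakk> \<Longrightarrow>
     \<exists>h p B \<mu>. h \<in> T \<and> norm h < s \<and> symmetric_form B \<and> upper_jet T w h p B \<and>
       (\<forall>v\<in>T. B v v \<le> \<mu> * (norm v)\<^sup>2) \<and> N * \<mu> + (\<Sum>e\<in>E. B e e) < - \<epsilon>"
    by blast
  \<comment> \<open>Being within 1 of the infimum yields \<open>m < \<theta>\<close>; being within
    \<open>\<epsilon>\<close> of it contradicts an improvement by the barrier.\<close>
  obtain c where c: "c \<in> C" "c < Inf C + min \<epsilon> 1"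
    using cInf_lessD[of C "Inf C + min \<epsilon> 1"] c0 \<epsilon>(1) by fastforce
  then obtain y q B m where yB: "c = cost B m" "adm y q B m" by (auto simp: C_def)
  then have y: "y \<in> T" "dist y0 y < R" and B: "symmetric_form B" and jet: "upper_jet T W y q B"
    and B_le: "\<And>v. v \<in> T \<Longrightarrow> B v v \<le> A v v + m * (norm v)\<^sup>2" by (auto simp: adm_def)
  have "m < \<theta>"
  proof -
    have "N * m < N * \<theta>"
    proof -
      have "N * \<theta> = d * (a + K) + 1" using \<theta> by (simp add: N_def)
      then show ?thesis
        using c(2) yB(1) Inf_le trace_ge[OF yB(2)] by (simp add: cost_def distrib_left)
    qed
    then show ?thesis using N by simp
  qed
  then have B_le': "B v v \<le> A v v + \<theta> * (norm v)\<^sup>2" if "v \<in> T" for v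
    using B_le[OF that] mult_right_mono[of m \<theta> "(norm v)\<^sup>2"] by simp
  obtain s0 where s0: "s0 > 0" "\<And>h. h \<in> T \<Longrightarrow> norm h < s0 \<Longrightarrow> W (y + h) \<le> W y + inner q h + B h h / 2"
    using jet by (auto simp: upper_jet_def)
  define s where "s = min s0 (R - dist y0 y)"
  have s: "s > 0" "s \<le> s0" "s \<le> R - dist y0 y" using s0 y by (auto simp: s_def)
  define w where "w = (\<lambda>h. W (y + h) - W y - inner q h - B h h / 2)"
  have w_ge: "w h0 \<ge> - (\<theta> / 16) * s\<^sup>2" if h0: "h0 \<in> T" "norm h0 \<le> s / 4" for h0
  proof (rule ccontr)
    assume contr: "\<not> ?thesis"
    have "\<exists>h p B \<mu>. h \<in> T \<and> norm h < s \<and> symmetric_form B \<and> upper_jet T w h p B \<and>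
       (\<forall>v\<in>T. B v v \<le> \<mu> * (norm v)\<^sup>2) \<and> N * \<mu> + (\<Sum>e\<in>E. B e e) < - \<epsilon>"
    proof (rule \<epsilon>(2)[OF s(1) _ _ _ _ h0])
      have "continuous_on T (\<lambda>h. W (y + h))"
        by (rule continuous_on_compose2[OF cont]) (use y in \<open>auto intro!: continuous_intros\<close>)
      then show "continuous_on T w"
        unfolding w_def using continuous_on_form[OF B] by (intro continuous_intros) auto
      show "w 0 = 0" by (simp add: w_def symmetric_form_simps[OF B])
      show "w h \<le> 0" if "h \<in> T" "norm h < s" for h
        using s0(2)[of h] that s by (simp add: w_def)
      show "w h0 < - (\<theta> / 16) * s\<^sup>2" using contr by simp
      fix x assume x: "x \<in> T"
      obtain l where l: "linear l" "\<And>k. k \<in> T \<Longrightarrow> W (y + x + k) \<ge> W (y + x) + l k - K * (norm k)\<^sup>2 / 2"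
        using lower[of "y + x"] x y by auto
      define l' where "l' = (\<lambda>k. l k - inner q k - B x k)"
      have "linear (inner q)" by (intro linearI) (auto simp: inner_add_right)
      then have "linear l'" unfolding l'_def
        by (intro linear_compose_sub l(1) symmetric_form_linear[OF B])
      moreover have "w (x + k) \<ge> w x + l' k - K' * (norm k)\<^sup>2 / 2" if k: "k \<in> T" for k
      proof -
        have "B k k \<le> (a + \<theta>) * (norm k)\<^sup>2"
          using B_le'[OF k] a[OF k] by (simp add: algebra_simps)
        then show ?thesis
          using l(2)[OF k] symmetric_form_commute[OF B, of k x]
          by (simp add: w_def l'_def K'_def symmetric_form_simps[OF B] inner_add_right add.assoc
              add_divide_distrib distrib_right)
      qed
      ultimately show "\<exists>l. linear l \<and> (\<forall>k\<in>T. w (x + k) \<ge> w x + l k - K' * (norm k)\<^sup>2 / 2)" by blast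
    qed
    then obtain h p B' \<mu> where *: "h \<in> T" "norm h < s" "symmetric_form B'" "upper_jet T w h p B'"
      "\<And>v. v \<in> T \<Longrightarrow> B' v v \<le> \<mu> * (norm v)\<^sup>2" "N * \<mu> + (\<Sum>e\<in>E. B' e e) < - \<epsilon>" by blast
    define B'' where "B'' = (\<lambda>x y. B x y + B' x y)"
    \<comment> \<open>Re-expanding the polynomial of the old jet at \<open>h\<close> changes its
      gradient by the vector that represents \<open>B h\<close>; added to the jet of
      \<open>w\<close> at \<open>h\<close> this gives a jet of \<open>W\<close> at
      \<open>y + h\<close>.\<close>
    obtain b where b: "\<And>k. k \<in> T \<Longrightarrow> B h k = inner b k" using form_representation[OF B *(1)] by blast
    have "adm (y + h) (q + p + b) B'' (m + \<mu>)"
      unfolding adm_def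
    proof (intro conjI ballI)
      show "y + h \<in> T" using y * by simp
      have "dist y0 (y + h) \<le> dist y0 y + dist y (y + h)" by (rule dist_triangle)
      then show "dist y0 (y + h) < R" using *(2) s by (simp add: dist_norm)
      show "symmetric_form B''" unfolding B''_def by (intro symmetric_form_add B *)
      show "B'' v v \<le> A v v + (m + \<mu>) * (norm v)\<^sup>2" if "v \<in> T" for v
        using B_le[OF that] *(5)[OF that] by (simp add: B''_def algebra_simps)
      obtain t where t: "t > 0" "\<And>k. k \<in> T \<Longrightarrow> norm k < t \<Longrightarrow> w (h + k) \<le> w h + inner p k + B' k k / 2"
        using *(4) by (auto simp: upper_jet_def)
      show "upper_jet T W (y + h) (q + p + b) B''"
        unfolding upper_jet_def
      proof (intro exI[of _ t] conjI ballI impI t(1))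
        fix k assume k: "k \<in> T" "norm k < t"
        show "W (y + h + k) \<le> W (y + h) + inner (q + p + b) k + B'' k k / 2"
          using t(2)[OF k] b[OF k(1)] symmetric_form_commute[OF B, of k h]
          by (simp add: w_def B''_def symmetric_form_simps[OF B] inner_add_right inner_add_left add.assoc
              add_divide_distrib)
      qed
    qed
    then have "cost B'' (m + \<mu>) \<in> C" unfolding C_def by blast
    then have "Inf C \<le> cost B'' (m + \<mu>)" using bdd by (rule cInf_lower)
    also have "\<dots> < c - \<epsilon>" using *(6) by (simp add: cost_def B''_def yB sum.distrib distrib_left)
    finally show False using c(2) by simp
  qed
  show thesis
  proof (rule that[OF y B, of "s / 4"])
    show "s / 4 > 0" using s by simp
    show "B v v \<le> A v v + \<theta> * (norm v)\<^sup>2" if "v \<in> T" for v using B_le'[OF that] .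
    fix h assume h: "h \<in> T" "norm h \<le> s / 4"
    then show "W (y + h) \<le> W y + inner q h + B h h / 2" using s0(2)[of h] s by simp
    show "W y + inner q h + B h h / 2 - \<theta> * (s / 4)\<^sup>2 \<le> W (y + h)"
      using w_ge[OF h] by (simp add: w_def power_divide)
  qed
qed

end

section \<open>Jets of sums and sup-convolutions\<close>

context frame
begin

lemma frame_prod: "frame (T \<times> T) (E \<times> {0} \<union> {0} \<times> E)"
proof
  show "subspace (T \<times> T)" using subspace by (rule subspace_Times[OF _ subspace])
  show "finite (E \<times> {0} \<union> {0} \<times> E)" using finite_E by simp
  show "E \<times> {0} \<union> {0} \<times> E \<noteq> {}" using nonempty_E by blast
  show "E \<times> {0} \<union> {0} \<times> E \<subseteq> T \<times> T" using E_subset by auto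
  show "norm e = 1" if "e \<in> E \<times> {0} \<union> {0} \<times> E" for e
    using that norm_E by (auto simp: norm_Pair)
  show "g = (\<Sum>e\<in>E \<times> {0} \<union> {0} \<times> E. inner g e *\<^sub>R e)" if g: "g \<in> T \<times> T" for g
  proof -
    obtain x z where xz: "g = (x, z)" "x \<in> T" "z \<in> T" using g by auto
    have "0 \<notin> E" using norm_E by fastforce
    then have "(\<Sum>e\<in>E \<times> {0} \<union> {0} \<times> E. inner g e *\<^sub>R e)
        = (\<Sum>e\<in>E \<times> {0}. inner g e *\<^sub>R e) + (\<Sum>e\<in>{0} \<times> E. inner g e *\<^sub>R e)"
      using finite_E by (intro sum.union_disjoint) auto
    also have "(\<Sum>e\<in>E \<times> {0}. inner g e *\<^sub>R e) = (\<Sum>e\<in>E. (inner x e *\<^sub>R e, 0))"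
      by (simp add: sum.Sigma[symmetric] sum.cartesian_product' xz)
    also have "\<dots> = (x, 0)" using expand[OF xz(2)] by (simp add: sum_prod)
    also have "(\<Sum>e\<in>{0} \<times> E. inner g e *\<^sub>R e) = (\<Sum>e\<in>E. (0, inner z e *\<^sub>R e))"
      by (simp add: sum.cartesian_product' xz)
    also have "\<dots> = (0, z)" using expand[OF xz(3)] by (simp add: sum_prod)
    finally show ?thesis by (simp add: xz)
  qed
  show "compact ((T \<times> T) \<inter> cball 0 R)" for R
  proof -
    have "norm x \<le> R" "norm z \<le> R" if "norm (x, z) \<le> R" for x z :: 'b
      using that norm_fst_le[of x z] norm_snd_le[of z x] by linarith+
    then have "(T \<times> T) \<inter> cball 0 R = ((T \<inter> cball 0 R) \<times> (T \<inter> cball 0 R)) \<inter> cball 0 R"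
      by auto
    then show ?thesis using compact by (simp add: compact_Times compact_Int_closed)
  qed
qed

text \<open>The theorem on sums for semiconvex functions. The Hessian \<open>B\<close> found by
  \<open>almost_quadratic_point\<close> on \<open>T \<times> T\<close> need not split, but its mixed
  part is almost nonnegative, so dropping it costs little in the upper bound for the diagonal
  blocks.\<close>

lemma jets_of_sum:
  fixes U V :: "'b \<Rightarrow> real"
  assumes cont: "continuous_on T U" "continuous_on T V" and K: "K \<ge> 0"
    and lower_U: "\<And>y. y \<in> T \<Longrightarrow>
      \<exists>l. linear l \<and> (\<forall>k\<in>T. U (y + k) \<ge> U y + l k - K * (norm k)\<^sup>2 / 2)"
    and lower_V: "\<And>y. y \<in> T \<Longrightarrow>
      \<exists>l. linear l \<and> (\<forall>k\<in>T. V (y + k) \<ge> V y + l k - K * (norm k)\<^sup>2 / 2)"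
    and xz0: "x0 \<in> T" "z0 \<in> T" and A: "symmetric_form A"
    and jet: "upper_jet (T \<times> T) (\<lambda>(x, z). U x + V z) (x0, z0) p0 A"
    and a: "\<And>v. v \<in> T \<times> T \<Longrightarrow> \<bar>A v v\<bar> \<le> a * (norm v)\<^sup>2"
    and R: "R > 0" and \<theta>: "\<theta> > 0"
  obtains x z p q X Z where "x \<in> T" "z \<in> T" "dist x0 x < R" "dist z0 z < R"
    "symmetric_form X" "symmetric_form Z" "upper_jet T U x p X" "upper_jet T V z q Z"
    "\<And>\<xi> \<eta>. \<xi> \<in> T \<Longrightarrow> \<eta> \<in> T \<Longrightarrow>
      X \<xi> \<xi> + Z \<eta> \<eta> \<le> A (\<xi>, \<eta>) (\<xi>, \<eta>) + \<theta> * ((norm \<xi>)\<^sup>2 + (norm \<eta>)\<^sup>2)"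
proof -
  interpret P: frame "T \<times> T" "E \<times> {0} \<union> {0} \<times> E" by (rule frame_prod)
  define W where "W = (\<lambda>(x, z). U x + V z)"
  have contW: "continuous_on (T \<times> T) W"
    unfolding W_def split_def
    by (intro continuous_intros continuous_on_compose2[OF cont(1)] continuous_on_compose2[OF cont(2)]) auto
  have lowerW: "\<exists>l. linear l \<and> (\<forall>k\<in>T\<times>T. W (y + k) \<ge> W y + l k - K * (norm k)\<^sup>2 / 2)"
    if "y \<in> T \<times> T" for y
  proof -
    obtain x z where y: "y = (x, z)" "x \<in> T" "z \<in> T" using \<open>y \<in> T \<times> T\<close> by auto
    obtain l1 l2 where l: "linear l1" "\<And>k. k \<in> T \<Longrightarrow> U (x + k) \<ge> U x + l1 k - K * (norm k)\<^sup>2 / 2"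
      "linear l2" "\<And>k. k \<in> T \<Longrightarrow> V (z + k) \<ge> V z + l2 k - K * (norm k)\<^sup>2 / 2"
      using lower_U[OF y(2)] lower_V[OF y(3)] by blast
    have "linear (\<lambda>k. l1 (fst k) + l2 (snd k))"
      using l(1,3) by (intro linear_compose_add linear_compose[unfolded o_def, OF linear_fst]
          linear_compose[unfolded o_def, OF linear_snd])
    moreover have "W (y + k) \<ge> W y + (l1 (fst k) + l2 (snd k)) - K * (norm k)\<^sup>2 / 2" if "k \<in> T \<times> T" for k
      using that l(2)[of "fst k"] l(4)[of "snd k"]
      by (cases k) (simp add: W_def y norm_Pair algebra_simps add_divide_distrib)
    ultimately show ?thesis by blast
  qed
  have jetW: "upper_jet (T \<times> T) W (x0, z0) p0 A" using jet by (simp add: W_def)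
  have xz0': "(x0, z0) \<in> T \<times> T" using xz0 by simp
  \<comment> \<open>One fifth of \<open>\<theta>\<close> is spent in \<open>B_le\<close> and four
    fifths on twice the mixed term, each of which costs \<open>2 * \<theta> / 5\<close>.\<close>
  have "\<theta> / 5 > 0" using \<theta> by simp
  obtain y B \<sigma> q where y: "y \<in> T \<times> T" "dist (x0, z0) y < R" and B: "symmetric_form B" and \<sigma>: "\<sigma> > 0"
    and B_le: "\<And>v. v \<in> T \<times> T \<Longrightarrow> B v v \<le> A v v + (\<theta> / 5) * (norm v)\<^sup>2"
    and up: "\<And>h. h \<in> T \<times> T \<Longrightarrow> norm h \<le> \<sigma> \<Longrightarrow> W (y + h) \<le> W y + inner q h + B h h / 2"
    and low: "\<And>h. h \<in> T \<times> T \<Longrightarrow> norm h \<le> \<sigma> \<Longrightarrow>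
      W y + inner q h + B h h / 2 - (\<theta> / 5) * \<sigma>\<^sup>2 \<le> W (y + h)"
    by (rule P.almost_quadratic_point[OF contW K lowerW xz0' A jetW a R \<open>\<theta> / 5 > 0\<close>])
       (assumption | (rule that; assumption))+
  obtain x z where xz: "y = (x, z)" "x \<in> T" "z \<in> T" using y(1) by auto
  have dists: "dist x0 x < R" "dist z0 z < R"
    using y(2) dist_fst_le[of "(x0, z0)" "(x, z)"] dist_snd_le[of "(x0, z0)" "(x, z)"] by (auto simp: xz)
  have split: "B (\<xi>, \<eta>) (\<xi>, \<eta>) = B (\<xi>, 0) (\<xi>, 0) + B (0, \<eta>) (0, \<eta>) + 2 * B (\<xi>, 0) (0, \<eta>)" for \<xi> \<eta>
  proof -
    have "B (\<xi>, \<eta>) (\<xi>, \<eta>) = B ((\<xi>, 0) + (0, \<eta>)) ((\<xi>, 0) + (0, \<eta>))" by simp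
    also have "\<dots> = B (\<xi>, 0) (\<xi>, 0) + B (0, \<eta>) (0, \<eta>) + 2 * B (\<xi>, 0) (0, \<eta>)"
      unfolding symmetric_form_simps(1,2)[OF B] using symmetric_form_commute[OF B, of "(0, \<eta>)" "(\<xi>, 0)"]
      by linarith
    finally show ?thesis .
  qed
  \<comment> \<open>\<open>W (y + (\<xi>, \<eta>))\<close> is determined by the values at
    \<open>y\<close>, \<open>y + (\<xi>, 0)\<close> and \<open>y + (0, \<eta>)\<close>. The upper
    bound of the polynomial at the first point and its lower bounds at the last two leave an
    inequality for the mixed term alone.\<close>
  have off: "B (\<xi>, 0) (0, \<eta>) \<ge> - (2 * \<theta> / 5) * ((norm \<xi>)\<^sup>2 + (norm \<eta>)\<^sup>2)" if "\<xi> \<in> T" "\<eta> \<in> T" for \<xi> \<eta>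
  proof (cases "(\<xi>, \<eta>) = 0")
    case True
    then show ?thesis using symmetric_form_simps(9)[OF B, of 0] by (simp add: zero_prod_def)
  next
    case False
    \<comment> \<open>The error \<open>(\<theta> / 5) * \<sigma>\<^sup>2\<close> does not shrink
      with the displacement, so the pair is rescaled to the full radius \<open>\<sigma>\<close>,
      where it is comparable with the quadratic terms.\<close>
    define t where "t = \<sigma> / norm (\<xi>, \<eta>)"
    have t: "t > 0" using \<sigma> False by (simp add: t_def)
    define \<xi>' \<eta>' where "\<xi>' = t *\<^sub>R \<xi>" and "\<eta>' = t *\<^sub>R \<eta>"
    have T': "\<xi>' \<in> T" "\<eta>' \<in> T" using that by (auto simp: \<xi>'_def \<eta>'_def)
    have "norm (\<xi>', \<eta>') = norm (t *\<^sub>R (\<xi>, \<eta>))" by (simp add: \<xi>'_def \<eta>'_def)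
    also have "\<dots> = \<sigma>" using False \<sigma> by (simp only: norm_scaleR) (simp add: t_def)
    finally have nrm: "norm (\<xi>', \<eta>') = \<sigma>" .
    have nrm': "norm (\<xi>', 0::'b) \<le> \<sigma>" "norm (0::'b, \<eta>') \<le> \<sigma>"
      using nrm norm_fst_le[of \<xi>' \<eta>'] norm_snd_le[of \<eta>' \<xi>'] by (auto simp: norm_Pair)
    have "W y + inner q (\<xi>', 0) + B (\<xi>', 0) (\<xi>', 0) / 2 - (\<theta> / 5) * \<sigma>\<^sup>2 \<le> W (y + (\<xi>', 0))"
      using low[OF _ nrm'(1)] T' by simp
    moreover have "W y + inner q (0, \<eta>') + B (0, \<eta>') (0, \<eta>') / 2 - (\<theta> / 5) * \<sigma>\<^sup>2 \<le> W (y + (0, \<eta>'))"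
      using low[OF _ nrm'(2)] T' by simp
    moreover have "W (y + (\<xi>', \<eta>')) \<le> W y + inner q (\<xi>', \<eta>') + B (\<xi>', \<eta>') (\<xi>', \<eta>') / 2"
      using up[of "(\<xi>', \<eta>')"] T' nrm by simp
    moreover have "W (y + (\<xi>', \<eta>')) = W (y + (\<xi>', 0)) + W (y + (0, \<eta>')) - W y"
      by (simp add: W_def xz)
    moreover have "inner q (\<xi>', \<eta>') = inner q (\<xi>', 0) + inner q (0, \<eta>')" by (cases q) simp
    ultimately have "B (\<xi>', 0) (0, \<eta>') \<ge> - (2 * ((\<theta> / 5) * \<sigma>\<^sup>2))"
      using split[of \<xi>' \<eta>'] by linarith
    moreover have "B (\<xi>', 0) (0, \<eta>') = t\<^sup>2 * B (\<xi>, 0) (0, \<eta>)"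
    proof -
      have "(\<xi>', 0) = t *\<^sub>R (\<xi>, 0::'b)" "(0, \<eta>') = t *\<^sub>R (0::'b, \<eta>)" by (auto simp: \<xi>'_def \<eta>'_def)
      then show ?thesis by (simp only: symmetric_form_simps[OF B]) (simp add: power2_eq_square)
    qed
    moreover have "\<sigma>\<^sup>2 = t\<^sup>2 * ((norm \<xi>)\<^sup>2 + (norm \<eta>)\<^sup>2)"
      using False by (simp add: t_def power_divide norm_Pair zero_prod_def)
    ultimately have "t\<^sup>2 * (- (2 * \<theta> / 5) * ((norm \<xi>)\<^sup>2 + (norm \<eta>)\<^sup>2)) \<le> t\<^sup>2 * B (\<xi>, 0) (0, \<eta>)"
      by (simp add: algebra_simps)
    then show ?thesis using t by (subst (asm) mult_le_cancel_left_pos) simp_all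
  qed
  define X where "X = (\<lambda>\<xi> \<xi>'. B (\<xi>, 0) (\<xi>', 0))"
  define Z where "Z = (\<lambda>\<eta> \<eta>'. B (0, \<eta>) (0, \<eta>'))"
  have X: "symmetric_form X" and Z: "symmetric_form Z"
  proof -
    have "linear (X x)" "linear (Z x)" for x
    proof -
      have "linear (\<lambda>x :: 'b. (x, 0 :: 'b))" "linear (\<lambda>x :: 'b. (0 :: 'b, x))" by (auto intro!: linearI)
      then show "linear (X x)" "linear (Z x)"
        unfolding X_def Z_def using linear_compose[OF _ symmetric_form_linear[OF B]] by (auto simp: o_def)
    qed
    then show "symmetric_form X" "symmetric_form Z"
      by (auto intro!: symmetric_formI simp: X_def Z_def symmetric_form_commute[OF B])
  qed
  have jX: "upper_jet T U x (fst q) X" and jZ: "upper_jet T V z (snd q) Z"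
    unfolding upper_jet_def
  proof (intro exI[of _ \<sigma>] conjI ballI impI \<sigma>)
    fix h assume "h \<in> T" "norm h < \<sigma>"
    then show "U (x + h) \<le> U x + inner (fst q) h + X h h / 2"
      using up[of "(h, 0)"] by (cases q) (simp add: W_def xz X_def norm_Pair)
  next
    show "\<exists>s>0. \<forall>h\<in>T. norm h < s \<longrightarrow> V (z + h) \<le> V z + inner (snd q) h + Z h h / 2"
    proof (intro exI[of _ \<sigma>] conjI ballI impI \<sigma>)
      fix h assume "h \<in> T" "norm h < \<sigma>"
      then show "V (z + h) \<le> V z + inner (snd q) h + Z h h / 2"
        using up[of "(0, h)"] by (cases q) (simp add: W_def xz Z_def norm_Pair)
    qed
  qed
  show thesis
  proof (rule that[OF xz(2,3) dists X Z jX jZ])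
    fix \<xi> \<eta> assume "\<xi> \<in> T" "\<eta> \<in> T"
    then show "X \<xi> \<xi> + Z \<eta> \<eta> \<le> A (\<xi>, \<eta>) (\<xi>, \<eta>) + \<theta> * ((norm \<xi>)\<^sup>2 + (norm \<eta>)\<^sup>2)"
      using B_le[of "(\<xi>, \<eta>)"] off[of \<xi> \<eta>] split[of \<xi> \<eta>]
      by (simp add: X_def Z_def norm_Pair algebra_simps)
  qed
qed

end

text \<open>For \<open>y\<close> maximising at \<open>x\<close>, the function
  \<open>u y - (norm (x + k - y))\<^sup>2 / (2 * \<epsilon>)\<close> of \<open>k\<close> stays below
  \<open>U (x + k)\<close> and agrees with it at \<open>k = 0\<close>; this is the supporting
  paraboloid of opening \<open>1 / \<epsilon>\<close>. The same inequality, used at two points,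
  gives continuity. Compactness of \<open>D\<close> provides the maximiser.\<close>

lemma sup_convolution:
  fixes u :: "'a::real_inner \<Rightarrow> real"
  assumes D: "compact D" "D \<noteq> {}" and u: "continuous_on D u" and \<epsilon>: "\<epsilon> > 0"
  obtains U where
    "\<And>x. \<exists>y\<in>D. U x = u y - (norm (x - y))\<^sup>2 / (2 * \<epsilon>)"
    "\<And>x y. y \<in> D \<Longrightarrow> u y - (norm (x - y))\<^sup>2 / (2 * \<epsilon>) \<le> U x"
    "\<And>y. \<exists>l. linear l \<and> (\<forall>k. U (y + k) \<ge> U y + l k - (1 / \<epsilon>) * (norm k)\<^sup>2 / 2)"
    "continuous_on UNIV U"
proof -
  have "\<exists>m. (\<exists>y\<in>D. m = u y - (norm (x - y))\<^sup>2 / (2 * \<epsilon>)) \<and>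
      (\<forall>y\<in>D. u y - (norm (x - y))\<^sup>2 / (2 * \<epsilon>) \<le> m)" for x
  proof -
    have "continuous_on D (\<lambda>y. u y - (norm (x - y))\<^sup>2 / (2 * \<epsilon>))"
      using \<epsilon> by (intro continuous_intros u) auto
    from continuous_attains_sup[OF D this] show ?thesis by blast
  qed
  then obtain U where U: "\<And>x. \<exists>y\<in>D. U x = u y - (norm (x - y))\<^sup>2 / (2 * \<epsilon>)"
    "\<And>x y. y \<in> D \<Longrightarrow> u y - (norm (x - y))\<^sup>2 / (2 * \<epsilon>) \<le> U x" by metis
  have step: "U (x + k) \<ge> U x - inner (x - y) k / \<epsilon> - (1 / \<epsilon>) * (norm k)\<^sup>2 / 2"
    if "y \<in> D" "U x = u y - (norm (x - y))\<^sup>2 / (2 * \<epsilon>)" for x y k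
  proof -
    have "x + k - y = (x - y) + k" by simp
    then have "(norm (x + k - y))\<^sup>2 = (norm (x - y))\<^sup>2 + 2 * inner (x - y) k + (norm k)\<^sup>2"
      by (simp only: power2_norm_eq_inner inner_simps inner_commute) (simp add: inner_commute algebra_simps)
    then show ?thesis using U(2)[OF that(1), of "x + k"] that(2)
      by (simp add: add_divide_distrib)
  qed
  have lower: "\<exists>l. linear l \<and> (\<forall>k. U (y + k) \<ge> U y + l k - (1 / \<epsilon>) * (norm k)\<^sup>2 / 2)" for y
  proof -
    obtain y' where "y' \<in> D" "U y = u y' - (norm (y - y'))\<^sup>2 / (2 * \<epsilon>)" using U(1) by blast
    from step[OF this] have "\<forall>k. U (y + k) \<ge> U y + - (inner (y - y') k / \<epsilon>) - (1 / \<epsilon>) * (norm k)\<^sup>2 / 2"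
      by simp
    moreover have "linear (\<lambda>k. - (inner (y - y') k / \<epsilon>))"
      by (intro linearI) (auto simp: inner_add_right add_divide_distrib)
    ultimately show ?thesis by (intro exI[of _ "\<lambda>k. - (inner (y - y') k / \<epsilon>)"]) simp
  qed
  obtain M where M: "\<And>y. y \<in> D \<Longrightarrow> norm y \<le> M" using compact_imp_bounded[OF D(1)] bounded_iff by blast
  have below: "U x - U x' \<le> ((norm x + M) * norm (x' - x) + (norm (x' - x))\<^sup>2) / \<epsilon>" for x x'
  proof -
    obtain y where y: "y \<in> D" "U x = u y - (norm (x - y))\<^sup>2 / (2 * \<epsilon>)" using U(1) by blast
    have "inner (x - y) (x' - x) \<le> norm (x - y) * norm (x' - x)" by (rule norm_cauchy_schwarz)
    also have "\<dots> \<le> (norm x + M) * norm (x' - x)"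
      using norm_triangle_ineq4[of x y] M[OF y(1)] by (intro mult_right_mono) auto
    finally have "inner (x - y) (x' - x) / \<epsilon> \<le> (norm x + M) * norm (x' - x) / \<epsilon>" using \<epsilon> by (simp add: divide_right_mono)
    moreover have "(1 / \<epsilon>) * (norm (x' - x))\<^sup>2 / 2 \<le> (norm (x' - x))\<^sup>2 / \<epsilon>" using \<epsilon> by (simp add: field_simps)
    ultimately show ?thesis using step[OF y, of "x' - x"] by (simp add: add_divide_distrib)
  qed
  have "isCont U x" for x
  proof -
    define G where "G = (\<lambda>x'. ((norm x' + norm x + M) * norm (x' - x) + (norm (x' - x))\<^sup>2) / \<epsilon>)"
    have "(G \<longlongrightarrow> ((norm x + norm x + M) * norm (x - x) + (norm (x - x))\<^sup>2) / \<epsilon>) (at x)"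
      unfolding G_def by (intro tendsto_intros) (use \<epsilon> in auto)
    then have G: "(G \<longlongrightarrow> 0) (at x)" by simp
    have "norm (U x' - U x) \<le> G x'" for x'
    proof -
      have M0: "M \<ge> 0" using D(2) M norm_ge_zero order.trans by (metis equals0I)
      have "(norm y + M) * norm (x' - x) \<le> (norm x' + norm x + M) * norm (x' - x)" if "y \<in> {x, x'}" for y
        using that M0 by (intro mult_right_mono) auto
      then have "((norm y + M) * norm (x' - x) + (norm (x' - x))\<^sup>2) / \<epsilon> \<le> G x'" if "y \<in> {x, x'}" for y
        unfolding G_def using \<epsilon> that by (intro divide_right_mono add_right_mono) auto
      from this[of x] this[of x'] below[of x x'] below[of x' x] show ?thesis
        by (auto simp: abs_le_iff norm_minus_commute)
    qed
    then have "((\<lambda>x'. U x' - U x) \<longlongrightarrow> 0) (at x)"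
      by (intro Lim_null_comparison[OF _ G]) auto
    then show ?thesis unfolding isCont_def by (rule LIM_zero_cancel)
  qed
  then have "continuous_on UNIV U" by (simp add: continuous_at_imp_continuous_on)
  with U lower show thesis by (rule that)
qed

text \<open>Shifting \<open>x\<close> and its maximiser \<open>y\<close> by the same
  \<open>h\<close> does not change the penalty, so the growth of \<open>u\<close> from
  \<open>y\<close> is at most that of \<open>U\<close> from \<open>x\<close>. Gradient and Hessian
  pass over unchanged; only the base point moves. A neighbourhood of \<open>y\<close> must lie in
  \<open>D\<close>.\<close>

lemma upper_jet_sup_convolution:
  assumes jet: "upper_jet T U x p X"
    and y: "U x = u y - (norm (x - y))\<^sup>2 / (2 * \<epsilon>)"
    and U: "\<And>x y. y \<in> D \<Longrightarrow> u y - (norm (x - y))\<^sup>2 / (2 * \<epsilon>) \<le> U x"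
    and D: "\<rho> > 0" "\<And>h. h \<in> T \<Longrightarrow> norm h < \<rho> \<Longrightarrow> y + h \<in> D"
  shows "upper_jet T u y p X"
proof -
  obtain s where s: "s > 0" "\<And>h. h \<in> T \<Longrightarrow> norm h < s \<Longrightarrow> U (x + h) \<le> U x + inner p h + X h h / 2"
    using jet by (auto simp: upper_jet_def)
  show ?thesis
    unfolding upper_jet_def
  proof (intro exI[of _ "min s \<rho>"] conjI ballI impI)
    fix h assume h: "h \<in> T" "norm h < min s \<rho>"
    have "u (y + h) - (norm (x + h - (y + h)))\<^sup>2 / (2 * \<epsilon>) \<le> U (x + h)" using h by (intro U D) auto
    then show "u (y + h) \<le> u y + inner p h + X h h / 2" using s(2)[of h] h y by simp
  qed (use s D in auto)
qed

section \<open>Eigenvalues of quadratic forms\<close>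

text \<open>Fewer equations than unknowns: a zero row makes the system square, and expansion along
  that row shows that the determinant vanishes.\<close>

lemma nontrivial_kernel:
  fixes c :: "nat \<Rightarrow> nat \<Rightarrow> real"
  obtains w where "\<exists>j\<le>m. w j \<noteq> 0" "\<And>i. i < m \<Longrightarrow> (\<Sum>j\<le>m. c i j * w j) = 0"
proof -
  define A where "A = mat (Suc m) (Suc m) (\<lambda>(i, j). if i < m then c i j else 0)"
  have A: "A \<in> carrier_mat (Suc m) (Suc m)" by (simp add: A_def)
  have "det A = 0"
    by (subst laplace_expansion_row[OF A, of m]) (auto simp: A_def)
  then obtain v where v: "v \<in> carrier_vec (Suc m)" "v \<noteq> 0\<^sub>v (Suc m)" "A *\<^sub>v v = 0\<^sub>v (Suc m)"
    using det_0_iff_vec_prod_zero_field[OF A] by blast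
  show thesis
  proof (rule that[of "\<lambda>j. v $ j"])
    have "\<exists>j<Suc m. v $ j \<noteq> 0"
    proof (rule ccontr)
      assume "\<not> ?thesis"
      then have "v = 0\<^sub>v (Suc m)" using v(1) by (intro eq_vecI) auto
      then show False using v(2) by simp
    qed
    then show "\<exists>j\<le>m. v $ j \<noteq> 0" by (auto simp: less_Suc_eq_le)
    fix i assume i: "i < m"
    then have "(A *\<^sub>v v) $ i = (\<Sum>j\<in>{0..<Suc m}. c i j * v $ j)"
      using v(1) by (simp add: A_def scalar_prod_def)
    also have "{0..<Suc m} = {..m}" by auto
    finally show "(\<Sum>j\<le>m. c i j * v $ j) = 0" using v(3) i by simp
  qed
qed

section \<open>Orthonormal families and minimisation of the Rayleigh quotient\<close>

definition orthonormal :: "nat \<Rightarrow> (nat \<Rightarrow> 'a::real_inner) \<Rightarrow> bool" where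
  "orthonormal k v \<longleftrightarrow> (\<forall>i<k. \<forall>j<k. inner (v i) (v j) = (if i = j then 1 else 0))"

lemma inner_orthonormal_sum:
  assumes "orthonormal k v" "i < k"
  shows "inner (v i) (\<Sum>j<k. c j *\<^sub>R v j) = c i"
proof -
  have "inner (v i) (\<Sum>j<k. c j *\<^sub>R v j) = (\<Sum>j<k. if j = i then c i else 0)"
    unfolding inner_sum_right using assms by (intro sum.cong) (auto simp: orthonormal_def)
  then show ?thesis using assms by simp
qed

lemma norm_orthonormal_sum:
  assumes "orthonormal k v"
  shows "(norm (\<Sum>j<k. c j *\<^sub>R v j))\<^sup>2 = (\<Sum>j<k. (c j)\<^sup>2)"
proof -
  have "inner (\<Sum>i<k. c i *\<^sub>R v i) (\<Sum>j<k. c j *\<^sub>R v j) = (\<Sum>i<k. c i * c i)"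
    unfolding inner_sum_left[of _ "{..<k}"] inner_scaleR_left
    by (intro sum.cong refl) (simp add: inner_orthonormal_sum[OF assms])
  then show ?thesis unfolding power2_norm_eq_inner by (simp add: power2_eq_square)
qed

text \<open>A dimension count, for arbitrary \<open>v\<close>. It supplies both the next competitor
  in the Rayleigh minimisation and the common vector in the comparison of eigenvalues.\<close>

lemma orthogonal_combination:
  assumes w: "orthonormal (Suc m) w"
  obtains c where "norm (\<Sum>j\<le>m. c j *\<^sub>R w j) = 1"
    "\<And>i. i < m \<Longrightarrow> inner (v i) (\<Sum>j\<le>m. c j *\<^sub>R w j) = 0"
proof -
  obtain c where c: "\<exists>j\<le>m. c j \<noteq> 0" "\<And>i. i < m \<Longrightarrow> (\<Sum>j\<le>m. inner (v i) (w j) * c j) = 0"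
    using nontrivial_kernel[of m "\<lambda>i j. inner (v i) (w j)"] by blast
  define z where "z = (\<Sum>j\<le>m. c j *\<^sub>R w j)"
  have "z \<noteq> 0"
  proof
    assume "z = 0"
    then have "c j = 0" if "j \<le> m" for j
      using inner_orthonormal_sum[OF w, of j c] that by (simp add: z_def lessThan_Suc_atMost)
    then show False using c(1) by blast
  qed
  have z: "(\<Sum>j\<le>m. (c j / norm z) *\<^sub>R w j) = (1 / norm z) *\<^sub>R z"
    by (simp add: z_def scaleR_sum_right divide_inverse mult.commute)
  show thesis
  proof (rule that[of "\<lambda>j. c j / norm z"])
    show "norm (\<Sum>j\<le>m. (c j / norm z) *\<^sub>R w j) = 1" using \<open>z \<noteq> 0\<close> by (simp add: z)
    show "inner (v i) (\<Sum>j\<le>m. (c j / norm z) *\<^sub>R w j) = 0" if "i < m" for i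
      using c(2)[OF that] unfolding z by (simp add: z_def inner_sum_right mult.commute)
  qed
qed

lemma orthonormal_axis: "orthonormal k axis_fsv"
  by (simp add: orthonormal_def inner_axis_fsv coord_axis)

lemma frame_Rn:
  assumes "n \<ge> 1"
  shows "frame (Rn n) (axis_fsv ` {..<n})"
proof
  show "axis_fsv ` {..<n} \<noteq> {}" using assms by (auto simp: lessThan_empty_iff)
  show "g = (\<Sum>e\<in>axis_fsv ` {..<n}. inner g e *\<^sub>R e)" if "g \<in> Rn n" for g
    using Rn_expand[OF that]
    by (subst sum.reindex) (auto simp: inner_axis_fsv intro: inj_on_subset[OF inj_axis])
qed (auto simp: subspace_Rn axis_in_Rn norm_axis_fsv compact_Rn_cball)

text \<open>The spectral theorem by successive minimisation: \<open>v i\<close> minimises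
  \<open>X z z\<close> over the unit vectors orthogonal to its predecessors. The last clause is the
  first order condition at the minimum and is what diagonalises \<open>X\<close>.\<close>

lemma rayleigh_basis:
  assumes X: "symmetric_form X" and n: "n \<ge> 1" and k: "k \<le> n"
  shows "\<exists>v. orthonormal k v \<and> (\<forall>i<k. v i \<in> Rn n \<and>
    (\<forall>z\<in>Rn n. (\<forall>j<i. inner (v j) z = 0) \<longrightarrow> X (v i) (v i) * (norm z)\<^sup>2 \<le> X z z) \<and>
    (\<forall>z\<in>Rn n. (\<forall>j\<le>i. inner (v j) z = 0) \<longrightarrow> X (v i) z = 0))"
  using k
proof (induction k)
  case 0
  show ?case by (simp add: orthonormal_def)
next
  case (Suc k)
  interpret frame "Rn n" "axis_fsv ` {..<n}" by (rule frame_Rn[OF n])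
  obtain v where v: "orthonormal k v" "\<And>i. i < k \<Longrightarrow> v i \<in> Rn n"
    "\<And>i z. i < k \<Longrightarrow> z \<in> Rn n \<Longrightarrow> (\<forall>j<i. inner (v j) z = 0) \<Longrightarrow> X (v i) (v i) * (norm z)\<^sup>2 \<le> X z z"
    "\<And>i z. i < k \<Longrightarrow> z \<in> Rn n \<Longrightarrow> (\<forall>j\<le>i. inner (v j) z = 0) \<Longrightarrow> X (v i) z = 0"
    using Suc by fastforce
  define G where "G = (Rn n \<inter> cball 0 1) \<inter> ({z. norm z = 1} \<inter> (\<Inter>j<k. {z. inner (v j) z = 0}))"
  have "compact G"
    unfolding G_def
    by (intro compact_Int_closed compact closed_Int closed_INT ballI closed_Collect_eq continuous_intros)
  moreover have "G \<noteq> {}"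
  proof -
    obtain c where c: "norm (\<Sum>j\<le>k. c j *\<^sub>R axis_fsv j) = 1"
      "\<And>i. i < k \<Longrightarrow> inner (v i) (\<Sum>j\<le>k. c j *\<^sub>R axis_fsv j) = 0"
      using orthogonal_combination[OF orthonormal_axis] by blast
    moreover have "(\<Sum>j\<le>k. c j *\<^sub>R axis_fsv j) \<in> Rn n"
      using Suc.prems by (intro subspace_sum[OF subspace_Rn] subspace_scale[OF subspace_Rn] axis_in_Rn) auto
    ultimately have "(\<Sum>j\<le>k. c j *\<^sub>R axis_fsv j) \<in> G" by (simp add: G_def)
    then show ?thesis by blast
  qed
  moreover have "continuous_on G (\<lambda>z. X z z)"
    by (rule continuous_on_subset[OF continuous_on_form[OF X]]) (auto simp: G_def)
  ultimately have "\<exists>y\<in>G. \<forall>z\<in>G. X y y \<le> X z z" by (rule continuous_attains_inf)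
  then obtain y where y: "y \<in> G" "\<And>z. z \<in> G \<Longrightarrow> X y y \<le> X z z" by blast
  have yG: "y \<in> Rn n" "norm y = 1" "\<And>j. j < k \<Longrightarrow> inner (v j) y = 0" using y(1) by (auto simp: G_def)
  have min: "X y y * (norm z)\<^sup>2 \<le> X z z" if z: "z \<in> Rn n" "\<forall>j<k. inner (v j) z = 0" for z
  proof (cases "z = 0")
    case False
    have "(1 / norm z) *\<^sub>R z \<in> G" using z False by (auto simp: G_def)
    from y(2)[OF this] show ?thesis
      using False by (simp add: symmetric_form_simps[OF X] power2_eq_square field_simps)
  qed (simp add: symmetric_form_simps[OF X])
  have crit: "X y z = 0" if z: "z \<in> Rn n" "\<forall>j<k. inner (v j) z = 0" "inner y z = 0" for z
  proof -
    define b where "b = X y z"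
    define c where "c = X z z - X y y * (norm z)\<^sup>2"
    have quad: "0 \<le> 2 * t * b + t\<^sup>2 * c" for t
    proof -
      have "X y y * (norm (y + t *\<^sub>R z))\<^sup>2 \<le> X (y + t *\<^sub>R z) (y + t *\<^sub>R z)"
        using z yG by (intro min) (auto simp: inner_add_right)
      moreover have "(norm (y + t *\<^sub>R z))\<^sup>2 = 1 + t\<^sup>2 * (norm z)\<^sup>2"
      proof -
        have "inner y y = 1" using yG(2) by (simp add: norm_eq_1)
        then show ?thesis unfolding power2_norm_eq_inner
          using z(3) by (simp add: inner_simps inner_commute[of z y] power2_eq_square)
      qed
      ultimately show ?thesis
        using symmetric_form_commute[OF X, of z y]
        by (simp add: symmetric_form_simps[OF X] b_def c_def power2_eq_square algebra_simps)
    qed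
    \<comment> \<open>A positive upper bound for \<open>c\<close>, so that dividing by it is safe
      even if \<open>c \<le> 0\<close>; at \<open>t = - b / e\<close> the quadratic is at most
      \<open>- (b\<^sup>2 / e)\<close>.\<close>
    define e where "e = \<bar>c\<bar> + 1"
    have e: "e > 0" "c \<le> e" by (auto simp: e_def)
    have "0 \<le> 2 * (- b / e) * b + (- b / e)\<^sup>2 * c" by (rule quad)
    also have "\<dots> \<le> 2 * (- b / e) * b + (- b / e)\<^sup>2 * e" using e by (intro add_left_mono mult_left_mono) auto
    also have "\<dots> = - (b\<^sup>2 / e)" using e by (simp add: power2_eq_square field_simps)
    finally have "b\<^sup>2 / e \<le> 0" by simp
    then show ?thesis using e by (simp add: b_def[symmetric] divide_le_0_iff)
  qed
  define v' where "v' = v(k := y)"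
  have v': "v' i = v i" if "i < k" for i using that by (simp add: v'_def)
  have v'k: "v' k = y" by (simp add: v'_def)
  show ?case
  proof (intro exI[of _ v'] conjI allI impI ballI)
    show "orthonormal (Suc k) v'"
      using v(1) yG(2,3) unfolding orthonormal_def v'_def
      by (auto simp: less_Suc_eq norm_eq_1 inner_commute)
    fix i assume i: "i < Suc k"
    show "v' i \<in> Rn n" using i v(2) yG(1) by (auto simp: v'_def)
    fix z assume z: "z \<in> Rn n"
    show "X (v' i) (v' i) * (norm z)\<^sup>2 \<le> X z z" if "\<forall>j<i. inner (v' j) z = 0"
      using i that v(3)[OF _ z] min[OF z] v' v'k by (cases "i = k") (auto simp: less_Suc_eq)
    show "X (v' i) z = 0" if "\<forall>j\<le>i. inner (v' j) z = 0"
    proof (cases "i = k")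
      case True
      then show ?thesis using that crit[OF z] v' v'k by (simp add: order.order_iff_strict)
    next
      case False
      then show ?thesis using that i v(4)[OF _ z, of i] v' by (simp add: order.order_iff_strict)
    qed
  qed
qed

section \<open>From the diagonalising basis to the ordered eigenvalues\<close>

definition form_mat :: "nat \<Rightarrow> (fsv \<Rightarrow> fsv \<Rightarrow> real) \<Rightarrow> real mat" where
  "form_mat n X = mat n n (\<lambda>(i, j). X (axis_fsv i) (axis_fsv j))"

text \<open>The matrix with columns \<open>v j\<close> is orthogonal and conjugates
  \<open>form_mat n X\<close> into a diagonal matrix, whose characteristic polynomial is read
  off.\<close>

lemma char_poly_form_mat:
  assumes X: "symmetric_form X" and v: "orthonormal n v" "\<And>i. i < n \<Longrightarrow> v i \<in> Rn n"
    and diag: "\<And>i j. i < n \<Longrightarrow> j < n \<Longrightarrow> i \<noteq> j \<Longrightarrow> X (v i) (v j) = 0"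
  shows "char_poly (form_mat n X) = (\<Prod>i\<leftarrow>[0..<n]. [:- X (v i) (v i), 1:])"
proof -
  define P where "P = mat n n (\<lambda>(i, j). coord (v j) i)"
  define D where "D = mat n n (\<lambda>(i, j). if i = j then X (v i) (v i) else 0)"
  let ?M = "form_mat n X" and ?Q = "transpose_mat P"
  have carr: "P \<in> carrier_mat n n" "?Q \<in> carrier_mat n n" "D \<in> carrier_mat n n" "?M \<in> carrier_mat n n"
    by (auto simp: P_def D_def form_mat_def)
  have QP: "?Q * P = 1\<^sub>m n"
  proof (rule eq_matI)
    fix i j assume ij: "i < dim_row (1\<^sub>m n)" "j < dim_col (1\<^sub>m n)"
    then have "(?Q * P) $$ (i, j) = (\<Sum>k\<in>{0..<n}. coord (v i) k * coord (v j) k)"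
      by (simp add: P_def scalar_prod_def)
    also have "\<dots> = inner (v i) (v j)" using ij inner_Rn[OF v(2)] by (simp add: atLeast0LessThan)
    finally show "(?Q * P) $$ (i, j) = 1\<^sub>m n $$ (i, j)" using ij v(1) by (simp add: orthonormal_def)
  qed (auto simp: P_def)
  then have PQ: "P * ?Q = 1\<^sub>m n" using mat_mult_left_right_inverse carr by blast
  have "?Q * (?M * P) = D"
  proof (rule eq_matI)
    fix i j assume ij: "i < dim_row D" "j < dim_col D"
    then have ij': "i < n" "j < n" by (auto simp: D_def)
    have MP: "(?M * P) $$ (k, j) = X (axis_fsv k) (v j)" if "k < n" for k
    proof -
      have "(?M * P) $$ (k, j) = (\<Sum>l<n. X (axis_fsv k) (axis_fsv l) * coord (v j) l)"
        using that ij' by (simp add: P_def form_mat_def scalar_prod_def atLeast0LessThan)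
      also have "\<dots> = X (axis_fsv k) (\<Sum>l<n. coord (v j) l *\<^sub>R axis_fsv l)"
        using symmetric_form_linear[OF X] by (simp add: linear_sum linear_scale mult.commute)
      finally show ?thesis using Rn_expand[OF v(2)[OF ij'(2)]] by simp
    qed
    have "(?Q * (?M * P)) $$ (i, j) = (\<Sum>k<n. coord (v i) k * X (axis_fsv k) (v j))"
      using ij' MP carr by (simp add: P_def form_mat_def scalar_prod_def atLeast0LessThan)
    also have "\<dots> = (\<Sum>k<n. coord (v i) k * X (v j) (axis_fsv k))"
      by (simp only: symmetric_form_commute[OF X, of "v j"])
    also have "\<dots> = X (v j) (\<Sum>k<n. coord (v i) k *\<^sub>R axis_fsv k)"
      using symmetric_form_linear[OF X] by (simp add: linear_sum linear_scale)
    also have "\<dots> = X (v j) (v i)" using Rn_expand[OF v(2)[OF ij'(1)]] by simp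
    finally show "(?Q * (?M * P)) $$ (i, j) = D $$ (i, j)" using ij' diag by (auto simp: D_def)
  qed (auto simp: P_def D_def form_mat_def)
  then have "P * D * ?Q = P * (?Q * (?M * P)) * ?Q" by simp
  also have "P * (?Q * (?M * P)) = (P * ?Q) * (?M * P)" using carr by (simp add: assoc_mult_mat[of _ n n _ n _ n])
  also have "\<dots> * ?Q = ?M * (P * ?Q)" using carr by (simp add: PQ assoc_mult_mat[of _ n n _ n _ n])
  also have "\<dots> = ?M" using carr by (simp add: PQ)
  finally have "similar_mat ?M D" using carr PQ QP by (intro similar_matI[of _ _ P ?Q n]) auto
  then have "char_poly ?M = char_poly D" by (rule char_poly_similar)
  also have "\<dots> = (\<Prod>a\<leftarrow>diag_mat D. [:- a, 1:])"
    by (rule char_poly_upper_triangular[OF carr(3)]) (auto simp: D_def upper_triangular_def)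
  also have "diag_mat D = map (\<lambda>i. X (v i) (v i)) [0..<n]" by (auto simp: diag_mat_def D_def)
  finally show ?thesis by (simp add: o_def)
qed

text \<open>Links the variational minima with the roots of the characteristic polynomial by which
  \<open>ordered_eigenvalue\<close> is defined: the minima increase, so listing them already sorts
  the roots. Vectors are numbered from 0 and eigenvalues from 1, hence \<open>Suc i\<close>.\<close>

lemma eigenbasis:
  assumes X: "symmetric_form X" and n: "n \<ge> 1"
  obtains v where "orthonormal n v" "\<And>i. i < n \<Longrightarrow> v i \<in> Rn n"
    "\<And>i j. i < n \<Longrightarrow> j < n \<Longrightarrow> i \<noteq> j \<Longrightarrow> X (v i) (v j) = 0"
    "\<And>i. i < n \<Longrightarrow> X (v i) (v i) = ordered_eigenvalue (Suc i) (form_mat n X)"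
    "\<And>i j. i \<le> j \<Longrightarrow> j < n \<Longrightarrow> X (v i) (v i) \<le> X (v j) (v j)"
    "\<And>i z. i < n \<Longrightarrow> z \<in> Rn n \<Longrightarrow> (\<forall>j<i. inner (v j) z = 0) \<Longrightarrow> X (v i) (v i) * (norm z)\<^sup>2 \<le> X z z"
proof -
  obtain v where v: "orthonormal n v" "\<And>i. i < n \<Longrightarrow> v i \<in> Rn n"
    "\<And>i z. i < n \<Longrightarrow> z \<in> Rn n \<Longrightarrow> (\<forall>j<i. inner (v j) z = 0) \<Longrightarrow> X (v i) (v i) * (norm z)\<^sup>2 \<le> X z z"
    "\<And>i z. i < n \<Longrightarrow> z \<in> Rn n \<Longrightarrow> (\<forall>j\<le>i. inner (v j) z = 0) \<Longrightarrow> X (v i) z = 0"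
    using rayleigh_basis[OF X n order.refl] by metis
  have orth: "inner (v i) (v j) = 0" if "i < n" "j < n" "i \<noteq> j" for i j
    using v(1) that by (simp add: orthonormal_def)
  have unit: "norm (v i) = 1" if "i < n" for i
    using v(1) that by (simp add: orthonormal_def norm_eq_1)
  have diag': "X (v i) (v j) = 0" if "i < j" "j < n" for i j
    using that by (intro v(4)) (auto intro!: v(2) orth)
  have diag: "X (v i) (v j) = 0" if "i < n" "j < n" "i \<noteq> j" for i j
    using diag'[of i j] diag'[of j i] that symmetric_form_commute[OF X, of "v i" "v j"] by (cases "i < j") auto
  have mono: "X (v i) (v i) \<le> X (v j) (v j)" if "i \<le> j" "j < n" for i j
  proof -
    have "\<forall>l<i. inner (v l) (v j) = 0" using that by (auto intro!: orth)
    then show ?thesis using v(3)[of i "v j"] v(2)[of j] that unit[of j] by simp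
  qed
  have "proots (char_poly (form_mat n X)) = mset (map (\<lambda>i. X (v i) (v i)) [0..<n])"
  proof -
    have "char_poly (form_mat n X) = (\<Prod>p\<leftarrow>map (\<lambda>i. [:- X (v i) (v i), 1:]) [0..<n]. p)"
      using char_poly_form_mat[OF X v(1,2) diag] by simp
    also have "proots \<dots> = (\<Sum>p\<leftarrow>map (\<lambda>i. [:- X (v i) (v i), 1:]) [0..<n]. proots p)"
      by (rule proots_prod_list) auto
    also have "\<dots> = (\<Sum>i\<leftarrow>[0..<n]. {#X (v i) (v i)#})" by (simp add: o_def)
    also have "\<dots> = mset (map (\<lambda>i. X (v i) (v i)) [0..<n])" by (induction n) auto
    finally show ?thesis .
  qed
  moreover have "sorted (map (\<lambda>i. X (v i) (v i)) [0..<n])" by (auto simp: sorted_iff_nth_mono intro: mono)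
  ultimately have "sorted_list_of_multiset (proots (char_poly (form_mat n X))) = map (\<lambda>i. X (v i) (v i)) [0..<n]"
    by (simp add: sorted_sort_id del: mset_map)
  then have eq: "X (v i) (v i) = ordered_eigenvalue (Suc i) (form_mat n X)" if "i < n" for i
    using that by (simp add: ordered_eigenvalue_def)
  show thesis by (rule that[OF v(1,2) diag eq mono v(3)])
qed

lemma eigenvalue_first_le:
  assumes X: "symmetric_form X" and n: "n \<ge> 1" and z: "z \<in> Rn n"
  shows "ordered_eigenvalue 1 (form_mat n X) * (norm z)\<^sup>2 \<le> X z z"
proof -
  obtain v where v: "\<And>i. i < n \<Longrightarrow> X (v i) (v i) = ordered_eigenvalue (Suc i) (form_mat n X)"
    "\<And>i z. i < n \<Longrightarrow> z \<in> Rn n \<Longrightarrow> (\<forall>j<i. inner (v j) z = 0) \<Longrightarrow> X (v i) (v i) * (norm z)\<^sup>2 \<le> X z z"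
    by (rule eigenbasis[OF X n]) (rule that; assumption)
  show ?thesis using v(2)[of 0 z] v(1)[of 0] n z by simp
qed

lemma eigenvalue_last_ge:
  assumes X: "symmetric_form X" and n: "n \<ge> 1" and z: "z \<in> Rn n"
  shows "X z z \<le> ordered_eigenvalue n (form_mat n X) * (norm z)\<^sup>2"
proof -
  obtain v where v: "orthonormal n v" "\<And>i. i < n \<Longrightarrow> v i \<in> Rn n"
    "\<And>i j. i < n \<Longrightarrow> j < n \<Longrightarrow> i \<noteq> j \<Longrightarrow> X (v i) (v j) = 0"
    "\<And>i. i < n \<Longrightarrow> X (v i) (v i) = ordered_eigenvalue (Suc i) (form_mat n X)"
    "\<And>i j. i \<le> j \<Longrightarrow> j < n \<Longrightarrow> X (v i) (v i) \<le> X (v j) (v j)"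
    by (rule eigenbasis[OF X n]) (rule that; assumption)
  obtain c where c: "z = (\<Sum>j<n. c j *\<^sub>R v j)"
  proof -
    \<comment> \<open>That \<open>v\<close> spans \<open>Rn n\<close> is obtained from a linear
      relation among its \<open>n\<close> members and \<open>z\<close>: there are \<open>n\<close>
      coordinate equations and \<open>n + 1\<close> unknowns. Orthonormality excludes a zero
      coefficient of \<open>z\<close>.\<close>
    obtain w where w: "\<exists>j\<le>n. w j \<noteq> 0"
      "\<And>i. i < n \<Longrightarrow> (\<Sum>j\<le>n. (if j < n then coord (v j) i else coord z i) * w j) = 0"
      using nontrivial_kernel[of n "\<lambda>i j. if j < n then coord (v j) i else coord z i"] by blast
    have sum0: "(\<Sum>j<n. w j *\<^sub>R v j) + w n *\<^sub>R z = 0"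
    proof (rule fsv_eqI)
      fix i
      show "coord ((\<Sum>j<n. w j *\<^sub>R v j) + w n *\<^sub>R z) i = coord 0 i"
      proof (cases "i < n")
        case True
        have "{..n} = insert n {..<n}" by auto
        then show ?thesis using w(2)[OF True] by (simp add: coord_sum mult.commute)
      next
        case False
        then show ?thesis using v(2) z by (simp add: coord_sum Rn_def)
      qed
    qed
    have "w n \<noteq> 0"
    proof
      assume "w n = 0"
      then have "w j = 0" if "j < n" for j
        using inner_orthonormal_sum[OF v(1) that, of w] sum0 by simp
      then show False using w(1) \<open>w n = 0\<close> by (metis nat_less_le)
    qed
    then have "z = (\<Sum>j<n. (- w j / w n) *\<^sub>R v j)"
    proof -
      have "w n *\<^sub>R z = - (\<Sum>j<n. w j *\<^sub>R v j)" using sum0 by (metis add.commute add_eq_0_iff)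
      then have "(1 / w n) *\<^sub>R (w n *\<^sub>R z) = (\<Sum>j<n. (- w j / w n) *\<^sub>R v j)"
        by (simp add: scaleR_sum_right sum_negf[symmetric] divide_inverse mult.commute)
      then show ?thesis using \<open>w n \<noteq> 0\<close> by simp
    qed
    then show thesis by (rule that)
  qed
  have Xv: "X (v i) z = c i * X (v i) (v i)" if i: "i < n" for i
  proof -
    have "X (v i) z = (\<Sum>j<n. c j * X (v i) (v j))"
      using symmetric_form_linear[OF X] by (simp add: c linear_sum linear_scale)
    also have "\<dots> = (\<Sum>j<n. if j = i then c i * X (v i) (v i) else 0)"
      using v(3) i by (intro sum.cong) auto
    finally show ?thesis using i by simp
  qed
  have "X z z = (\<Sum>i<n. c i * X z (v i))"
    using symmetric_form_linear[OF X, of z] by (subst (2) c) (simp add: linear_sum linear_scale)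
  also have "\<dots> = (\<Sum>i<n. (c i)\<^sup>2 * X (v i) (v i))"
    using Xv by (intro sum.cong) (simp_all add: symmetric_form_commute[OF X, of z] power2_eq_square)
  also have "\<dots> \<le> (\<Sum>i<n. (c i)\<^sup>2 * X (v (n - 1)) (v (n - 1)))"
    using n by (intro sum_mono mult_left_mono v(5)) auto
  also have "\<dots> = X (v (n - 1)) (v (n - 1)) * (norm z)\<^sup>2"
    unfolding c norm_orthonormal_sum[OF v(1)] by (simp only: sum_distrib_left mult.commute)
  also have "X (v (n - 1)) (v (n - 1)) = ordered_eigenvalue n (form_mat n X)" using v(4)[of "n - 1"] n by simp
  finally show ?thesis .
qed

text \<open>The Courant-Fischer argument. Some unit \<open>z\<close> in the span of the first
  \<open>Suc m\<close> eigenvectors of \<open>Y\<close> is orthogonal to the first \<open>m\<close>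
  eigenvectors of \<open>X\<close>; for it \<open>X z z\<close> is at least the eigenvalue of
  \<open>X\<close>, and \<open>Y z z\<close> at most that of \<open>Y\<close>.\<close>

lemma eigenvalue_mono:
  assumes X: "symmetric_form X" and Y: "symmetric_form Y" and n: "n \<ge> 1" and i: "i \<in> {1..n}"
    and le: "\<And>z. z \<in> Rn n \<Longrightarrow> X z z \<le> Y z z + c * (norm z)\<^sup>2"
  shows "ordered_eigenvalue i (form_mat n X) \<le> ordered_eigenvalue i (form_mat n Y) + c"
proof -
  obtain m where m: "i = Suc m" "m < n" using i by (metis Suc_le_eq atLeastAtMost_iff One_nat_def not0_implies_Suc not_one_le_zero)
  obtain v where v: "\<And>i. i < n \<Longrightarrow> X (v i) (v i) = ordered_eigenvalue (Suc i) (form_mat n X)"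
    "\<And>i z. i < n \<Longrightarrow> z \<in> Rn n \<Longrightarrow> (\<forall>j<i. inner (v j) z = 0) \<Longrightarrow> X (v i) (v i) * (norm z)\<^sup>2 \<le> X z z"
    by (rule eigenbasis[OF X n]) (rule that; assumption)
  obtain w where w: "orthonormal n w" "\<And>i. i < n \<Longrightarrow> w i \<in> Rn n"
    "\<And>i j. i < n \<Longrightarrow> j < n \<Longrightarrow> i \<noteq> j \<Longrightarrow> Y (w i) (w j) = 0"
    "\<And>i. i < n \<Longrightarrow> Y (w i) (w i) = ordered_eigenvalue (Suc i) (form_mat n Y)"
    "\<And>i j. i \<le> j \<Longrightarrow> j < n \<Longrightarrow> Y (w i) (w i) \<le> Y (w j) (w j)"
    by (rule eigenbasis[OF Y n]) (rule that; assumption)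
  have w': "orthonormal (Suc m) w" using w(1) m by (simp add: orthonormal_def)
  obtain b where b: "norm (\<Sum>j\<le>m. b j *\<^sub>R w j) = 1"
      "\<And>i. i < m \<Longrightarrow> inner (v i) (\<Sum>j\<le>m. b j *\<^sub>R w j) = 0"
    using orthogonal_combination[OF w'] by blast
  define z where "z = (\<Sum>j<Suc m. b j *\<^sub>R w j)"
  have z: "norm z = 1" "\<And>i. i < m \<Longrightarrow> inner (v i) z = 0" using b by (auto simp: z_def lessThan_Suc_atMost)
  have zR: "z \<in> Rn n"
    unfolding z_def using m by (intro subspace_sum[OF subspace_Rn] subspace_scale[OF subspace_Rn] w(2)) auto
  have Yw: "Y (w j) z = b j * Y (w j) (w j)" if j: "j < Suc m" for j
  proof -
    have "Y (w j) z = (\<Sum>l<Suc m. b l * Y (w j) (w l))"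
      using symmetric_form_linear[OF Y] unfolding z_def by (simp only: linear_sum linear_scale real_scaleR_def)
    also have "\<dots> = (\<Sum>l<Suc m. if l = j then b j * Y (w j) (w j) else 0)"
      using w(3) j m by (intro sum.cong) auto
    finally show ?thesis using j by simp
  qed
  have "ordered_eigenvalue i (form_mat n X) \<le> X z z" using v(2)[OF m(2) zR] z v(1)[OF m(2)] m(1) by simp
  also have "\<dots> \<le> Y z z + c" using le[OF zR] z(1) by simp
  also have "Y z z = (\<Sum>j<Suc m. b j * Y z (w j))"
    using symmetric_form_linear[OF Y, of z] by (subst (2) z_def) (simp only: linear_sum linear_scale real_scaleR_def)
  also have "\<dots> = (\<Sum>j<Suc m. (b j)\<^sup>2 * Y (w j) (w j))"
    using Yw by (intro sum.cong) (simp_all add: symmetric_form_commute[OF Y, of z] power2_eq_square)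
  also have "\<dots> \<le> (\<Sum>j<Suc m. (b j)\<^sup>2 * Y (w m) (w m))"
    using m by (intro sum_mono mult_left_mono w(5)) auto
  also have "\<dots> = Y (w m) (w m) * (norm z)\<^sup>2"
    unfolding z_def norm_orthonormal_sum[OF w'] by (simp only: sum_distrib_left mult.commute)
  also have "\<dots> = ordered_eigenvalue i (form_mat n Y)" using w(4)[OF m(2)] m(1) z(1) by simp
  finally show ?thesis by simp
qed

section \<open>The doubling argument\<close>

abbreviation wes :: "nat \<Rightarrow> (nat \<Rightarrow> real) \<Rightarrow> (fsv \<Rightarrow> fsv \<Rightarrow> real) \<Rightarrow> real" where
  "wes n \<alpha> X \<equiv> weighted_eigenvalue_sum n \<alpha> (form_mat n X)"

lemma eigenvalue_attained:
  assumes X: "symmetric_form X" and n: "n \<ge> 1" and i: "i \<in> {1..n}"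
  obtains z where "z \<in> Rn n" "norm z = 1" "X z z = ordered_eigenvalue i (form_mat n X)"
proof -
  obtain v where v: "orthonormal n v" "\<And>i. i < n \<Longrightarrow> v i \<in> Rn n"
    "\<And>i. i < n \<Longrightarrow> X (v i) (v i) = ordered_eigenvalue (Suc i) (form_mat n X)"
    by (rule eigenbasis[OF X n]) (rule that; assumption)
  show thesis
    by (rule that[of "v (i - 1)"]) (use v i in \<open>auto simp: orthonormal_def norm_eq_1\<close>)
qed

lemma symmetric_form_uminus: "symmetric_form X \<Longrightarrow> symmetric_form (\<lambda>x y. - X x y)"
  using symmetric_form_scale[of X "-1"] by simp

lemma wes_mono:
  assumes X: "symmetric_form X" and Y: "symmetric_form Y" and n: "n \<ge> 1"
    and \<alpha>: "\<And>i. i \<in> {1..n} \<Longrightarrow> \<alpha> i \<ge> 0" "(\<Sum>i=1..n. \<alpha> i) = 1"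
    and le: "\<And>z. z \<in> Rn n \<Longrightarrow> X z z \<le> Y z z + c * (norm z)\<^sup>2"
  shows "wes n \<alpha> X \<le> wes n \<alpha> Y + c"
proof -
  have "wes n \<alpha> X \<le> (\<Sum>i=1..n. \<alpha> i * (ordered_eigenvalue i (form_mat n Y) + c))"
    unfolding weighted_eigenvalue_sum_def
    by (intro sum_mono mult_left_mono eigenvalue_mono[OF X Y n] le \<alpha>) auto
  also have "\<dots> = wes n \<alpha> Y + c"
    using \<alpha>(2) by (simp add: weighted_eigenvalue_sum_def distrib_left sum.distrib sum_distrib_right[symmetric])
  finally show ?thesis .
qed

text \<open>
  The form on the right is the Hessian of the doubling function.  Tangentially it forces \<open>X \<le> Y\<close>, while
  in direction \<open>e\<close> either \<open>X\<close> has an eigenvalue below \<open>- 2 (1 - \<delta>) \<kappa>\<close> or \<open>Y\<close> has one above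
  \<open>2 (1 - \<delta>) \<kappa>\<close>.  As \<open>\<delta> < 1/2\<close>, such an eigenvalue is strictly beyond the range \<open>Y \<ge> - \<kappa>\<close>, \<open>X \<le> \<kappa>\<close>,
  so the first or the last eigenvalue of \<open>X\<close> is strictly smaller than that of \<open>Y\<close>.
\<close>

lemma wes_doubling_gap:
  assumes X: "symmetric_form X" and Y: "symmetric_form Y" and n: "n \<ge> 1"
    and \<alpha>: "\<And>i. i \<in> {1..n} \<Longrightarrow> \<alpha> i \<ge> 0" "(\<Sum>i=1..n. \<alpha> i) = 1"
    and e: "e \<in> Rn n" "norm e = 1" and \<kappa>: "\<kappa> \<ge> 0" and \<delta>: "\<delta> < 1 / 2"
    and le: "\<And>\<xi> \<eta>. \<xi> \<in> Rn n \<Longrightarrow> \<eta> \<in> Rn n \<Longrightarrow> X \<xi> \<xi> - Y \<eta> \<eta> \<le>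
      \<kappa> * ((norm (\<xi> - \<eta>))\<^sup>2 - (2 - \<delta>) * (inner e (\<xi> - \<eta>))\<^sup>2) + m * ((norm \<xi>)\<^sup>2 + (norm \<eta>)\<^sup>2)"
  shows "wes n \<alpha> X \<le> wes n \<alpha> Y + 2 * m - min (\<alpha> 1) (\<alpha> n) * ((1 - 2 * \<delta>) * \<kappa>)"
proof -
  define x y where "x i = ordered_eigenvalue i (form_mat n X)" and "y i = ordered_eigenvalue i (form_mat n Y)" for i
  \<comment> \<open>The difference between \<open>2 * (1 - \<delta>) * \<kappa>\<close>, half of the
    gap in direction \<open>e\<close>, and the bound \<open>\<kappa>\<close> for the other
    form.\<close>
  define \<gamma> where "\<gamma> = (1 - 2 * \<delta>) * \<kappa>"
  have \<gamma>: "\<gamma> \<ge> 0" using \<kappa> \<delta> by (simp add: \<gamma>_def)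
  \<comment> \<open>Equal arguments \<open>\<xi> = \<eta>\<close> remove the term with
    \<open>\<kappa>\<close>, which orders all eigenvalues up to \<open>2 * m\<close>.\<close>
  have xy: "x i \<le> y i + 2 * m" if "i \<in> {1..n}" for i
    unfolding x_def y_def using le by (intro eigenvalue_mono[OF X Y n that]) force
  have zero: "0 \<in> Rn n" by (simp add: Rn_def)
  have inner_e: "inner e e = 1" using e(2) by (simp add: norm_eq_1)
  have neg_e: "- e \<in> Rn n" using e(1) by (simp add: Rn_def)
  have X_le: "X z z \<le> \<kappa> + m" if z: "z \<in> Rn n" "norm z = 1" for z
  proof -
    have "\<kappa> * (1 - (2 - \<delta>) * (inner e z)\<^sup>2) \<le> \<kappa> * 1" using \<kappa> \<delta> by (intro mult_left_mono) auto
    then show ?thesis using le[OF z(1) zero] z(2) by (simp add: symmetric_form_simps[OF Y])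
  qed
  have Y_ge: "Y z z \<ge> - \<kappa> - m" if z: "z \<in> Rn n" "norm z = 1" for z
  proof -
    have "\<kappa> * (1 - (2 - \<delta>) * (inner e z)\<^sup>2) \<le> \<kappa> * 1" using \<kappa> \<delta> by (intro mult_left_mono) auto
    then show ?thesis using le[OF zero z(1)] z(2) by (simp add: symmetric_form_simps[OF X])
  qed
  \<comment> \<open>The pair \<open>e\<close>, \<open>- e\<close> has difference
    \<open>2 *\<^sub>R e\<close>, and
    \<open>4 * (1 - (2 - \<delta>)) = - 4 * (1 - \<delta>)\<close>. It is the concavity of the power
    along \<open>e\<close> that makes the sign negative.\<close>
  have "X e e - Y e e \<le> - (4 * ((1 - \<delta>) * \<kappa>)) + 2 * m"
  proof -
    have "e - - e = 2 *\<^sub>R e" by (simp add: scaleR_2)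
    then show ?thesis using le[OF e(1) neg_e] e(2) inner_e
      by (simp add: symmetric_form_simps[OF Y] power_mult_distrib algebra_simps)
  qed
  then consider "X e e \<le> - (2 * ((1 - \<delta>) * \<kappa>)) + m" | "Y e e \<ge> 2 * ((1 - \<delta>) * \<kappa>) - m" by linarith
  then have "x 1 \<le> y 1 + 2 * m - \<gamma> \<or> x n \<le> y n + 2 * m - \<gamma>"
  proof cases
    case 1
    have "1 \<in> {1..n}" using n by simp
    then obtain z where "z \<in> Rn n" "norm z = 1" "Y z z = y 1"
      using eigenvalue_attained[OF Y n, of 1] by (metis y_def)
    then have "y 1 \<ge> - \<kappa> - m" using Y_ge by metis
    moreover have "x 1 \<le> X e e" using eigenvalue_first_le[OF X n e(1)] e(2) by (simp add: x_def)
    ultimately show ?thesis using 1 by (simp add: \<gamma>_def algebra_simps)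
  next
    case 2
    have "n \<in> {1..n}" using n by simp
    then obtain z where "z \<in> Rn n" "norm z = 1" "X z z = x n"
      using eigenvalue_attained[OF X n, of n] by (metis x_def)
    then have "x n \<le> \<kappa> + m" using X_le by metis
    moreover have "Y e e \<le> y n" using eigenvalue_last_ge[OF Y n e(1)] e(2) by (simp add: y_def)
    ultimately show ?thesis using 2 by (simp add: \<gamma>_def algebra_simps)
  qed
  then obtain j where j: "j \<in> {1, n}" "x j \<le> y j + 2 * m - \<gamma>" by auto
  have jn: "j \<in> {1..n}" using j n by auto
  have "wes n \<alpha> X \<le> (\<Sum>i=1..n. \<alpha> i * y i + (\<alpha> i * (2 * m) - (if i = j then \<alpha> j * \<gamma> else 0)))"
    unfolding weighted_eigenvalue_sum_def x_def[symmetric]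
  proof (rule sum_mono)
    fix i assume i: "i \<in> {1..n}"
    have "x i \<le> y i + 2 * m - (if i = j then \<gamma> else 0)" using xy[OF i] j(2) by auto
    then have "\<alpha> i * x i \<le> \<alpha> i * (y i + 2 * m - (if i = j then \<gamma> else 0))" using \<alpha>(1)[OF i] by (rule mult_left_mono)
    then show "\<alpha> i * x i \<le> \<alpha> i * y i + (\<alpha> i * (2 * m) - (if i = j then \<alpha> j * \<gamma> else 0))"
      by (auto simp: algebra_simps split: if_splits)
  qed
  also have "\<dots> = wes n \<alpha> Y + ((\<Sum>i=1..n. \<alpha> i) * (2 * m) - \<alpha> j * \<gamma>)"
    unfolding sum.distrib sum_subtractf sum_distrib_right[symmetric]
    using jn by (simp add: weighted_eigenvalue_sum_def y_def)
  finally have "wes n \<alpha> X \<le> wes n \<alpha> Y + (2 * m - \<alpha> j * \<gamma>)" using \<alpha>(2) by simp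
  moreover have "\<alpha> j * \<gamma> \<ge> min (\<alpha> 1) (\<alpha> n) * \<gamma>" using j \<gamma> by (intro mult_right_mono) auto
  ultimately show ?thesis unfolding \<gamma>_def by linarith
qed

section \<open>Second order expansion of the doubling penalty\<close>

lemma powr_taylor:
  fixes \<gamma> \<tau> :: real
  assumes "\<tau> > 0"
  obtains t where "t > 0" "\<And>s. \<bar>s\<bar> < t \<Longrightarrow> (1 + s) powr \<gamma> \<le> 1 + \<gamma> * s - (\<gamma> * (1 - \<gamma>) / 2 - \<tau>) * s\<^sup>2"
proof -
  have "((\<lambda>s::real. ((1 + s) powr \<gamma> - 1 - \<gamma> * s) / s\<^sup>2) \<longlongrightarrow> - (\<gamma> * (1 - \<gamma>) / 2)) (at 0)"
    by (real_asymp simp: field_simps)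
  then have "\<forall>\<^sub>F s in at 0. ((1 + s) powr \<gamma> - 1 - \<gamma> * s) / s\<^sup>2 < - (\<gamma> * (1 - \<gamma>) / 2) + \<tau>"
    using assms by (intro order_tendstoD(2)) auto
  then obtain t where t: "t > 0" "\<And>s. s \<noteq> 0 \<Longrightarrow> \<bar>s\<bar> < t \<Longrightarrow>
      ((1 + s) powr \<gamma> - 1 - \<gamma> * s) / s\<^sup>2 < - (\<gamma> * (1 - \<gamma>) / 2) + \<tau>"
    by (auto simp: eventually_at dist_real_def)
  show thesis
  proof (rule that[OF t(1)])
    fix s :: real assume s: "\<bar>s\<bar> < t"
    show "(1 + s) powr \<gamma> \<le> 1 + \<gamma> * s - (\<gamma> * (1 - \<gamma>) / 2 - \<tau>) * s\<^sup>2"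
    proof (cases "s = 0")
      case False
      then have "(1 + s) powr \<gamma> - 1 - \<gamma> * s < (- (\<gamma> * (1 - \<gamma>) / 2) + \<tau>) * s\<^sup>2"
        using t(2)[OF False s] by (simp add: pos_divide_less_eq)
      then show ?thesis by (simp add: algebra_simps)
    qed simp
  qed
qed

text \<open>The power of the norm is the power \<open>\<delta> / 2\<close> of the squared norm,
  which is a quadratic polynomial in \<open>k\<close>; so the one-dimensional expansion suffices.
  The term with \<open>\<tau>\<close> absorbs every remainder and keeps the inequality
  exact.\<close>

lemma norm_powr_jet:
  fixes g :: "'a::real_inner"
  assumes g: "g \<noteq> 0" and \<delta>: "0 < \<delta>" "\<delta> < 2" and \<tau>: "\<tau> > 0"
  obtains t where "t > 0" "\<And>k. norm k < t \<Longrightarrow> norm (g + k) powr \<delta> \<le> norm g powr \<delta> +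
     \<delta> * norm g powr (\<delta> - 2) * inner g k +
     \<delta> * norm g powr (\<delta> - 2) * ((norm k)\<^sup>2 - (2 - \<delta>) * (inner (g /\<^sub>R norm g) k)\<^sup>2) / 2 + \<tau> * (norm k)\<^sup>2"
proof -
  define \<rho> where "\<rho> = norm g"
  have \<rho>: "\<rho> > 0" using g by (simp add: \<rho>_def)
  define \<gamma> where "\<gamma> = \<delta> / 2"
  define q where "q = \<gamma> * (1 - \<gamma>) / 2"
  have q: "q > 0" using \<delta> by (simp add: q_def \<gamma>_def)
  define P where "P = \<rho> powr \<delta>"
  have P: "P > 0" using \<rho> by (simp add: P_def)
  \<comment> \<open>As \<open>s\<^sup>2\<close> is at most
    \<open>9 * (norm k)\<^sup>2 / \<rho>\<^sup>2\<close>, this value makes the Taylor error at most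
    \<open>\<tau> * (norm k)\<^sup>2 / 2\<close>.\<close>
  define \<tau>' where "\<tau>' = \<tau> * \<rho>\<^sup>2 / (18 * P)"
  have \<tau>': "\<tau>' > 0" using \<tau> \<rho> P by (simp add: \<tau>'_def)
  obtain t0 where t0: "t0 > 0"
    "\<And>s. \<bar>s\<bar> < t0 \<Longrightarrow> (1 + s) powr \<gamma> \<le> 1 + \<gamma> * s - (\<gamma> * (1 - \<gamma>) / 2 - \<tau>') * s\<^sup>2"
    by (rule powr_taylor[OF \<tau>', of \<gamma>]) (rule that; assumption)
  \<comment> \<open>The entries give, in turn,
    \<open>\<bar>s\<bar> \<le> 3 * norm k / \<rho>\<close>, the range of \<open>powr_taylor\<close>,
    and a cubic part of \<open>s\<^sup>2\<close> that costs at most the other half of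
    \<open>\<tau> * (norm k)\<^sup>2\<close>.\<close>
  define t where "t = min \<rho> (min (t0 * \<rho> / 3) (\<tau> * \<rho> ^ 3 / (8 * P * q)))"
  show thesis
  proof (rule that)
    show "t > 0" using \<rho> t0 \<tau> P q by (simp add: t_def)
    fix k :: 'a assume "norm k < t"
    then have k: "norm k \<le> \<rho>" "norm k < t0 * \<rho> / 3" "norm k \<le> \<tau> * \<rho> ^ 3 / (8 * P * q)" by (auto simp: t_def)
    define b where "b = inner g k"
    define s where "s = (2 * b + (norm k)\<^sup>2) / \<rho>\<^sup>2"
    have b: "\<bar>b\<bar> \<le> \<rho> * norm k" unfolding b_def \<rho>_def by (rule Cauchy_Schwarz_ineq2)
    have kk: "norm k * norm k \<le> \<rho> * norm k" using k(1) by (intro mult_right_mono) auto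
    have "\<bar>2 * b + (norm k)\<^sup>2\<bar> \<le> 3 * (\<rho> * norm k)"
      using b kk zero_le_square[of "norm k"] unfolding abs_le_iff power2_eq_square by linarith
    then have s_le: "\<bar>s\<bar> \<le> 3 * norm k / \<rho>"
      using \<rho> by (simp add: s_def field_simps power2_eq_square)
    also have "\<dots> < t0" using k(2) \<rho> by (simp add: field_simps)
    finally have "(1 + s) powr \<gamma> \<le> 1 + \<gamma> * s - (q - \<tau>') * s\<^sup>2" using t0(2) by (simp add: q_def)
    moreover have "norm (g + k) powr \<delta> = P * (1 + s) powr \<gamma>"
    proof -
      have "(norm (g + k))\<^sup>2 = \<rho>\<^sup>2 * (1 + s)"
        unfolding power2_norm_eq_inner using \<rho>
        by (simp add: s_def b_def \<rho>_def inner_simps inner_commute field_simps power2_norm_eq_inner)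
      moreover from this have "1 + s \<ge> 0"
        using \<rho> by (metis zero_le_mult_iff zero_le_power2 zero_less_power not_le)
      moreover have "norm (g + k) powr \<delta> = ((norm (g + k))\<^sup>2) powr \<gamma>"
        by (cases "g + k = 0") (auto simp: \<gamma>_def powr_powr simp flip: powr_numeral)
      moreover have "(\<rho>\<^sup>2) powr \<gamma> = P" using \<rho> by (simp add: \<gamma>_def P_def powr_powr flip: powr_numeral)
      ultimately show ?thesis by (simp add: powr_mult)
    qed
    moreover have "P * (q * s\<^sup>2) \<ge> P * (4 * q * b\<^sup>2 / \<rho> ^ 4) - \<tau> * (norm k)\<^sup>2 / 2"
    proof -
      have "(2 * b + (norm k)\<^sup>2)\<^sup>2 \<ge> 4 * b\<^sup>2 - 4 * (\<rho> * norm k) * (norm k)\<^sup>2"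
      proof -
        have "- (b * (norm k)\<^sup>2) \<le> (\<rho> * norm k) * (norm k)\<^sup>2"
          using b mult_right_mono[of "- b" "\<rho> * norm k" "(norm k)\<^sup>2"] by simp
        then show ?thesis by (simp add: power2_sum algebra_simps)
      qed
      then have "s\<^sup>2 \<ge> (4 * b\<^sup>2 - 4 * (\<rho> * norm k) * (norm k)\<^sup>2) / \<rho> ^ 4"
        using \<rho> by (simp add: s_def power_divide divide_right_mono)
      then have "P * (q * s\<^sup>2) \<ge> P * (q * ((4 * b\<^sup>2 - 4 * (\<rho> * norm k) * (norm k)\<^sup>2) / \<rho> ^ 4))"
        using P q by (intro mult_left_mono) auto
      moreover have "P * (q * (4 * (\<rho> * norm k) * (norm k)\<^sup>2 / \<rho> ^ 4)) \<le> \<tau> * (norm k)\<^sup>2 / 2"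
      proof -
        have "P * q * 8 * norm k \<le> \<tau> * \<rho> ^ 3" using k(3) P q by (simp add: field_simps)
        then have "P * q * 4 * norm k / \<rho> ^ 3 \<le> \<tau> / 2" using \<rho> by (simp add: field_simps)
        then have "P * q * 4 * norm k / \<rho> ^ 3 * (norm k)\<^sup>2 \<le> \<tau> / 2 * (norm k)\<^sup>2" by (rule mult_right_mono) simp
        moreover have "P * (q * (4 * (\<rho> * norm k) * (norm k)\<^sup>2 / \<rho> ^ 4)) = P * q * 4 * norm k / \<rho> ^ 3 * (norm k)\<^sup>2"
          using \<rho> by (simp add: field_simps power4_eq_xxxx power3_eq_cube)
        ultimately show ?thesis by simp
      qed
      ultimately show ?thesis by (simp add: diff_divide_distrib right_diff_distrib mult_ac)
    qed
    moreover have "P * (\<tau>' * s\<^sup>2) \<le> \<tau> * (norm k)\<^sup>2 / 2"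
    proof -
      have "\<bar>s\<bar>\<^sup>2 \<le> (3 * norm k / \<rho>)\<^sup>2" using s_le by (intro power_mono) auto
      then have "P * (\<tau>' * s\<^sup>2) \<le> P * (\<tau>' * (3 * norm k / \<rho>)\<^sup>2)" using P \<tau>' by simp
      also have "\<dots> = \<tau> * (norm k)\<^sup>2 / 2" using P \<rho> by (simp add: \<tau>'_def field_simps power2_eq_square)
      finally show ?thesis .
    qed
    ultimately have "norm (g + k) powr \<delta> \<le> P * (1 + \<gamma> * s) - P * (4 * q * b\<^sup>2 / \<rho> ^ 4) + \<tau> * (norm k)\<^sup>2"
      using mult_left_mono[of "(1 + s) powr \<gamma>" "1 + \<gamma> * s - (q - \<tau>') * s\<^sup>2" P] P
      by (simp add: algebra_simps)
    also have "P * (1 + \<gamma> * s) - P * (4 * q * b\<^sup>2 / \<rho> ^ 4) = norm g powr \<delta> +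
     \<delta> * norm g powr (\<delta> - 2) * inner g k +
     \<delta> * norm g powr (\<delta> - 2) * ((norm k)\<^sup>2 - (2 - \<delta>) * (inner (g /\<^sub>R norm g) k)\<^sup>2) / 2"
    proof -
      have e1: "norm g powr (\<delta> - 2) = P / \<rho>\<^sup>2" using \<rho> by (simp add: P_def powr_diff \<rho>_def)
      have e2: "inner (g /\<^sub>R norm g) k = b / \<rho>" by (simp add: b_def \<rho>_def divide_inverse mult.commute)
      have e3: "norm g powr \<delta> = P" by (simp add: P_def \<rho>_def)
      show ?thesis
        unfolding e1 e2 e3 b_def[symmetric] using \<rho>
        by (simp add: s_def q_def \<gamma>_def field_simps power2_eq_square power4_eq_xxxx)
    qed
    finally show "norm (g + k) powr \<delta> \<le> norm g powr \<delta> +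
     \<delta> * norm g powr (\<delta> - 2) * inner g k +
     \<delta> * norm g powr (\<delta> - 2) * ((norm k)\<^sup>2 - (2 - \<delta>) * (inner (g /\<^sub>R norm g) k)\<^sup>2) / 2 + \<tau> * (norm k)\<^sup>2"
      by simp
  qed
qed

lemma symmetric_form_compose:
  assumes "symmetric_form B" "linear f"
  shows "symmetric_form (\<lambda>x y. B (f x) (f y))"
  using linear_compose[OF assms(2) symmetric_form_linear[OF assms(1)]] symmetric_form_commute[OF assms(1)]
  by (intro symmetric_formI) (auto simp: o_def)

text \<open>At a local maximum the growth of \<open>U x + V z\<close> is at most the growth of the
  penalty, so an upper jet of the penalty is one of the sum. Away from the diagonal the penalty is
  smooth, and \<open>\<tau>\<close> pays for its Taylor remainder.\<close>

lemma doubling_jet: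
  fixes U V :: "'a::real_inner \<Rightarrow> real"
  assumes g: "x \<noteq> z" and \<delta>: "0 < \<delta>" "\<delta> < 1" and L: "L > 0" and M: "M \<ge> 0" and \<tau>: "\<tau> > 0"
    and s: "s > 0" and max: "\<And>x' z'. x' \<in> T \<Longrightarrow> z' \<in> T \<Longrightarrow> dist x x' < s \<Longrightarrow> dist z z' < s \<Longrightarrow>
      U x' + V z' - L * dist x' z' powr \<delta> - M * (dist x0 x')\<^sup>2 - M * (dist x0 z')\<^sup>2
      \<le> U x + V z - L * dist x z powr \<delta> - M * (dist x0 x)\<^sup>2 - M * (dist x0 z)\<^sup>2"
    and T: "subspace T" "x \<in> T" "z \<in> T"
  obtains p A a where "symmetric_form A" "upper_jet (T \<times> T) (\<lambda>(x, z). U x + V z) (x, z) p A"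
    "\<And>v. v \<in> T \<times> T \<Longrightarrow> \<bar>A v v\<bar> \<le> a * (norm v)\<^sup>2"
    "\<And>\<xi> \<eta>. A (\<xi>, \<eta>) (\<xi>, \<eta>) = (L * \<delta> * dist x z powr (\<delta> - 2)) *
        ((norm (\<xi> - \<eta>))\<^sup>2 - (2 - \<delta>) * (inner ((x - z) /\<^sub>R dist x z) (\<xi> - \<eta>))\<^sup>2)
        + (2 * M + \<tau>) * ((norm \<xi>)\<^sup>2 + (norm \<eta>)\<^sup>2)"
proof -
  define \<kappa> where "\<kappa> = L * \<delta> * dist x z powr (\<delta> - 2)"
  define e where "e = (x - z) /\<^sub>R dist x z"
  define d where "d = (\<lambda>v::'a \<times> 'a. fst v - snd v)"
  define A where "A = (\<lambda>v w. \<kappa> * inner (d v) (d w) + (- \<kappa> * (2 - \<delta>)) * (inner e (d v) * inner e (d w))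
      + (2 * M + \<tau>) * inner v w)"
  define p where "p = ((L * \<delta> * dist x z powr (\<delta> - 2)) *\<^sub>R (x - z) + (2 * M) *\<^sub>R (x - x0),
      - ((L * \<delta> * dist x z powr (\<delta> - 2)) *\<^sub>R (x - z)) + (2 * M) *\<^sub>R (z - x0))"
  have \<kappa>: "\<kappa> \<ge> 0" using L \<delta> by (simp add: \<kappa>_def)
  have norm_e: "norm e = 1" using g by (simp add: e_def dist_norm)
  have d: "linear d" unfolding d_def by (intro linearI) (auto simp: algebra_simps)
  have A_eq: "A (\<xi>, \<eta>) (\<xi>, \<eta>) = \<kappa> * ((norm (\<xi> - \<eta>))\<^sup>2 - (2 - \<delta>) * (inner e (\<xi> - \<eta>))\<^sup>2)
        + (2 * M + \<tau>) * ((norm \<xi>)\<^sup>2 + (norm \<eta>)\<^sup>2)" for \<xi> \<eta>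
    unfolding A_def d_def power2_norm_eq_inner by (simp add: power2_eq_square algebra_simps)
  have d_le: "(norm (\<xi> - \<eta>))\<^sup>2 \<le> 2 * ((norm \<xi>)\<^sup>2 + (norm \<eta>)\<^sup>2)" for \<xi> \<eta> :: 'a
    using zero_le_power2[of "norm (\<xi> + \<eta>)"] unfolding power2_norm_eq_inner
    by (simp add: inner_simps inner_commute)
  have "symmetric_form A" unfolding A_def
    by (intro symmetric_form_add symmetric_form_scale symmetric_form_inner d
        symmetric_form_compose[OF symmetric_form_inner d] symmetric_form_compose[OF symmetric_form_inner_prod d])
  moreover have "upper_jet (T \<times> T) (\<lambda>(x, z). U x + V z) (x, z) p A"
  proof -
    \<comment> \<open>The factor \<open>L\<close> and the bound \<open>(norm (\<xi> -
      \<eta>))\<^sup>2 \<le> 2 * ((norm \<xi>)\<^sup>2 + (norm \<eta>)\<^sup>2)\<close> turn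
      \<open>\<tau> / (4 * L)\<close> into the share \<open>\<tau> / 2\<close>.\<close>
    have "x - z \<noteq> 0" "\<delta> < 2" "\<tau> / (4 * L) > 0" using g \<delta> \<tau> L by auto
    from norm_powr_jet[OF this(1) \<delta>(1) this(2,3)] obtain t where t: "t > 0"
      "\<And>k. norm k < t \<Longrightarrow> norm (x - z + k) powr \<delta> \<le> norm (x - z) powr \<delta> +
       \<delta> * norm (x - z) powr (\<delta> - 2) * inner (x - z) k +
       \<delta> * norm (x - z) powr (\<delta> - 2) * ((norm k)\<^sup>2 - (2 - \<delta>) * (inner ((x - z) /\<^sub>R norm (x - z)) k)\<^sup>2) / 2
       + \<tau> / (4 * L) * (norm k)\<^sup>2" by blast
    show ?thesis
      unfolding upper_jet_def
    proof (intro exI[of _ "min s (t / 2)"] conjI ballI impI)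
      show "min s (t / 2) > 0" using s t by simp
      fix h assume h: "h \<in> T \<times> T" "norm h < min s (t / 2)"
      obtain \<xi> \<eta> where h_eq: "h = (\<xi>, \<eta>)" "\<xi> \<in> T" "\<eta> \<in> T" using h(1) by auto
      have n: "norm \<xi> < min s (t / 2)" "norm \<eta> < min s (t / 2)"
        using h(2) norm_fst_le[of \<xi> \<eta>] norm_snd_le[of \<eta> \<xi>] unfolding h_eq by linarith+
      define k where "k = \<xi> - \<eta>"
      have k: "norm k < t" using n norm_triangle_ineq4[of \<xi> \<eta>] by (simp add: k_def)
      have sq: "(dist x0 (y + \<zeta>))\<^sup>2 = (dist x0 y)\<^sup>2 + 2 * inner (y - x0) \<zeta> + (norm \<zeta>)\<^sup>2" for y \<zeta> :: 'a
        unfolding dist_norm power2_norm_eq_inner by (simp add: inner_simps inner_commute)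
      have "L * dist (x + \<xi>) (z + \<eta>) powr \<delta> \<le> L * (norm (x - z) powr \<delta> +
       \<delta> * norm (x - z) powr (\<delta> - 2) * inner (x - z) k +
       \<delta> * norm (x - z) powr (\<delta> - 2) * ((norm k)\<^sup>2 - (2 - \<delta>) * (inner ((x - z) /\<^sub>R norm (x - z)) k)\<^sup>2) / 2
       + \<tau> / (4 * L) * (norm k)\<^sup>2)"
      proof -
        have "dist (x + \<xi>) (z + \<eta>) = norm (x - z + k)" by (simp add: dist_norm k_def algebra_simps)
        then show ?thesis using t(2)[OF k] L by simp
      qed
      also have "\<dots> = L * dist x z powr \<delta> + (L * \<delta> * dist x z powr (\<delta> - 2)) * inner (x - z) k +
          \<kappa> * ((norm k)\<^sup>2 - (2 - \<delta>) * (inner e k)\<^sup>2) / 2 + \<tau> / 4 * (norm k)\<^sup>2"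
        using L by (simp add: \<kappa>_def e_def dist_norm distrib_left)
      also have "\<tau> / 4 * (norm k)\<^sup>2 \<le> (\<tau> * (norm \<xi>)\<^sup>2 + \<tau> * (norm \<eta>)\<^sup>2) / 2"
        using mult_left_mono[OF d_le[of \<xi> \<eta>], of "\<tau> / 4"] \<tau> by (simp add: k_def distrib_left)
      finally have "L * dist (x + \<xi>) (z + \<eta>) powr \<delta> \<le> L * dist x z powr \<delta> + (L * \<delta> * dist x z powr (\<delta> - 2)) * inner (x - z) k +
          \<kappa> * ((norm k)\<^sup>2 - (2 - \<delta>) * (inner e k)\<^sup>2) / 2 + (\<tau> * (norm \<xi>)\<^sup>2 + \<tau> * (norm \<eta>)\<^sup>2) / 2" by simp
      moreover have "U (x + \<xi>) + V (z + \<eta>) - L * dist (x + \<xi>) (z + \<eta>) powr \<delta> - M * (dist x0 (x + \<xi>))\<^sup>2 - M * (dist x0 (z + \<eta>))\<^sup>2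
      \<le> U x + V z - L * dist x z powr \<delta> - M * (dist x0 x)\<^sup>2 - M * (dist x0 z)\<^sup>2"
        using n T h_eq by (intro max subspace_add) (auto simp: dist_norm)
      moreover have "M * (dist x0 (y + \<zeta>))\<^sup>2 = M * (dist x0 y)\<^sup>2 + 2 * M * inner (y - x0) \<zeta> + M * (norm \<zeta>)\<^sup>2" for y \<zeta>
        unfolding sq by (simp add: algebra_simps)
      moreover have "inner p h = (L * \<delta> * dist x z powr (\<delta> - 2)) * inner (x - z) k
          + 2 * M * inner (x - x0) \<xi> + 2 * M * inner (z - x0) \<eta>"
        by (simp add: p_def h_eq k_def inner_simps algebra_simps)
      ultimately have "U (x + \<xi>) + V (z + \<eta>) \<le> U x + V z + inner p h +
          (\<kappa> * ((norm k)\<^sup>2 - (2 - \<delta>) * (inner e k)\<^sup>2) / 2 + (\<tau> * (norm \<xi>)\<^sup>2 + \<tau> * (norm \<eta>)\<^sup>2) / 2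
           + M * (norm \<xi>)\<^sup>2 + M * (norm \<eta>)\<^sup>2)" by simp
      also have "(\<kappa> * ((norm k)\<^sup>2 - (2 - \<delta>) * (inner e k)\<^sup>2) / 2 + (\<tau> * (norm \<xi>)\<^sup>2 + \<tau> * (norm \<eta>)\<^sup>2) / 2
           + M * (norm \<xi>)\<^sup>2 + M * (norm \<eta>)\<^sup>2) = A h h / 2"
        unfolding h_eq(1) A_eq k_def by (simp add: field_simps)
      finally show "(\<lambda>(x, z). U x + V z) ((x, z) + h) \<le> (\<lambda>(x, z). U x + V z) (x, z) + inner p h + A h h / 2"
        by (simp add: h_eq(1))
    qed
  qed
  moreover have "\<bar>A v v\<bar> \<le> (6 * \<kappa> + (2 * M + \<tau>)) * (norm v)\<^sup>2" for v
  proof -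
    obtain \<xi> \<eta> where v: "v = (\<xi>, \<eta>)" by (cases v)
    define k where "k = \<xi> - \<eta>"
    have nv: "(norm v)\<^sup>2 = (norm \<xi>)\<^sup>2 + (norm \<eta>)\<^sup>2" by (simp add: v norm_Pair)
    have k: "(norm k)\<^sup>2 \<le> 2 * (norm v)\<^sup>2" unfolding nv k_def by (rule d_le)
    have "\<bar>inner e k\<bar> \<le> norm k" using Cauchy_Schwarz_ineq2[of e k] norm_e by simp
    then have "\<bar>inner e k\<bar>\<^sup>2 \<le> (norm k)\<^sup>2" by (intro power_mono) auto
    then have ek: "(inner e k)\<^sup>2 \<le> (norm k)\<^sup>2" by simp
    have "(2 - \<delta>) * (inner e k)\<^sup>2 \<le> 2 * (2 * (norm v)\<^sup>2)" using ek k \<delta> by (intro mult_mono) auto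
    moreover have "0 \<le> (2 - \<delta>) * (inner e k)\<^sup>2" using \<delta> by simp
    ultimately have "\<bar>(norm k)\<^sup>2 - (2 - \<delta>) * (inner e k)\<^sup>2\<bar> \<le> 6 * (norm v)\<^sup>2"
      using k zero_le_power2[of "norm k"] zero_le_power2[of "norm v"] unfolding abs_le_iff by linarith
    then have "\<kappa> * \<bar>(norm k)\<^sup>2 - (2 - \<delta>) * (inner e k)\<^sup>2\<bar> \<le> \<kappa> * (6 * (norm v)\<^sup>2)" using \<kappa> by (rule mult_left_mono)
    then have "\<bar>\<kappa> * ((norm k)\<^sup>2 - (2 - \<delta>) * (inner e k)\<^sup>2)\<bar> \<le> \<kappa> * (6 * (norm v)\<^sup>2)" using \<kappa> by (simp add: abs_mult)
    moreover have "\<bar>(2 * M + \<tau>) * (norm v)\<^sup>2\<bar> = (2 * M + \<tau>) * (norm v)\<^sup>2" using M \<tau> by simp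
    ultimately show ?thesis
      using abs_triangle_ineq[of "\<kappa> * ((norm k)\<^sup>2 - (2 - \<delta>) * (inner e k)\<^sup>2)" "(2 * M + \<tau>) * (norm v)\<^sup>2"]
      unfolding v A_eq k_def[symmetric] nv[unfolded v, symmetric] by (simp add: algebra_simps)
  qed
  ultimately show thesis using A_eq unfolding \<kappa>_def e_def by (rule that)
qed

text \<open>The equation enters only through the signs of \<open>wes\<close> on jets, in
  \<open>sub\<close> and \<open>super\<close>. The estimate is one-sided because exchanging the
  points gives the other side.\<close>

lemma holder_estimate_Rn:
  fixes u :: "fsv \<Rightarrow> real"
  assumes n: "n \<ge> 1" and \<alpha>: "\<And>i. i \<in> {1..n} \<Longrightarrow> \<alpha> i \<ge> 0" "(\<Sum>i=1..n. \<alpha> i) = 1" "min (\<alpha> 1) (\<alpha> n) > 0"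
    and \<delta>: "0 < \<delta>" "\<delta> < 1 / 2" and r: "r > 0" and A: "A > 0" and c: "c \<in> Rn n"
    and cont: "continuous_on (Rn n \<inter> ball c (2 * r)) u"
    and bound: "\<And>x. x \<in> Rn n \<inter> ball c (2 * r) \<Longrightarrow> \<bar>u x\<bar> \<le> A"
    and sub: "\<And>x p X. x \<in> Rn n \<inter> ball c (2 * r) \<Longrightarrow> symmetric_form X \<Longrightarrow> upper_jet (Rn n) u x p X \<Longrightarrow>
      0 \<le> wes n \<alpha> X"
    and super: "\<And>x p X. x \<in> Rn n \<inter> ball c (2 * r) \<Longrightarrow> symmetric_form X \<Longrightarrow>
      upper_jet (Rn n) (\<lambda>x. - u x) x p X \<Longrightarrow> wes n \<alpha> (\<lambda>x y. - X x y) \<le> 0"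
    and x0: "x0 \<in> Rn n \<inter> ball c r" and z0: "z0 \<in> Rn n \<inter> ball c r"
  shows "u x0 - u z0 \<le> (40 / (\<delta> * (1 - 2 * \<delta>) * min (\<alpha> 1) (\<alpha> n)) + 9) * A * (dist x0 z0 / r) powr \<delta>"
proof (rule ccontr)
  define \<mu> where "\<mu> = min (\<alpha> 1) (\<alpha> n)"
  \<comment> \<open>The final inequality opposes \<open>40 * A / r\<^sup>2\<close>, produced by this
    constant, to the error \<open>2 * m = 38 * A / r\<^sup>2\<close>, produced by \<open>M\<close>
    and \<open>\<tau>\<close>.\<close>
  define C where "C = 40 / (\<delta> * (1 - 2 * \<delta>) * \<mu>)"
  define L where "L = C * A * r powr (- \<delta>)"
  \<comment> \<open>A positive value of the doubled function forces
    \<open>M * (dist x0 y)\<^sup>2 < 2 * A\<close> for both arguments; with 9 this gives squared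
    distance below \<open>2 * r\<^sup>2 / 9\<close>, less than \<open>(r / 2)\<^sup>2\<close>, so
    the maximum is interior to \<open>G \<times> G\<close>.\<close>
  define M where "M = 9 * A / r\<^sup>2"
  define d where "d = dist x0 z0"
  assume "\<not> ?thesis"
  then have contr: "(C + 9) * A * (d / r) powr \<delta> < u x0 - u z0" by (simp add: C_def \<mu>_def d_def)
  have \<mu>: "\<mu> > 0" using \<alpha>(3) by (simp add: \<mu>_def)
  have C: "C > 0" using \<delta> \<mu> by (simp add: C_def)
  have L: "L > 0" and M: "M > 0" using C A r by (auto simp: L_def M_def)
  have x0': "x0 \<in> Rn n" "dist c x0 < r" and z0': "z0 \<in> Rn n" "dist c z0 < r" using x0 z0 by auto
  \<comment> \<open>For distant points the trivial bound \<open>2 * A\<close> suffices: then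
    \<open>(d / r) powr \<delta> \<ge> 1 / 2\<close>, and \<open>9 / 2\<close> exceeds 2.\<close>
  have d_lt: "d < r / 2"
  proof (rule ccontr)
    assume "\<not> ?thesis"
    then have "1 / 2 \<le> d / r" using r by (simp add: field_simps)
    have "1 / 2 = (1 / 2 :: real) powr 1" by simp
    also have "\<dots> \<le> (1 / 2) powr \<delta>" using \<delta> by (intro powr_mono') auto
    also have "\<dots> \<le> (d / r) powr \<delta>" using \<open>1 / 2 \<le> d / r\<close> \<delta> by (intro powr_mono2) auto
    finally have "(9 * A) * (1 / 2) \<le> ((C + 9) * A) * (d / r) powr \<delta>"
      using C A by (intro mult_mono) auto
    moreover have "\<bar>u x0\<bar> \<le> A" "\<bar>u z0\<bar> \<le> A" using x0 z0 r by (auto intro!: bound)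
    ultimately show False using contr A by linarith
  qed
  have d0: "d \<ge> 0" by (simp add: d_def)
  \<comment> \<open>A lower bound for the doubled function at \<open>(x0, z0)\<close>. The summand 9
    in the constant pays for the localising term, since
    \<open>(d / r)\<^sup>2 \<le> (d / r) powr \<delta>\<close> for \<open>d \<le> r\<close>.\<close>
  define \<omega>0 where "\<omega>0 = u x0 - u z0 - L * d powr \<delta> - M * d\<^sup>2"
  have \<omega>0: "\<omega>0 > 0"
  proof -
    have "(d / r)\<^sup>2 \<le> (d / r) powr \<delta>"
    proof (cases "d = 0")
      case False
      then have dr: "d / r > 0" "d / r \<le> 1" using d0 r d_lt by auto
      then have "(d / r)\<^sup>2 = (d / r) powr 2" by simp
      also have "\<dots> \<le> (d / r) powr \<delta>" using dr \<delta> by (intro powr_mono') auto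
      finally show ?thesis .
    qed simp
    then have "9 * A * (d / r)\<^sup>2 \<le> 9 * A * (d / r) powr \<delta>" using A by simp
    moreover have "M * d\<^sup>2 = 9 * A * (d / r)\<^sup>2" by (simp add: M_def power_divide)
    moreover have "L * d powr \<delta> = C * A * (d / r) powr \<delta>"
      using r d0 by (simp add: L_def powr_divide powr_minus_divide)
    ultimately show ?thesis using contr by (simp add: \<omega>0_def algebra_simps)
  qed
  \<comment> \<open>Room for three displacements: the maximum point is within
    \<open>3 * r / 2\<close> of \<open>c\<close>, \<open>jets_of_sum\<close> moves it by less than
    \<open>r / 8\<close>, and the passage to the maximiser of the sup-convolution by less than
    \<open>b \<le> r / 8\<close>. Altogether this is below \<open>7 * r / 4\<close>.\<close>
  define D where "D = Rn n \<inter> cball c (7 * r / 4)"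
  have D: "compact D" by (simp add: D_def compact_Rn_cball)
  have D_sub: "D \<subseteq> Rn n \<inter> ball c (2 * r)" using r by (auto simp: D_def)
  have contD: "continuous_on D u" by (rule continuous_on_subset[OF cont D_sub])
  have boundD: "\<bar>u x\<bar> \<le> A" if "x \<in> D" for x using bound that D_sub by blast
  have "c \<in> D" using c r by (simp add: D_def)
  then have D_ne: "D \<noteq> {}" by blast
  obtain \<omega> where \<omega>: "\<omega> > 0" "\<And>x y. x \<in> D \<Longrightarrow> y \<in> D \<Longrightarrow> dist y x < \<omega> \<Longrightarrow> dist (u y) (u x) < \<omega>0"
    using compact_uniformly_continuous[OF contD D] \<omega>0 unfolding uniformly_continuous_on_def by meson
  \<comment> \<open>The bound \<open>\<omega> / 2\<close> keeps two maximisers belonging to the same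
    point closer than \<open>\<omega>\<close>. With \<open>\<epsilon> = b\<^sup>2 / (8 * A)\<close>,
    an oscillation of at most \<open>2 * A\<close> allows squared displacements of at most
    \<open>b\<^sup>2 / 2\<close>.\<close>
  define b where "b = min (r / 8) (\<omega> / 2)"
  define \<epsilon> where "\<epsilon> = b\<^sup>2 / (8 * A)"
  have b: "b > 0" "b \<le> r / 8" "b \<le> \<omega> / 2" using r \<omega> by (auto simp: b_def)
  have \<epsilon>: "\<epsilon> > 0" using b A by (simp add: \<epsilon>_def)
  obtain U where U: "\<And>x. \<exists>y\<in>D. U x = u y - (norm (x - y))\<^sup>2 / (2 * \<epsilon>)"
    "\<And>x y. y \<in> D \<Longrightarrow> u y - (norm (x - y))\<^sup>2 / (2 * \<epsilon>) \<le> U x"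
    "\<And>y. \<exists>l. linear l \<and> (\<forall>k. U (y + k) \<ge> U y + l k - (1 / \<epsilon>) * (norm k)\<^sup>2 / 2)"
    "continuous_on UNIV U"
    by (rule sup_convolution[OF D D_ne contD \<epsilon>]) (rule that; assumption)
  obtain V where V: "\<And>x. \<exists>y\<in>D. V x = - u y - (norm (x - y))\<^sup>2 / (2 * \<epsilon>)"
    "\<And>x y. y \<in> D \<Longrightarrow> - u y - (norm (x - y))\<^sup>2 / (2 * \<epsilon>) \<le> V x"
    "\<And>y. \<exists>l. linear l \<and> (\<forall>k. V (y + k) \<ge> V y + l k - (1 / \<epsilon>) * (norm k)\<^sup>2 / 2)"
    "continuous_on UNIV V"
    by (rule sup_convolution[OF D D_ne continuous_on_minus[OF contD] \<epsilon>]) (rule that; assumption)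
  have close: "norm (x - y) < b"
    if "x \<in> D" "y \<in> D" "W x = w y - (norm (x - y))\<^sup>2 / (2 * \<epsilon>)"
      "\<And>y. y \<in> D \<Longrightarrow> w y - (norm (x - y))\<^sup>2 / (2 * \<epsilon>) \<le> W x" "\<And>y. y \<in> D \<Longrightarrow> \<bar>w y\<bar> \<le> A" for W w x y
  proof -
    have "(norm (x - y))\<^sup>2 / (2 * \<epsilon>) \<le> w y - w x" using that(3) that(4)[OF that(1)] by simp
    also have "\<dots> \<le> 2 * A" using that(5)[OF that(1)] that(5)[OF that(2)] unfolding abs_le_iff by linarith
    finally have "(norm (x - y))\<^sup>2 \<le> 2 * A * (2 * \<epsilon>)" using \<epsilon> by (simp add: pos_divide_le_eq)
    also have "\<dots> = b\<^sup>2 / 2" using A by (simp add: \<epsilon>_def)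
    also have "\<dots> < b\<^sup>2" using b by simp
    finally show ?thesis using b by (meson less_imp_le not_le power_mono norm_ge_zero)
  qed
  have closeU: "norm (x - y) < b" if "x \<in> D" "y \<in> D" "U x = u y - (norm (x - y))\<^sup>2 / (2 * \<epsilon>)" for x y
    by (rule close[where W = U and w = u, OF that U(2) boundD])
  have closeV: "norm (x - y) < b" if "x \<in> D" "y \<in> D" "V x = - u y - (norm (x - y))\<^sup>2 / (2 * \<epsilon>)" for x y
    using boundD by (intro close[where W = V and w = "\<lambda>x. - u x", OF that V(2)]) auto
  have U_le: "U x \<le> A" and V_le: "V x \<le> A" for x
  proof -
    obtain y y' where "y \<in> D" "U x = u y - (norm (x - y))\<^sup>2 / (2 * \<epsilon>)"
      "y' \<in> D" "V x = - u y' - (norm (x - y'))\<^sup>2 / (2 * \<epsilon>)" using U(1) V(1) by meson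
    moreover have "(norm (x - y))\<^sup>2 / (2 * \<epsilon>) \<ge> 0" "(norm (x - y'))\<^sup>2 / (2 * \<epsilon>) \<ge> 0" using \<epsilon> by auto
    ultimately show "U x \<le> A" "V x \<le> A" using boundD[of y] boundD[of y'] unfolding abs_le_iff by linarith+
  qed
  define G where "G = Rn n \<inter> cball x0 (r / 2)"
  have G: "compact G" by (simp add: G_def compact_Rn_cball)
  have GD: "x \<in> D" "dist c x < 3 * r / 2" if "x \<in> G" for x
  proof -
    show 1: "dist c x < 3 * r / 2" using that x0' dist_triangle[of c x x0] by (simp add: G_def)
    then have "dist c x \<le> 7 * r / 4" using r by linarith
    then show "x \<in> D" using that by (simp add: G_def D_def)
  qed
  define \<psi> where "\<psi> = (\<lambda>(x, z). U x + V z - L * dist x z powr \<delta> - M * (dist x0 x)\<^sup>2 - M * (dist x0 z)\<^sup>2)"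
  have "continuous_on (G \<times> G) \<psi>"
    unfolding \<psi>_def split_def using \<delta>
    by (intro continuous_intros continuous_on_powr' continuous_on_compose2[OF U(4)] continuous_on_compose2[OF V(4)]) auto
  moreover have x0G: "x0 \<in> G" and z0G: "z0 \<in> G" using x0' z0' r d_lt by (auto simp: G_def d_def)
  moreover have "compact (G \<times> G)" using G by (simp add: compact_Times)
  ultimately have "\<exists>y\<in>G\<times>G. \<forall>y'\<in>G\<times>G. \<psi> y' \<le> \<psi> y" by (intro continuous_attains_sup) auto
  then obtain x z where xz: "x \<in> G" "z \<in> G" and max: "\<And>x' z'. x' \<in> G \<Longrightarrow> z' \<in> G \<Longrightarrow> \<psi> (x', z') \<le> \<psi> (x, z)"
    by force
  have \<psi>_ge: "\<psi> (x, z) \<ge> \<omega>0"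
  proof -
    have "u x0 \<le> U x0" "- u z0 \<le> V z0" using U(2)[of x0 x0] V(2)[of z0 z0] GD(1) x0G z0G by auto
    then have "\<omega>0 \<le> \<psi> (x0, z0)" by (simp add: \<psi>_def \<omega>0_def d_def)
    then show ?thesis using max[OF x0G z0G] by simp
  qed
  have nonneg: "L * dist x z powr \<delta> \<ge> 0" "M * (dist x0 x)\<^sup>2 \<ge> 0" "M * (dist x0 z)\<^sup>2 \<ge> 0" using L M by auto
  have inner_pt: "dist x0 y < r / 2" if "M * (dist x0 y)\<^sup>2 < 2 * A" for y
  proof -
    have "(dist x0 y)\<^sup>2 < (r / 2)\<^sup>2"
    proof -
      have "9 * (dist x0 y)\<^sup>2 < 2 * r\<^sup>2" using that A r by (simp add: M_def field_simps)
      moreover have "(r / 2)\<^sup>2 = r\<^sup>2 / 4" by (simp add: power_divide)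
      moreover have "r\<^sup>2 > 0" using r by simp
      ultimately show ?thesis by linarith
    qed
    then show ?thesis using r by (meson less_imp_le not_le power_mono half_gt_zero)
  qed
  have inx: "dist x0 x < r / 2" and inz: "dist x0 z < r / 2"
    using \<psi>_ge \<omega>0 nonneg U_le[of x] V_le[of z] unfolding \<psi>_def split_conv
    by (intro inner_pt; linarith)+
  \<comment> \<open>On the diagonal the penalty has no second order expansion. There
    \<open>U x + V x\<close> is at most \<open>u y - u y'\<close> for nearby maximisers, which
    uniform continuity keeps below \<open>\<omega>0\<close>.\<close>
  have "x \<noteq> z"
  proof
    assume "x = z"
    obtain y y' where y: "y \<in> D" "U x = u y - (norm (x - y))\<^sup>2 / (2 * \<epsilon>)"
      "y' \<in> D" "V x = - u y' - (norm (x - y'))\<^sup>2 / (2 * \<epsilon>)" using U(1) V(1) by meson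
    have "norm (x - y) < b" "norm (x - y') < b" using closeU closeV y GD(1)[OF xz(1)] by auto
    then have "dist y y' < \<omega>" using dist_triangle3[of y y' x] b by (simp add: dist_norm)
    then have "u y - u y' < \<omega>0" using \<omega>(2)[OF y(3,1)] by (simp add: dist_real_def)
    moreover have "(norm (x - y))\<^sup>2 / (2 * \<epsilon>) \<ge> 0" "(norm (x - y'))\<^sup>2 / (2 * \<epsilon>) \<ge> 0" using \<epsilon> by auto
    ultimately have "U x + V x < \<omega>0" using y by linarith
    then show False using \<psi>_ge nonneg \<open>x = z\<close> by (simp add: \<psi>_def)
  qed
  define \<tau> where "\<tau> = A / (2 * r\<^sup>2)"
  have \<tau>: "\<tau> > 0" using A r by (simp add: \<tau>_def)
  define s where "s = min (r / 2 - dist x0 x) (r / 2 - dist x0 z)"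
  have s: "s > 0" using inx inz by (simp add: s_def)
  have xzR: "x \<in> Rn n" "z \<in> Rn n" using xz by (auto simp: G_def)
  have max': "U x' + V z' - L * dist x' z' powr \<delta> - M * (dist x0 x')\<^sup>2 - M * (dist x0 z')\<^sup>2
      \<le> U x + V z - L * dist x z powr \<delta> - M * (dist x0 x)\<^sup>2 - M * (dist x0 z)\<^sup>2"
    if "x' \<in> Rn n" "z' \<in> Rn n" "dist x x' < s" "dist z z' < s" for x' z'
  proof -
    have "x' \<in> G" "z' \<in> G"
      using that dist_triangle[of x0 x' x] dist_triangle[of x0 z' z] by (auto simp: G_def s_def)
    then show ?thesis using max[of x' z'] by (simp add: \<psi>_def)
  qed
  have \<delta>1: "\<delta> < 1" using \<delta> by simp
  define \<kappa> where "\<kappa> = L * \<delta> * dist x z powr (\<delta> - 2)"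
  define e where "e = (x - z) /\<^sub>R dist x z"
  obtain p0 B a where B: "symmetric_form B" "upper_jet (Rn n \<times> Rn n) (\<lambda>(x, z). U x + V z) (x, z) p0 B"
    "\<And>v. v \<in> Rn n \<times> Rn n \<Longrightarrow> \<bar>B v v\<bar> \<le> a * (norm v)\<^sup>2"
    "\<And>\<xi> \<eta>. B (\<xi>, \<eta>) (\<xi>, \<eta>) = \<kappa> * ((norm (\<xi> - \<eta>))\<^sup>2 - (2 - \<delta>) * (inner e (\<xi> - \<eta>))\<^sup>2)
        + (2 * M + \<tau>) * ((norm \<xi>)\<^sup>2 + (norm \<eta>)\<^sup>2)"
    by (rule doubling_jet[OF \<open>x \<noteq> z\<close> \<delta>(1) \<delta>1 L less_imp_le[OF M] \<tau> s max' subspace_Rn xzR,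
          folded \<kappa>_def e_def])
       (assumption | (rule that; assumption))+
  interpret frame "Rn n" "axis_fsv ` {..<n}" by (rule frame_Rn[OF n])
  have r8: "r / 8 > 0" using r by simp
  have \<epsilon>': "1 / \<epsilon> \<ge> 0" using \<epsilon> by simp
  have lowU: "\<exists>l. linear l \<and> (\<forall>k\<in>Rn n. U (y + k) \<ge> U y + l k - (1 / \<epsilon>) * (norm k)\<^sup>2 / 2)" for y
    using U(3)[of y] by blast
  have lowV: "\<exists>l. linear l \<and> (\<forall>k\<in>Rn n. V (y + k) \<ge> V y + l k - (1 / \<epsilon>) * (norm k)\<^sup>2 / 2)" for y
    using V(3)[of y] by blast
  obtain x1 z1 p q X Z where 1: "x1 \<in> Rn n" "z1 \<in> Rn n" "dist x x1 < r / 8" "dist z z1 < r / 8"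
    "symmetric_form X" "symmetric_form Z" "upper_jet (Rn n) U x1 p X" "upper_jet (Rn n) V z1 q Z"
    "\<And>\<xi> \<eta>. \<xi> \<in> Rn n \<Longrightarrow> \<eta> \<in> Rn n \<Longrightarrow>
      X \<xi> \<xi> + Z \<eta> \<eta> \<le> B (\<xi>, \<eta>) (\<xi>, \<eta>) + \<tau> * ((norm \<xi>)\<^sup>2 + (norm \<eta>)\<^sup>2)"
    by (rule jets_of_sum[OF continuous_on_subset[OF U(4) subset_UNIV] continuous_on_subset[OF V(4) subset_UNIV]
        \<epsilon>' lowU lowV xzR B(1,2,3) r8 \<tau>]) (assumption | (rule that; assumption))+
  have transfer: "\<exists>y. y \<in> Rn n \<inter> ball c (2 * r) \<and> upper_jet (Rn n) w y p' X'"
    if y1: "y1 \<in> Rn n" "dist c y1 < 3 * r / 2 + r / 8" and jet: "upper_jet (Rn n) W y1 p' X'"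
      and W: "\<And>x. \<exists>y\<in>D. W x = w y - (norm (x - y))\<^sup>2 / (2 * \<epsilon>)"
      "\<And>x y. y \<in> D \<Longrightarrow> w y - (norm (x - y))\<^sup>2 / (2 * \<epsilon>) \<le> W x" "\<And>y. y \<in> D \<Longrightarrow> \<bar>w y\<bar> \<le> A" for W w y1 p' X'
  proof -
    obtain y where y: "y \<in> D" "W y1 = w y - (norm (y1 - y))\<^sup>2 / (2 * \<epsilon>)" using W(1) by blast
    have "y1 \<in> D" using y1 r by (simp add: D_def)
    then have "norm (y1 - y) < b" by (rule close[where W = W and w = w, OF _ y W(2,3)])
    then have dy: "dist c y < 7 * r / 4" using dist_triangle[of c y y1] y1 b by (simp add: dist_norm)
    have "upper_jet (Rn n) w y p' X'"
    proof (rule upper_jet_sup_convolution[where \<rho> = "7 * r / 4 - dist c y", OF jet y(2) W(2)])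
      show "y + h \<in> D" if "h \<in> Rn n" "norm h < 7 * r / 4 - dist c y" for h
        using that y(1) dist_triangle[of c "y + h" y] by (simp add: D_def dist_norm)
    qed (use dy in auto)
    then show ?thesis using y(1) D_sub by blast
  qed
  have "dist c x1 < 3 * r / 2 + r / 8" "dist c z1 < 3 * r / 2 + r / 8"
    using 1(3,4) GD(2)[OF xz(1)] GD(2)[OF xz(2)] dist_triangle[of c x1 x] dist_triangle[of c z1 z] by auto
  then obtain y y' where "y \<in> Rn n \<inter> ball c (2 * r)" "upper_jet (Rn n) u y p X"
    "y' \<in> Rn n \<inter> ball c (2 * r)" "upper_jet (Rn n) (\<lambda>x. - u x) y' q Z"
    using transfer[OF 1(1) _ 1(7), of u] transfer[OF 1(2) _ 1(8), of "\<lambda>x. - u x"] U(1,2) V(1,2) boundD by auto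
  then have signs: "0 \<le> wes n \<alpha> X" "wes n \<alpha> (\<lambda>x y. - Z x y) \<le> 0" using sub super 1(5,6) by blast+
  have \<kappa>: "\<kappa> \<ge> 0" using L \<delta> by (simp add: \<kappa>_def)
  have e: "e \<in> Rn n" "norm e = 1" using xzR \<open>x \<noteq> z\<close> by (auto simp: e_def dist_norm)
  define m where "m = 2 * M + 2 * \<tau>"
  have "wes n \<alpha> X \<le> wes n \<alpha> (\<lambda>x y. - Z x y) + 2 * m - min (\<alpha> 1) (\<alpha> n) * ((1 - 2 * \<delta>) * \<kappa>)"
  proof (rule wes_doubling_gap[OF 1(5) symmetric_form_uminus[OF 1(6)] n \<alpha>(1,2) e \<kappa> \<delta>(2)])
    show "X \<xi> \<xi> - - Z \<eta> \<eta> \<le> \<kappa> * ((norm (\<xi> - \<eta>))\<^sup>2 - (2 - \<delta>) * (inner e (\<xi> - \<eta>))\<^sup>2) + m * ((norm \<xi>)\<^sup>2 + (norm \<eta>)\<^sup>2)"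
      if "\<xi> \<in> Rn n" "\<eta> \<in> Rn n" for \<xi> \<eta>
      using 1(9)[OF that] by (simp add: B(4) m_def algebra_simps)
  qed auto
  then have le: "\<mu> * ((1 - 2 * \<delta>) * \<kappa>) \<le> 2 * m" using signs by (simp add: \<mu>_def)
  \<comment> \<open>Both points are within \<open>r / 2\<close> of \<open>x0\<close>, hence
    \<open>dist x z \<le> r\<close>, and the exponent \<open>\<delta> - 2\<close> is
    negative.\<close>
  have "\<kappa> \<ge> C * A * \<delta> / r\<^sup>2"
  proof -
    have "dist x z \<le> r" using inx inz dist_triangle3[of x z x0] by simp
    moreover have "dist x z > 0" using \<open>x \<noteq> z\<close> by simp
    ultimately have "r powr (\<delta> - 2) \<le> dist x z powr (\<delta> - 2)" using \<delta> by (intro powr_mono2') auto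
    then have "L * \<delta> * r powr (\<delta> - 2) \<le> \<kappa>" unfolding \<kappa>_def using L \<delta> by (intro mult_left_mono) auto
    moreover have "L * \<delta> * r powr (\<delta> - 2) = C * A * \<delta> / r\<^sup>2"
      using r by (simp add: L_def powr_diff powr_minus field_simps)
    ultimately show ?thesis by simp
  qed
  then have "\<mu> * ((1 - 2 * \<delta>) * (C * A * \<delta> / r\<^sup>2)) \<le> \<mu> * ((1 - 2 * \<delta>) * \<kappa>)"
    using \<mu> \<delta> by (intro mult_left_mono) auto
  moreover have "\<mu> * ((1 - 2 * \<delta>) * (C * A * \<delta> / r\<^sup>2)) = 40 * A / r\<^sup>2"
    using \<mu> \<delta> by (simp add: C_def)
  moreover have "2 * m = 38 * A / r\<^sup>2" by (simp add: m_def M_def \<tau>_def add_divide_distrib)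
  moreover have "38 * A / r\<^sup>2 < 40 * A / r\<^sup>2" using A r by (intro divide_strict_right_mono) auto
  ultimately show False using le by linarith
qed

section \<open>Test functions\<close>

text \<open>The quartic term turns touching near \<open>x\<close> into touching on the whole domain.\<close>

definition quartic ::
  "nat \<Rightarrow> real \<Rightarrow> (nat \<Rightarrow> real) \<Rightarrow> (nat \<Rightarrow> nat \<Rightarrow> real) \<Rightarrow> real \<Rightarrow> (nat \<Rightarrow> real) \<Rightarrow> (nat \<Rightarrow> real) \<Rightarrow> real" where
  "quartic n c p a M x y = c + (\<Sum>i<n. p i * (y i - x i))
     + (\<Sum>i<n. \<Sum>j<n. a i j * ((y i - x i) * (y j - x j))) / 2 + M * (\<Sum>i<n. (y i - x i) ^ 4)"

section \<open>Derivatives of the quartic test function\<close>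

lemma DERIV_fun_upd: "((\<lambda>t. (y(k := t)) i) has_real_derivative (if i = k then 1 else 0)) (at s)"
  by (cases "i = k") simp_all

lemma partial_deriv_eqI:
  assumes "((\<lambda>t. f (y(k := t))) has_real_derivative D) (at (y k))"
  shows "partial_differentiable k f y" "partial_deriv k f y = D"
  using assms by (auto simp: partial_differentiable_def partial_deriv_def field_differentiable_def
      intro: DERIV_imp_deriv)

lemma quartic_deriv1:
  assumes k: "k < n" and sym: "\<And>i j. a i j = a j i"
  shows "((\<lambda>t. quartic n c p a M x (y(k := t))) has_real_derivative
    p k + (\<Sum>i<n. a k i * (y i - x i)) + 4 * M * (y k - x k) ^ 3) (at (y k))"
proof -
  let ?d = "\<lambda>i. if i = k then 1 else 0 :: real"
  have "((\<lambda>t. quartic n c p a M x (y(k := t))) has_real_derivative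
      (\<Sum>i<n. p i * ?d i)
     + (\<Sum>i<n. \<Sum>j<n. a i j * (?d i * (y j - x j) + ?d j * (y i - x i))) / 2
     + M * (\<Sum>i<n. 4 * (y i - x i) ^ 3 * ?d i)) (at (y k))"
  proof -
    have c: "((\<lambda>t. (y(k := t)) i - x i) has_real_derivative ?d i) (at (y k))" for i
      by (rule DERIV_cong[OF DERIV_diff[OF DERIV_fun_upd DERIV_const]]) simp
    have c2: "((\<lambda>t. a i j * (((y(k := t)) i - x i) * ((y(k := t)) j - x j))) has_real_derivative
        a i j * (?d i * (y j - x j) + ?d j * (y i - x i))) (at (y k))" for i j
      using DERIV_cmult[OF DERIV_mult[OF c[of i] c[of j]], of "a i j"] by simp
    have c4: "((\<lambda>t. ((y(k := t)) i - x i) ^ 4) has_real_derivative 4 * (y i - x i) ^ 3 * ?d i) (at (y k))" for i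
      using DERIV_power[OF c[of i], of 4] by (simp add: mult_ac)
    show ?thesis
      unfolding quartic_def add.assoc[symmetric]
      by (rule DERIV_cong[OF DERIV_add[OF DERIV_add[OF DERIV_add[OF DERIV_const
            DERIV_sum[OF DERIV_cmult[OF c]]] DERIV_cdivide[OF DERIV_sum[OF DERIV_sum[OF c2]]]]
            DERIV_cmult[OF DERIV_sum[OF c4]]]]) simp
  qed
  moreover have "(\<Sum>i<n. p i * ?d i) = p k"
    using k by (simp add: mult_delta_right)
  moreover have "(\<Sum>i<n. 4 * (y i - x i) ^ 3 * ?d i) = 4 * (y k - x k) ^ 3"
    using k by (simp add: mult_delta_right)
  moreover have "(\<Sum>i<n. \<Sum>j<n. a i j * (?d i * (y j - x j) + ?d j * (y i - x i)))
      = 2 * (\<Sum>i<n. a k i * (y i - x i))"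
  proof -
    have "(\<Sum>i<n. \<Sum>j<n. a i j * (?d i * (y j - x j) + ?d j * (y i - x i)))
      = (\<Sum>i<n. ?d i * (\<Sum>j<n. a i j * (y j - x j))) + (\<Sum>i<n. \<Sum>j<n. ?d j * (a i j * (y i - x i)))"
      by (simp add: distrib_left sum.distrib sum_distrib_left mult_ac)
    also have "\<dots> = (\<Sum>i<n. a k i * (y i - x i)) + (\<Sum>i<n. a i k * (y i - x i))"
      using k by (simp add: mult_delta_left)
    finally show ?thesis by (simp add: sym[of k])
  qed
  ultimately show ?thesis by (simp add: mult_ac)
qed

lemma quartic_deriv2:
  fixes l n :: nat
  assumes l: "l < n"
  shows "((\<lambda>t. p k + (\<Sum>i<n. a k i * ((y(l := t)) i - x i)) + 4 * M * ((y(l := t)) k - x k) ^ 3)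
    has_real_derivative a k l + (if k = l then 12 * (M * (y k - x k)\<^sup>2) else 0)) (at (y l))"
proof -
  let ?d = "\<lambda>i. if i = l then 1 else 0 :: real"
  have "((\<lambda>t. p k + (\<Sum>i<n. a k i * ((y(l := t)) i - x i)) + 4 * M * ((y(l := t)) k - x k) ^ 3)
    has_real_derivative (\<Sum>i<n. a k i * ?d i) + 4 * M * (3 * (y k - x k)\<^sup>2 * ?d k)) (at (y l))"
  proof -
    have c: "((\<lambda>t. (y(l := t)) i - x i) has_real_derivative ?d i) (at (y l))" for i
      by (rule DERIV_cong[OF DERIV_diff[OF DERIV_fun_upd DERIV_const]]) simp
    have c3: "((\<lambda>t. ((y(l := t)) k - x k) ^ 3) has_real_derivative 3 * (y k - x k)\<^sup>2 * ?d k) (at (y l))"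
      using DERIV_power[OF c[of k], of 3] by (simp add: mult_ac)
    show ?thesis
      by (rule DERIV_cong[OF DERIV_add[OF DERIV_add[OF DERIV_const DERIV_sum[OF DERIV_cmult[OF c]]]
            DERIV_cmult[OF c3]]]) simp
  qed
  moreover have "(\<Sum>i<n. a k i * ?d i) = a k l"
    using l by (simp add: mult_delta_right)
  ultimately show ?thesis by (simp cong: if_cong split: if_splits)
qed

lemma continuous_on_fun_coordinate: "continuous_on A (\<lambda>y::nat \<Rightarrow> real. y i)"
  by (rule continuous_on_subset[OF continuous_on_product_coordinates]) simp

lemma Euclidean_space_eq: "Euclidean_space n = top_of_set {x. \<forall>i\<ge>n. x i = 0}"
  by (simp add: Euclidean_space_def euclidean_product_topology)

lemma cont_on_iff: "cont_on n S f \<longleftrightarrow> continuous_on ({x. \<forall>i\<ge>n. x i = 0} \<inter> S) f"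
  by (simp add: cont_on_def Euclidean_space_eq subtopology_subtopology)

lemma partial_deriv_quartic:
  assumes sym: "\<And>i j. a i j = a j i" and k: "k < n"
  shows "partial_deriv k (quartic n c p a M x) =
    (\<lambda>y. p k + (\<Sum>i<n. a k i * (y i - x i)) + 4 * M * (y k - x k) ^ 3)"
  by (rule ext, rule partial_deriv_eqI(2), rule quartic_deriv1[OF k], rule sym)

lemma partial_deriv2_quartic:
  assumes sym: "\<And>i j. a i j = a j i" and k: "k < n" and l: "l < n"
  shows "partial_deriv l (partial_deriv k (quartic n c p a M x)) =
    (\<lambda>y. a k l + (if k = l then 12 * (M * (y k - x k)\<^sup>2) else 0))"
  unfolding partial_deriv_quartic[OF sym k]
  by (rule ext, rule partial_deriv_eqI(2), rule quartic_deriv2[OF l])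

lemma C2_on_quartic:
  assumes sym: "\<And>i j. a i j = a j i"
  shows "C2_on n \<Omega> (quartic n c p a M x)"
proof -
  note cont = continuous_intros continuous_on_fun_coordinate
  have "cont_on n \<Omega> (quartic n c p a M x)"
    unfolding cont_on_iff quartic_def by (intro cont) auto
  moreover have "cont_on n \<Omega> (partial_deriv i (quartic n c p a M x))" if "i < n" for i
    unfolding cont_on_iff partial_deriv_quartic[OF sym that] by (intro cont)
  moreover have "cont_on n \<Omega> (partial_deriv i (partial_deriv j (quartic n c p a M x)))" if "i < n" "j < n" for i j
    unfolding cont_on_iff partial_deriv2_quartic[OF sym that(2,1)] by (cases "j = i") (auto intro!: cont)
  moreover have "partial_differentiable i (quartic n c p a M x) y" if "i < n" for i y
    by (rule partial_deriv_eqI(1), rule quartic_deriv1[OF that], rule sym)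
  moreover have "partial_differentiable i (partial_deriv j (quartic n c p a M x)) y" if "i < n" "j < n" for i j y
    unfolding partial_deriv_quartic[OF sym that(2)] by (rule partial_deriv_eqI(1)[OF quartic_deriv2[OF that(1)]])
  ultimately show ?thesis by (simp add: C2_on_def)
qed

lemma hessian_quartic:
  assumes sym: "\<And>i j. a i j = a j i"
  shows "hessian n (quartic n c p a M x) x = mat n n (\<lambda>(i, j). a i j)"
  by (rule eq_matI) (auto simp: hessian_def partial_deriv2_quartic[OF sym] sym)

lemma quartic_eq:
  assumes x: "x \<in> Rn n" and y: "y \<in> Rn n" and X: "symmetric_form X"
  shows "quartic n c (coord p) (\<lambda>i j. X (axis_fsv i) (axis_fsv j)) M (coord x) (coord y)
    = c + inner p (y - x) + X (y - x) (y - x) / 2 + M * (\<Sum>i<n. (coord (y - x) i) ^ 4)"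
proof -
  have h: "y - x \<in> Rn n" using x y by (simp add: Rn_def)
  define h where "h = y - x"
  have hR: "h \<in> Rn n" using h by (simp add: h_def)
  have Xh: "X z h = (\<Sum>j<n. coord h j * X z (axis_fsv j))" for z
    using symmetric_form_linear[OF X, of z] arg_cong[OF Rn_expand[OF hR], of "X z"]
    by (simp add: linear_sum linear_scale)
  have "X h h = (\<Sum>i<n. \<Sum>j<n. X (axis_fsv i) (axis_fsv j) * (coord h i * coord h j))"
    by (subst Xh, intro sum.cong refl)
       (simp add: symmetric_form_commute[OF X, of h] Xh sum_distrib_left mult_ac)
  moreover have "inner p h = (\<Sum>i<n. coord p i * coord h i)"
    by (subst inner_commute, subst inner_Rn[OF hR]) (simp add: mult.commute)
  ultimately show ?thesis by (simp add: quartic_def h_def[symmetric] flip: minus_fsv.rep_eq)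
     (simp add: h_def)
qed

text \<open>Near \<open>x\<close> the term with \<open>\<tau>\<close> makes the inequality strict.
  Beyond distance \<open>s\<close> the quartic term outgrows the constant, linear and quadratic
  parts once \<open>M\<close> is large, because \<open>w\<close> is bounded above on
  \<open>O'\<close>. At \<open>x\<close> itself the quartic term has no second derivative.\<close>

lemma strict_touching:
  assumes n: "n \<ge> 1" and x: "x \<in> Rn n" and X: "symmetric_form X" and jet: "upper_jet (Rn n) w x p X"
    and bd: "\<And>y. y \<in> O' \<Longrightarrow> w y \<le> b" and O': "O' \<subseteq> Rn n" and \<tau>: "\<tau> > 0"
  obtains M where "\<And>y. y \<in> O' \<Longrightarrow> y \<noteq> x \<Longrightarrow>
    w y < quartic n (w x) (coord p) (\<lambda>i j. X (axis_fsv i) (axis_fsv j) + \<tau> * inner (axis_fsv i) (axis_fsv j)) M (coord x) (coord y)"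
proof -
  define X' where "X' = (\<lambda>y z. X y z + \<tau> * inner y z)"
  have X': "symmetric_form X'" unfolding X'_def by (intro symmetric_form_add X symmetric_form_scale symmetric_form_inner)
  obtain s where s: "s > 0" "\<And>h. h \<in> Rn n \<Longrightarrow> norm h < s \<Longrightarrow> w (x + h) \<le> w x + inner p h + X h h / 2"
    using jet by (auto simp: upper_jet_def)
  define m where "m = ordered_eigenvalue 1 (form_mat n X')"
  \<comment> \<open>By Cauchy-Schwarz the fourth power of the norm is at most
    \<open>real n * Q\<close>. The three summands dominate the bound for \<open>w\<close> (the 1
    giving strictness), the gradient term and the quadratic term at distance at least
    \<open>s\<close>.\<close>
  define M where "M = real n * ((\<bar>b - w x\<bar> + 1) / s ^ 4 + norm p / s ^ 3 + \<bar>m\<bar> / s\<^sup>2)"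
  have M: "M \<ge> 0" using s by (simp add: M_def)
  show thesis
  proof (rule that)
    fix y assume y: "y \<in> O'" "y \<noteq> x"
    define h where "h = y - x"
    have yR: "y \<in> Rn n" using y O' by auto
    have h: "h \<in> Rn n" "h \<noteq> 0" "y = x + h" using x yR y by (auto simp: h_def Rn_def)
    define Q where "Q = (\<Sum>i<n. (coord h i) ^ 4)"
    have Q: "Q \<ge> 0" by (simp add: Q_def sum_nonneg)
    have "w y < w x + inner p h + X' h h / 2 + M * Q"
    proof (cases "norm h < s")
      case True
      have "w y \<le> w x + inner p h + X h h / 2" using s(2)[OF h(1) True] h(3) by simp
      moreover have "X' h h = X h h + \<tau> * (norm h)\<^sup>2" by (simp add: X'_def power2_norm_eq_inner)
      moreover have "\<tau> * (norm h)\<^sup>2 > 0" using h \<tau> by simp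
      moreover have "M * Q \<ge> 0" using M Q by simp
      ultimately show ?thesis by linarith
    next
      case False
      then have hs: "norm h \<ge> s" by simp
      define t where "t = norm h"
      have t: "t \<ge> s" "t > 0" using hs s by (auto simp: t_def)
      have "t ^ 4 \<le> Q * real n"
      proof -
        have "t\<^sup>2 = (\<Sum>i<n. (coord h i)\<^sup>2)"
          unfolding t_def power2_norm_eq_inner using inner_Rn[OF h(1)] by (simp add: power2_eq_square)
        moreover have "(\<Sum>i<n. (coord h i)\<^sup>2)\<^sup>2 \<le> (\<Sum>i<n. ((coord h i)\<^sup>2)\<^sup>2) * real (card {..<n})"
          by (rule sum_squared_le_sum_of_squares)
        moreover have "z ^ 4 = (z\<^sup>2)\<^sup>2" for z :: real by simp
        ultimately show ?thesis by (simp only: Q_def card_lessThan)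
      qed
      have R: "(\<bar>b - w x\<bar> + 1) + norm p * t + \<bar>m\<bar> * t\<^sup>2 \<le>
          ((\<bar>b - w x\<bar> + 1) / s ^ 4 + norm p / s ^ 3 + \<bar>m\<bar> / s\<^sup>2) * t ^ 4"
      proof -
        have "1 \<le> t / s" using t s by simp
        then have *: "1 \<le> (t / s) ^ k" for k by (rule one_le_power)
        have "(\<bar>b - w x\<bar> + 1) * 1 + norm p * t * 1 + \<bar>m\<bar> * t\<^sup>2 * 1 \<le> (\<bar>b - w x\<bar> + 1) * (t / s) ^ 4
            + norm p * t * (t / s) ^ 3 + \<bar>m\<bar> * t\<^sup>2 * (t / s) ^ 2"
          using t by (intro add_mono mult_left_mono * ) auto
        also have "\<dots> = ((\<bar>b - w x\<bar> + 1) / s ^ 4 + norm p / s ^ 3 + \<bar>m\<bar> / s\<^sup>2) * t ^ 4"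
          using s by (simp add: field_simps power4_eq_xxxx power3_eq_cube power2_eq_square)
        finally show ?thesis by simp
      qed
      also have "\<dots> \<le> ((\<bar>b - w x\<bar> + 1) / s ^ 4 + norm p / s ^ 3 + \<bar>m\<bar> / s\<^sup>2) * (Q * real n)"
        using s \<open>t ^ 4 \<le> Q * real n\<close> by (intro mult_left_mono) auto
      also have "\<dots> = M * Q" by (simp add: M_def)
      finally have "(\<bar>b - w x\<bar> + 1) + norm p * t + \<bar>m\<bar> * t\<^sup>2 \<le> M * Q" .
      moreover have "w y \<le> b" using bd y by simp
      moreover have "- inner p h \<le> norm p * t"
        using Cauchy_Schwarz_ineq2[of p h] unfolding t_def abs_le_iff by simp
      moreover have "X' h h \<ge> - \<bar>m\<bar> * t\<^sup>2"
      proof -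
        have "- \<bar>m\<bar> * t\<^sup>2 \<le> m * t\<^sup>2" by (intro mult_right_mono) auto
        also have "\<dots> \<le> X' h h" using eigenvalue_first_le[OF X' n h(1)] by (simp add: m_def t_def)
        finally show ?thesis .
      qed
      moreover have "0 \<le> \<bar>m\<bar> * t\<^sup>2" by simp
      ultimately show ?thesis by linarith
    qed
    then show "w y < quartic n (w x) (coord p) (\<lambda>i j. X (axis_fsv i) (axis_fsv j) + \<tau> * inner (axis_fsv i) (axis_fsv j)) M (coord x) (coord y)"
      using quartic_eq[OF x yR X', of "w x" p M] by (simp add: X'_def h_def Q_def)
  qed
qed

section \<open>Transfer to the sequence space\<close>

lemma coord_Abs_fsv:
  assumes "y \<in> topspace (Euclidean_space n)"
  shows "coord (Abs_fsv y) = y" "Abs_fsv y \<in> Rn n"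
proof -
  have "\<forall>i. y i \<noteq> 0 \<longrightarrow> i < n" using assms by (auto simp: topspace_Euclidean_space not_less[symmetric])
  then have "{i. y i \<noteq> 0} \<subseteq> {..<n}" by blast
  then have "finite {i. y i \<noteq> 0}" by (rule finite_subset) simp
  then show "coord (Abs_fsv y) = y" by (simp add: Abs_fsv_inverse)
  then show "Abs_fsv y \<in> Rn n" using assms by (simp add: Rn_def topspace_Euclidean_space)
qed

lemma coord_in_topspace: "coord x \<in> topspace (Euclidean_space n) \<longleftrightarrow> x \<in> Rn n"
  by (simp add: Rn_def topspace_Euclidean_space)

lemma euclid_dist_coord:
  assumes "x \<in> Rn n" "y \<in> Rn n"
  shows "euclid_dist n (coord x) (coord y) = dist x y"
proof -
  have "x - y \<in> Rn n" using assms by (simp add: Rn_def)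
  from inner_Rn[OF this, of "x - y"] show ?thesis
    by (simp add: euclid_dist_def L2_set_def dist_norm norm_eq_sqrt_inner power2_eq_square)
qed

lemma coord_in_euclid_ball:
  assumes "c \<in> Rn n"
  shows "coord x \<in> euclid_ball n (coord c) r \<longleftrightarrow> x \<in> Rn n \<inter> ball c r"
  using euclid_dist_coord[OF assms] by (auto simp: euclid_ball_def coord_in_topspace)

lemma quartic_uminus:
  "quartic n (- c) (\<lambda>i. - p i) (\<lambda>i j. - a i j) (- M) x y = - quartic n c p a M x y"
  by (simp add: quartic_def sum_negf)

lemma quartic_self: "quartic n c p a M x x = c"
  by (simp add: quartic_def)

text \<open>Jets touch weakly and locally, whereas test functions touch strictly on all of
  \<open>\<Omega>\<close>. Passing from one to the other costs \<open>\<tau>\<close> times the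
  identity in the Hessian, hence \<open>\<tau>\<close> in \<open>wes\<close> because the weights sum
  to 1; \<open>\<tau>\<close> is arbitrary.\<close>

lemma subsolution_upper_jet:
  assumes n: "n \<ge> 1" and \<alpha>: "\<And>i. i \<in> {1..n} \<Longrightarrow> \<alpha> i \<ge> 0" "(\<Sum>i=1..n. \<alpha> i) = 1"
    and sub: "viscosity_subsolution n \<alpha> \<Omega> u" and \<Omega>: "\<Omega> \<subseteq> topspace (Euclidean_space n)"
    and bd: "\<And>y. y \<in> \<Omega> \<Longrightarrow> u y \<le> b" and x: "coord x \<in> \<Omega>"
    and X: "symmetric_form X" and jet: "upper_jet (Rn n) (\<lambda>x. u (coord x)) x p X"
  shows "0 \<le> wes n \<alpha> X"
proof (rule field_le_epsilon)
  fix \<tau> :: real assume \<tau>: "\<tau> > 0"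
  define X' where "X' = (\<lambda>y z. X y z + \<tau> * inner y z)"
  have X': "symmetric_form X'" unfolding X'_def by (intro symmetric_form_add X symmetric_form_scale symmetric_form_inner)
  have xR: "x \<in> Rn n" using x \<Omega> coord_in_topspace by blast
  let ?a = "\<lambda>i j. X' (axis_fsv i) (axis_fsv j)"
  obtain M where M: "\<And>y. y \<in> Rn n \<inter> coord -` \<Omega> \<Longrightarrow> y \<noteq> x \<Longrightarrow>
      u (coord y) < quartic n (u (coord x)) (coord p) ?a M (coord x) (coord y)"
    using strict_touching[OF n xR X jet _ Int_lower1 \<tau>, of "coord -` \<Omega>" b] bd unfolding X'_def by auto
  let ?\<phi> = "quartic n (u (coord x)) (coord p) ?a M (coord x)"
  have sym: "?a i j = ?a j i" for i j by (rule symmetric_form_commute[OF X'])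
  have "u y < ?\<phi> y" if "y \<in> \<Omega>" "y \<noteq> coord x" for y
  proof -
    have "y \<in> topspace (Euclidean_space n)" using that \<Omega> by blast
    note y = coord_Abs_fsv[OF this]
    have "Abs_fsv y \<noteq> x" using that y(1) by metis
    then show ?thesis using M[of "Abs_fsv y"] that y by auto
  qed
  moreover have "u (coord x) = ?\<phi> (coord x)" by (simp add: quartic_self)
  ultimately have "0 \<le> weighted_eigenvalue_sum n \<alpha> (hessian n ?\<phi> (coord x))"
    using sub x C2_on_quartic[where a = ?a, OF sym] unfolding viscosity_subsolution_def by blast
  then have "0 \<le> wes n \<alpha> X'" by (simp add: hessian_quartic[where a = ?a, OF sym] form_mat_def)
  also have "\<dots> \<le> wes n \<alpha> X + \<tau>"
    by (rule wes_mono[OF X' X n \<alpha>]) (auto simp: X'_def power2_norm_eq_inner)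
  finally show "0 \<le> wes n \<alpha> X + \<tau>" .
qed

text \<open>The same argument for \<open>- u\<close>: the negative of the quartic above
  \<open>- u\<close> is a quartic below \<open>u\<close>.\<close>

lemma supersolution_upper_jet:
  assumes n: "n \<ge> 1" and \<alpha>: "\<And>i. i \<in> {1..n} \<Longrightarrow> \<alpha> i \<ge> 0" "(\<Sum>i=1..n. \<alpha> i) = 1"
    and super: "viscosity_supersolution n \<alpha> \<Omega> u" and \<Omega>: "\<Omega> \<subseteq> topspace (Euclidean_space n)"
    and bd: "\<And>y. y \<in> \<Omega> \<Longrightarrow> - u y \<le> b" and x: "coord x \<in> \<Omega>"
    and X: "symmetric_form X" and jet: "upper_jet (Rn n) (\<lambda>x. - u (coord x)) x p X"
  shows "wes n \<alpha> (\<lambda>y z. - X y z) \<le> 0"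
proof (rule field_le_epsilon)
  fix \<tau> :: real assume \<tau>: "\<tau> > 0"
  define X' where "X' = (\<lambda>y z. X y z + \<tau> * inner y z)"
  have X': "symmetric_form X'" unfolding X'_def by (intro symmetric_form_add X symmetric_form_scale symmetric_form_inner)
  have xR: "x \<in> Rn n" using x \<Omega> coord_in_topspace by blast
  let ?a = "\<lambda>i j. X' (axis_fsv i) (axis_fsv j)"
  obtain M where M: "\<And>y. y \<in> Rn n \<inter> coord -` \<Omega> \<Longrightarrow> y \<noteq> x \<Longrightarrow>
      - u (coord y) < quartic n (- u (coord x)) (coord p) ?a M (coord x) (coord y)"
    using strict_touching[OF n xR X jet _ Int_lower1 \<tau>, of "coord -` \<Omega>" b] bd unfolding X'_def by auto
  let ?\<phi> = "quartic n (u (coord x)) (\<lambda>i. - coord p i) (\<lambda>i j. - ?a i j) (- M) (coord x)"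
  have sym: "- ?a i j = - ?a j i" for i j by (simp add: symmetric_form_commute[OF X', of "axis_fsv i"])
  have "u y > ?\<phi> y" if "y \<in> \<Omega>" "y \<noteq> coord x" for y
  proof -
    have "y \<in> topspace (Euclidean_space n)" using that \<Omega> by blast
    note y = coord_Abs_fsv[OF this]
    have "Abs_fsv y \<noteq> x" using that y(1) by metis
    then show ?thesis
      using M[of "Abs_fsv y"] that y quartic_uminus[of n "- u (coord x)" "coord p" ?a M "coord x" y] by auto
  qed
  moreover have "u (coord x) = ?\<phi> (coord x)" by (simp add: quartic_self)
  ultimately have "weighted_eigenvalue_sum n \<alpha> (hessian n ?\<phi> (coord x)) \<le> 0"
    using super x C2_on_quartic[where a = "\<lambda>i j. - ?a i j", OF sym] unfolding viscosity_supersolution_def by blast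
  then have le: "wes n \<alpha> (\<lambda>y z. - X' y z) \<le> 0"
    by (simp add: hessian_quartic[where a = "\<lambda>i j. - ?a i j", OF sym] form_mat_def)
  have "wes n \<alpha> (\<lambda>y z. - X y z) \<le> wes n \<alpha> (\<lambda>y z. - X' y z) + \<tau>"
    by (rule wes_mono[OF symmetric_form_uminus[OF X] symmetric_form_uminus[OF X'] n \<alpha>])
       (auto simp: X'_def power2_norm_eq_inner)
  with le show "wes n \<alpha> (\<lambda>y z. - X y z) \<le> 0 + \<tau>" by simp
qed

text \<open>A bounded domain lies in the compact image of a ball of \<open>Rn n\<close>, so its
  closure is compact and \<open>u\<close> is bounded there. The bound on all of
  \<open>\<Omega>\<close>, not only on the ball, is what makes the quartic test functions
  global.\<close>

lemma cont_on_closure_bounded: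
  assumes dom: "bounded_domain n \<Omega>" and cont: "cont_on n (Euclidean_space n closure_of \<Omega>) u"
  obtains b where "\<And>y. y \<in> \<Omega> \<Longrightarrow> \<bar>u y\<bar> \<le> b"
proof -
  obtain R where R: "\<Omega> \<subseteq> euclid_ball n (\<lambda>_. 0) R" using dom by (auto simp: bounded_domain_def)
  have \<Omega>: "\<Omega> \<subseteq> topspace (Euclidean_space n)" using R by (auto simp: euclid_ball_def)
  let ?K = "coord ` (Rn n \<inter> cball 0 R)" and ?C = "Euclidean_space n closure_of \<Omega>"
  have K: "compact ?K" by (intro compact_continuous_image continuous_on_coord_fun compact_Rn_cball)
  have "\<Omega> \<subseteq> ?K"
  proof
    fix y assume y: "y \<in> \<Omega>"
    have 0: "0 \<in> Rn n" "coord 0 = (\<lambda>_. 0)" by (auto simp: Rn_def)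
    have "y \<in> topspace (Euclidean_space n)" using y \<Omega> by blast
    note y' = coord_Abs_fsv[OF this]
    have "coord (Abs_fsv y) \<in> euclid_ball n (coord 0) R" using y R y' 0(2) by auto
    then have "Abs_fsv y \<in> Rn n \<inter> cball 0 R" using coord_in_euclid_ball[OF 0(1)] by auto
    then show "y \<in> ?K" using y'(1) by (metis imageI)
  qed
  moreover have "closedin (Euclidean_space n) ?K"
  proof -
    have "?K \<subseteq> {x. \<forall>i\<ge>n. x i = 0}" by (auto simp: Rn_def)
    then show ?thesis unfolding Euclidean_space_eq using compact_imp_closed[OF K] by (simp add: closed_subset)
  qed
  ultimately have "?C \<subseteq> ?K" by (rule closure_of_minimal)
  moreover have "closed ?C" by (rule closedin_Euclidean_imp_closed[OF closedin_closure_of])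
  ultimately have "compact ?C" using K by (metis compact_Int_closed inf.absorb_iff2)
  moreover have "continuous_on ?C u"
  proof -
    have "?C \<subseteq> {x. \<forall>i\<ge>n. x i = 0}"
      using closure_of_subset_topspace[of "Euclidean_space n" \<Omega>] by (simp add: topspace_Euclidean_space)
    then show ?thesis using cont by (simp add: cont_on_iff Int_absorb1)
  qed
  ultimately have "bounded (u ` ?C)" by (intro compact_imp_bounded compact_continuous_image)
  then obtain b where "\<And>y. y \<in> ?C \<Longrightarrow> \<bar>u y\<bar> \<le> b" by (auto simp: bounded_iff)
  then show thesis using that closure_of_subset[OF \<Omega>] by blast
qed

section \<open>Pointwise values against the essential supremum\<close>

lemma euclid_ball_borel: "euclid_ball n c r \<in> sets borel"
proof -
  have "euclid_ball n c r = (\<Inter>i\<in>{n..}. {y. y i = 0}) \<inter> {y. euclid_dist n c y < r}"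
    by (auto simp: euclid_ball_def topspace_Euclidean_space)
  moreover have "closed (\<Inter>i\<in>{n..}. {y :: nat \<Rightarrow> real. y i = 0})"
    by (intro closed_INT ballI closed_Collect_eq continuous_on_fun_coordinate continuous_on_const)
  moreover have "open {y. euclid_dist n c y < r}"
    unfolding euclid_dist_def L2_set_def
    by (intro open_Collect_less continuous_intros continuous_on_fun_coordinate)
  ultimately show ?thesis by (simp add: borel_closed borel_open sets.Int)
qed

lemma norm_le_sum_coord:
  assumes "h \<in> Rn n"
  shows "norm h \<le> (\<Sum>i<n. \<bar>coord h i\<bar>)"
proof -
  have "norm (\<Sum>i<n. coord h i *\<^sub>R axis_fsv i) \<le> (\<Sum>i<n. norm (coord h i *\<^sub>R axis_fsv i))"
    by (rule norm_sum)
  then show ?thesis using Rn_expand[OF assms] by (simp add: norm_axis_fsv)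
qed

text \<open>If a continuous function exceeded its essential bound at one point, it would do so on a
  small coordinate box. Pulled back along \<open>zero_extend\<close>, this box would be null for the
  product measure, whereas its measure is a product of positive lengths.\<close>

lemma abs_le_Linfty_norm:
  assumes c: "c \<in> Rn n" and cont: "continuous_on (Rn n \<inter> ball c r) (\<lambda>x. u (coord x))"
    and x: "x \<in> Rn n \<inter> ball c r"
  shows "ereal \<bar>u (coord x)\<bar> \<le> Linfty_norm n (euclid_ball n (coord c) r) u"
proof (rule ccontr)
  let ?B = "euclid_ball n (coord c) r" and ?P = "\<Pi>\<^sub>M i\<in>{..<n}. (lborel :: real measure)"
  define N where "N = Linfty_norm n ?B u"
  assume "\<not> ?thesis"
  then have "N < ereal \<bar>u (coord x)\<bar>" by (simp add: N_def)
  then obtain t where t: "N < ereal t" "t < \<bar>u (coord x)\<bar>" using ereal_dense2 by force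
  have "\<forall>\<^sub>F y in at x within (Rn n \<inter> ball c r). t < \<bar>u (coord y)\<bar>"
    using cont x by (intro order_tendstoD(1)[OF tendsto_rabs t(2)]) (simp add: continuous_on_def)
  then obtain e1 where e1: "e1 > 0"
    "\<forall>y\<in>Rn n \<inter> ball c r. y \<noteq> x \<and> dist y x < e1 \<longrightarrow> t < \<bar>u (coord y)\<bar>"
    unfolding eventually_at by blast
  have near: "t < \<bar>u (coord y)\<bar>" if "y \<in> Rn n \<inter> ball c r" "dist y x < e1" for y
    using e1(2) that t(2) by (cases "y = x") auto
  define e where "e = min e1 (r - dist c x)"
  have e: "e > 0" using e1 x by (simp add: e_def)
  \<comment> \<open>The denominator \<open>real n + 1\<close> makes the sum of \<open>n\<close>
    coordinate differences strictly less than \<open>e\<close>.\<close>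
  define d where "d = e / (real n + 1)"
  have d: "d > 0" using e by (simp add: d_def)
  define Bx where "Bx = PiE {..<n} (\<lambda>i. {coord x i - d<..<coord x i + d})"
  have box: "zero_extend n z \<in> ?B \<and> t < \<bar>u (zero_extend n z)\<bar>" if z: "z \<in> Bx" for z
  proof -
    have top: "zero_extend n z \<in> topspace (Euclidean_space n)"
      by (simp add: topspace_Euclidean_space zero_extend_def)
    define y where "y = Abs_fsv (zero_extend n z)"
    have y: "coord y = zero_extend n z" "y \<in> Rn n" using coord_Abs_fsv[OF top] by (auto simp: y_def)
    have "y - x \<in> Rn n" using y x by (simp add: Rn_def)
    then have "norm (y - x) \<le> (\<Sum>i<n. \<bar>coord (y - x) i\<bar>)" by (rule norm_le_sum_coord)
    also have "\<dots> \<le> (\<Sum>i<n. d)"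
    proof (rule sum_mono)
      fix i assume i: "i \<in> {..<n}"
      then have "z i \<in> {coord x i - d<..<coord x i + d}" using z by (auto simp: Bx_def PiE_iff)
      then show "\<bar>coord (y - x) i\<bar> \<le> d" using i by (simp add: y zero_extend_def abs_le_iff)
    qed
    also have "\<dots> < (real n + 1) * d" using d by (simp add: algebra_simps)
    also have "\<dots> = e" by (simp add: d_def)
    finally have yx: "dist y x < e" by (simp add: dist_norm)
    then have "dist c y < r" using dist_triangle[of c y x] by (simp add: e_def dist_commute)
    then have "y \<in> Rn n \<inter> ball c r" using y by simp
    then show ?thesis using near[of y] yx coord_in_euclid_ball[OF c, of y r] by (simp add: y e_def)
  qed
  have "AE y in restrict_space (lborel_Rn n) ?B. ereal \<bar>u y\<bar> \<le> N"
    unfolding N_def Linfty_norm_def by (rule esssup_AE)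
  then have "AE y in lborel_Rn n. y \<in> ?B \<longrightarrow> ereal \<bar>u y\<bar> \<le> N"
    by (subst (asm) AE_restrict_space_iff) (auto simp: lborel_Rn_def euclid_ball_borel)
  then have "AE z in ?P. zero_extend n z \<in> ?B \<longrightarrow> ereal \<bar>u (zero_extend n z)\<bar> \<le> N"
    unfolding lborel_Rn_def by (rule AE_distrD[OF zero_extend_measurable])
  then have "AE z in ?P. z \<notin> Bx"
  proof eventually_elim
    case (elim z)
    have "\<not> (zero_extend n z \<in> ?B \<and> t < \<bar>u (zero_extend n z)\<bar>)"
    proof
      assume *: "zero_extend n z \<in> ?B \<and> t < \<bar>u (zero_extend n z)\<bar>"
      then have "ereal t < ereal \<bar>u (zero_extend n z)\<bar>" by simp
      also have "\<dots> \<le> N" using elim * by blast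
      finally show False using t(1) by simp
    qed
    then show ?case using box by blast
  qed
  moreover have Bx: "Bx \<in> sets ?P" unfolding Bx_def by (rule sets_PiM_I_finite) auto
  ultimately have "emeasure ?P Bx = 0"
    by (subst (asm) AE_iff_measurable[OF Bx]) (use sets.sets_into_space[OF Bx] in auto)
  moreover have "emeasure ?P Bx = (\<Prod>i<n. emeasure lborel {coord x i - d<..<coord x i + d})"
  proof -
    interpret product_sigma_finite "\<lambda>_::nat. lborel :: real measure" by standard
    show ?thesis unfolding Bx_def by (rule emeasure_PiM) auto
  qed
  ultimately show False using d by simp
qed

theorem corollary1p1:
  shows "\<exists>C :: real \<Rightarrow> real \<Rightarrow> real \<Rightarrow> real.
    \<forall>(n :: nat) (\<alpha> :: nat \<Rightarrow> real) (\<delta> :: real).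
      1 \<le> n \<and> (\<forall>i\<in>{1..n}. \<alpha> i \<ge> 0) \<and> min (\<alpha> 1) (\<alpha> n) > 0 \<and> (\<Sum>i=1..n. \<alpha> i) = 1 \<and>
      0 < \<delta> \<and> \<delta> < 1 / 2 \<longrightarrow>
        C \<delta> (\<alpha> 1) (\<alpha> n) > 0 \<and>
        (\<forall>\<Omega> u. bounded_domain n \<Omega> \<and> viscosity_solution n \<alpha> \<Omega> u \<longrightarrow>
          (\<forall>c\<in>topspace (Euclidean_space n). \<forall>r>0. euclid_ball n c (2 * r) \<subseteq> \<Omega> \<longrightarrow>
            (\<forall>x\<in>euclid_ball n c r. \<forall>z\<in>euclid_ball n c r.
              ereal \<bar>u x - u z\<bar> \<le>
                ereal (C \<delta> (\<alpha> 1) (\<alpha> n)) * Linfty_norm n (euclid_ball n c (2 * r)) u *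
                ereal (euclid_dist n x z powr \<delta> / r powr \<delta>))))"
proof -
  \<comment> \<open>A function of \<delta> and the two extreme weights only, fixed before the
    dimension and the other weights are chosen.\<close>
  define C where "C = (\<lambda>\<delta> a b :: real. 40 / (\<delta> * (1 - 2 * \<delta>) * min a b) + 9)"
  show ?thesis
  proof (intro exI[of _ C] allI impI conjI ballI; elim conjE)
    fix n :: nat and \<alpha> :: "nat \<Rightarrow> real" and \<delta> :: real
    assume n: "1 \<le> n" and \<alpha>: "\<forall>i\<in>{1..n}. \<alpha> i \<ge> 0" "min (\<alpha> 1) (\<alpha> n) > 0" "(\<Sum>i=1..n. \<alpha> i) = 1"
      and \<delta>: "0 < \<delta>" "\<delta> < 1 / 2"
    have "40 / (\<delta> * (1 - 2 * \<delta>) * min (\<alpha> 1) (\<alpha> n)) > 0" using \<alpha>(2) \<delta> by (intro divide_pos_pos mult_pos_pos) auto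
    then show C_pos: "C \<delta> (\<alpha> 1) (\<alpha> n) > 0" unfolding C_def by linarith
    fix \<Omega> u c r x z
    assume dom: "bounded_domain n \<Omega>" and sol: "viscosity_solution n \<alpha> \<Omega> u"
      and c_top: "c \<in> topspace (Euclidean_space n)" and r: "0 < r" and ball_sub: "euclid_ball n c (2 * r) \<subseteq> \<Omega>"
      and xB: "x \<in> euclid_ball n c r" and zB: "z \<in> euclid_ball n c r"
    obtain c' x' z' where eqs: "c = coord c'" "x = coord x'" "z = coord z'" and R: "c' \<in> Rn n" "x' \<in> Rn n" "z' \<in> Rn n"
    proof -
      have "x \<in> topspace (Euclidean_space n)" "z \<in> topspace (Euclidean_space n)"
        using xB zB by (auto simp: euclid_ball_def)
      then show thesis using that[of "Abs_fsv c" "Abs_fsv x" "Abs_fsv z"] c_top coord_Abs_fsv by simp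
    qed
    have x': "x' \<in> Rn n \<inter> ball c' r" and z': "z' \<in> Rn n \<inter> ball c' r"
      using xB zB coord_in_euclid_ball[OF R(1)] unfolding eqs by auto
    have x'2: "x' \<in> Rn n \<inter> ball c' (2 * r)" and z'2: "z' \<in> Rn n \<inter> ball c' (2 * r)" using x' z' r by auto
    have in_\<Omega>: "coord y \<in> \<Omega>" if "y \<in> Rn n \<inter> ball c' (2 * r)" for y
      using that ball_sub coord_in_euclid_ball[OF R(1)] unfolding eqs by blast
    have \<Omega>: "\<Omega> \<subseteq> topspace (Euclidean_space n)" using dom by (auto simp: bounded_domain_def euclid_ball_def)
    have cont: "cont_on n (Euclidean_space n closure_of \<Omega>) u" and sub: "viscosity_subsolution n \<alpha> \<Omega> u"
      and super: "viscosity_supersolution n \<alpha> \<Omega> u" using sol by (auto simp: viscosity_solution_def)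
    obtain b where b: "\<And>y. y \<in> \<Omega> \<Longrightarrow> \<bar>u y\<bar> \<le> b" using cont_on_closure_bounded[OF dom cont] by blast
    have contB: "continuous_on (Rn n \<inter> ball c' (2 * r)) (\<lambda>x. u (coord x))"
    proof (rule continuous_on_compose2[OF cont[unfolded cont_on_iff] continuous_on_coord_fun])
      show "coord ` (Rn n \<inter> ball c' (2 * r)) \<subseteq> {x. \<forall>i\<ge>n. x i = 0} \<inter> Euclidean_space n closure_of \<Omega>"
        using in_\<Omega> closure_of_subset[OF \<Omega>] by (auto simp: Rn_def)
    qed
    define N where "N = Linfty_norm n (euclid_ball n c (2 * r)) u"
    have le_N: "ereal \<bar>u (coord y)\<bar> \<le> N" if "y \<in> Rn n \<inter> ball c' (2 * r)" for y
      using abs_le_Linfty_norm[OF R(1) contB that] by (simp add: N_def eqs)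
    have D: "euclid_dist n x z powr \<delta> / r powr \<delta> = (dist x' z' / r) powr \<delta>"
      using r by (simp add: eqs euclid_dist_coord[OF R(2,3)] powr_divide)
    show "ereal \<bar>u x - u z\<bar> \<le> ereal (C \<delta> (\<alpha> 1) (\<alpha> n)) * Linfty_norm n (euclid_ball n c (2 * r)) u *
                ereal (euclid_dist n x z powr \<delta> / r powr \<delta>)"
    \<comment> \<open>Equal points come first: both sides are then 0, even for an infinite norm, as
      infinity times 0 is 0. For different points the last factor is positive, and an infinite norm
      makes the right side infinite.\<close>
    proof (cases "x' = z'")
      case True
      then show ?thesis by (simp add: eqs euclid_dist_coord[OF R(3,3)] zero_ereal_def[symmetric])
    next
      case False
      then have pos: "(dist x' z' / r) powr \<delta> > 0" using r by simp
      show ?thesis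
      proof (cases "N = \<infinity>")
        case True
        then show ?thesis using C_pos pos unfolding D N_def[symmetric] by simp
      next
        case False
        have "0 \<le> N" using le_N[OF x'2] by (rule order.trans[rotated]) simp
        with False obtain A where A: "N = ereal A" "A \<ge> 0" by (cases N) auto
        have bound: "\<bar>u (coord y)\<bar> \<le> A" if "y \<in> Rn n \<inter> ball c' (2 * r)" for y
          using le_N[OF that] by (simp add: A)
        have "\<bar>u x - u z\<bar> \<le> C \<delta> (\<alpha> 1) (\<alpha> n) * A * (dist x' z' / r) powr \<delta>"
        \<comment> \<open>\<open>holder_estimate_Rn\<close> requires a positive bound, as its
          regularisation parameter is divided by \<open>A\<close>; for norm 0 the function vanishes
          at both points.\<close>
        proof (cases "A = 0")
          case True
          then show ?thesis using bound[OF x'2] bound[OF z'2] by (simp add: eqs)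
        next
          case False
          then have A_pos: "A > 0" using A by simp
          have est: "u (coord y) - u (coord y') \<le> C \<delta> (\<alpha> 1) (\<alpha> n) * A * (dist y y' / r) powr \<delta>"
            if "y \<in> Rn n \<inter> ball c' r" "y' \<in> Rn n \<inter> ball c' r" for y y'
            unfolding C_def
          proof (rule holder_estimate_Rn[OF n _ \<alpha>(3,2) \<delta> r A_pos R(1) contB bound _ _ that])
            show "0 \<le> \<alpha> i" if "i \<in> {1..n}" for i using \<alpha>(1) that by blast
            show "0 \<le> wes n \<alpha> X" if "y \<in> Rn n \<inter> ball c' (2 * r)" "symmetric_form X"
              "upper_jet (Rn n) (\<lambda>x. u (coord x)) y p X" for y p X
              using \<alpha>(1) b by (intro subsolution_upper_jet[OF n _ \<alpha>(3) sub \<Omega> _ in_\<Omega>[OF that(1)] that(2,3), of b])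
                (auto simp: abs_le_iff)
            show "wes n \<alpha> (\<lambda>y z. - X y z) \<le> 0" if "y \<in> Rn n \<inter> ball c' (2 * r)" "symmetric_form X"
              "upper_jet (Rn n) (\<lambda>x. - u (coord x)) y p X" for y p X
              using \<alpha>(1) b by (intro supersolution_upper_jet[OF n _ \<alpha>(3) super \<Omega> _ in_\<Omega>[OF that(1)] that(2,3), of b])
                (auto simp: abs_le_iff)
          qed
          show ?thesis using est[OF x' z'] est[OF z' x'] by (simp add: eqs abs_le_iff dist_commute)
        qed
        then show ?thesis unfolding D N_def[symmetric] A by simp
      qed
    qed
  qed
qed

end
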